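(* Let $0\ne\xi\in c_o^*$. Then $$\widehat{(\xi)}=\begin{cases}F&\text{if }\xi\in\ell^1,\\(\widehat\xi)&\text{if }\xi\notin\ell^1.\end{cases}$$
   Context: $H$ is a separable infinite-dimensional complex Hilbert space. "Ideal" means a two-sided ideal of $B(H)$ contained in the compact operators; $F$ is the ideal of finite rank operators. $c_o^*$ is the set of nonnegative monotone nonincreasing sequences converging to $0$. $\Sigma(I):=\{s(X)\mid X\in I\}\subset c_o^*$, where $s(X)$ is the sequence of s-numbers (singular values) of $X$; an ideal is determined by $\Sigma(I)$. For $\xi\in c_o^*$, $(\xi)$ is the principal ideal generated by $\mathrm{diag}\,\xi$; $\eta\in\Sigma((\xi))$ iff $\eta=O(D_m\xi)$ for some $m\in\mathbb N$, where $(D_m\xi)_n:=\xi_{\lceil n/m\rceil}$. For $\xi\in c_o^*$ put $(\xi_a)_n:=\frac1n\sum_{j=1}^n\xi_j$. The arithmetic mean $I_a$ of an ideal $I$ is the ideal with $\Sigma(I_a)=\{\xi\in c_o^*\mid\xi=O(\eta_a)\text{ for some }\eta\in\Sigma(I)\}$. For an ideal $I$, $\widehat I:=\bigcap\{J\mid J\text{ an ideal},\ J_a\supset I_a\}$. For a sequence $\xi\in c_o^*\setminus\ell^1$, $\nu(\xi)_n:=\min\{k\in\mathbb N\mid\sum_{i=1}^k\xi_i\ge n\xi_1\}$ and $\widehat\xi\in c_o^*$ is the sequence $\widehat\xi_n:=(\xi_a)_{\nu(\xi)_n}$. *)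

theory Defs
  imports "HOL-Analysis.Analysis" "HOL-Algebra.Ideal"
begin

section \<open>Complex Hilbert spaces\<close>

text \<open>
  The underlying real Banach space comes from the library.  The inner product is linear in its
  first and conjugate linear in its second argument; it is positive definite because it induces
  the norm.
\<close>

class complex_hilbert = banach +
  fixes scaleC :: "complex \<Rightarrow> 'a \<Rightarrow> 'a" (infixr "*\<^sub>C" 75)
    and cinner :: "'a \<Rightarrow> 'a \<Rightarrow> complex"
  assumes scaleC_add_right: "c *\<^sub>C (x + y) = c *\<^sub>C x + c *\<^sub>C y"
    and scaleC_add_left: "(c + d) *\<^sub>C x = c *\<^sub>C x + d *\<^sub>C x"
    and scaleC_scaleC: "c *\<^sub>C (d *\<^sub>C x) = (c * d) *\<^sub>C x"
    and scaleC_of_real: "complex_of_real r *\<^sub>C x = r *\<^sub>R x"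
    and cinner_commute: "cinner x y = cnj (cinner y x)"
    and cinner_add_left: "cinner (x + y) z = cinner x z + cinner y z"
    and cinner_scaleC_left: "cinner (c *\<^sub>C x) y = c * cinner x y"
    and cinner_self: "cinner x x = complex_of_real ((norm x)\<^sup>2)"

global_interpretation complex_vector:
  vector_space "scaleC :: complex \<Rightarrow> 'h \<Rightarrow> 'h :: complex_hilbert"
  defines cspan = complex_vector.span
    and csubspace = complex_vector.subspace
    and cdependent = complex_vector.dependent
    and crepresentation = complex_vector.representation
    and cextend_basis = complex_vector.extend_basis
    and cdim = complex_vector.dim
proof unfold_locales
  show "1 *\<^sub>C x = x" for x :: 'h
    using scaleC_of_real[of 1 x] by simp
qed (simp_all add: scaleC_add_right scaleC_add_left scaleC_scaleC)

definition infinite_dimensional :: "'h::complex_hilbert itself \<Rightarrow> bool" where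
  "infinite_dimensional _ \<longleftrightarrow> (\<nexists>B :: 'h set. finite B \<and> cspan B = UNIV)"

definition orthonormal_basis :: "(nat \<Rightarrow> 'h::complex_hilbert) \<Rightarrow> bool" where
  "orthonormal_basis e \<longleftrightarrow>
     (\<forall>i j. cinner (e i) (e j) = (if i = j then 1 else 0)) \<and> closure (cspan (range e)) = UNIV"


section \<open>Bounded, compact and finite rank operators\<close>

definition bounded_clinear :: "('h::complex_hilbert \<Rightarrow> 'h) \<Rightarrow> bool" where
  "bounded_clinear X \<longleftrightarrow> bounded_linear X \<and> (\<forall>c x. X (c *\<^sub>C x) = c *\<^sub>C X x)"

definition BH :: "('h::complex_hilbert \<Rightarrow> 'h) ring" where
  "BH = \<lparr> carrier = {X. bounded_clinear X}, monoid.mult = (\<circ>), one = id,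
          zero = (\<lambda>_. 0), add = (\<lambda>X Y x. X x + Y x) \<rparr>"

definition compact_ops :: "('h::complex_hilbert \<Rightarrow> 'h) set" where
  "compact_ops = {X. bounded_clinear X \<and> compact (closure (X ` cball 0 1))}"

definition finite_rank_ops :: "('h::complex_hilbert \<Rightarrow> 'h) set" where
  "finite_rank_ops = {X. bounded_clinear X \<and> (\<exists>B. finite B \<and> range X \<subseteq> cspan B)}"

lemma ring_BH: "ring (BH :: ('h::complex_hilbert \<Rightarrow> 'h) ring)"
proof -
  have add: "bounded_clinear (\<lambda>x. X x + Y x)"
    if "bounded_clinear X" "bounded_clinear Y" for X Y :: "'h \<Rightarrow> 'h"
    using that unfolding bounded_clinear_def by (auto intro: bounded_linear_add simp: scaleC_add_right)
  have comp: "bounded_clinear (X \<circ> Y)"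
    if "bounded_clinear X" "bounded_clinear Y" for X Y :: "'h \<Rightarrow> 'h"
    using that unfolding bounded_clinear_def comp_def by (auto intro: bounded_linear_compose)
  have zero: "bounded_clinear (\<lambda>_. 0 :: 'h)" and one: "bounded_clinear (id :: 'h \<Rightarrow> 'h)"
    unfolding bounded_clinear_def id_def by auto
  have neg: "bounded_clinear (\<lambda>x. - X x)" if "bounded_clinear X" for X :: "'h \<Rightarrow> 'h"
    using that unfolding bounded_clinear_def
    by (auto intro: bounded_linear_minus)
  have lin: "X (x + y) = X x + X y" if "bounded_clinear X" for X :: "'h \<Rightarrow> 'h" and x y
    using that unfolding bounded_clinear_def by (simp add: bounded_linear.linear linear_add)
  show ?thesis
  proof (rule ringI)
    show "abelian_group (BH :: ('h \<Rightarrow> 'h) ring)"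
    proof (rule abelian_groupI)
      fix X :: "'h \<Rightarrow> 'h" assume "X \<in> carrier BH"
      then show "\<exists>Y\<in>carrier BH. Y \<oplus>\<^bsub>BH\<^esub> X = \<zero>\<^bsub>BH\<^esub>"
        using neg[of X] by (intro bexI[of _ "\<lambda>x. - X x"]) (auto simp: BH_def)
    qed (use add zero in \<open>auto simp: BH_def fun_eq_iff add_ac\<close>)
    show "Group.monoid (BH :: ('h \<Rightarrow> 'h) ring)"
      by (rule monoidI) (use comp one in \<open>auto simp: BH_def comp_assoc\<close>)
  qed (use lin in \<open>auto simp: BH_def fun_eq_iff\<close>)
qed

text \<open>Throughout, an ideal is a two-sided ideal of \<open>B(H)\<close> contained in the compact operators.\<close>

definition op_ideal :: "('h::complex_hilbert \<Rightarrow> 'h) set \<Rightarrow> bool" where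
  "op_ideal I \<longleftrightarrow> ideal I BH \<and> I \<subseteq> compact_ops"


section \<open>Sequences\<close>

text \<open>
  The sequences of the theory start at index 1.  Here they are functions on \<open>nat\<close> starting
  at index 0, so that \<open>\<xi> n\<close> stands for $\xi_{n+1}$.
\<close>

definition c0star :: "(nat \<Rightarrow> real) set" where
  "c0star = {\<xi>. (\<forall>n. 0 \<le> \<xi> n) \<and> decseq \<xi> \<and> \<xi> \<longlonglongrightarrow> 0}"

definition amean :: "(nat \<Rightarrow> real) \<Rightarrow> nat \<Rightarrow> real" where
  "amean \<xi> n = (\<Sum>j\<le>n. \<xi> j) / real (n + 1)"

text \<open>
  In \<open>\<nu> \<xi> n\<close> both the argument \<open>n\<close> and the value \<open>k\<close> are counted from 1, as in
  $\nu(\xi)_n = \min\{k \in \mathbb{N} \mid \sum_{i=1}^k \xi_i \ge n \xi_1\}$; the shift to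
  indices from 0 takes place in \<open>hat_seq\<close>.
\<close>

definition \<nu> :: "(nat \<Rightarrow> real) \<Rightarrow> nat \<Rightarrow> nat" where
  "\<nu> \<xi> n = (LEAST k. 1 \<le> k \<and> real n * \<xi> 0 \<le> (\<Sum>i<k. \<xi> i))"

definition hat_seq :: "(nat \<Rightarrow> real) \<Rightarrow> nat \<Rightarrow> real" where
  "hat_seq \<xi> n = amean \<xi> (\<nu> \<xi> (n + 1) - 1)"

text \<open>
  The bound is required for all \<open>n\<close>.  For \<open>\<xi>, \<eta> \<in> c0star\<close> this differs from the eventual
  bound of Landau's symbol only if \<open>\<eta>\<close> is eventually 0.  An arithmetic mean is eventually 0 only
  if it is identically 0, and there the bound for all \<open>n\<close> makes the arithmetic mean of the zero
  ideal the zero ideal.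
\<close>

definition big_O :: "(nat \<Rightarrow> real) \<Rightarrow> (nat \<Rightarrow> real) \<Rightarrow> bool" where
  "big_O \<xi> \<eta> \<longleftrightarrow> (\<exists>C. \<forall>n. \<xi> n \<le> C * \<eta> n)"


section \<open>Singular values and characteristic sets\<close>

definition cadjoint :: "('h::complex_hilbert \<Rightarrow> 'h) \<Rightarrow> 'h \<Rightarrow> 'h" where
  "cadjoint X = (THE Y. \<forall>x y. cinner (X x) y = cinner x (Y y))"

text \<open>
  The singular values of a compact operator \<open>X\<close> are the square roots of the eigenvalues of
  \<open>X\<^sup>*X\<close>, in decreasing order and repeated according to multiplicity.  If there are only finitely
  many nonzero ones, then the sequence is continued by zeros.  If there are infinitely many, then
  zero does not occur in it, even if \<open>X\<close> has a nontrivial kernel.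
\<close>

definition s_numbers :: "('h::complex_hilbert \<Rightarrow> 'h) \<Rightarrow> nat \<Rightarrow> real" where
  "s_numbers X = (THE s. s \<in> c0star \<and>
     (\<forall>t>0. card {n. s n = t} = cdim {v. cadjoint X (X v) = complex_of_real (t\<^sup>2) *\<^sub>C v}))"

definition char_set :: "('h::complex_hilbert \<Rightarrow> 'h) set \<Rightarrow> (nat \<Rightarrow> real) set" where
  "char_set I = s_numbers ` I"


section \<open>Principal ideals, arithmetic means and the hat of an ideal\<close>

definition diag_op :: "(nat \<Rightarrow> 'h::complex_hilbert) \<Rightarrow> (nat \<Rightarrow> real) \<Rightarrow> 'h \<Rightarrow> 'h" where
  "diag_op e \<xi> x = (\<Sum>n. (complex_of_real (\<xi> n) * cinner x (e n)) *\<^sub>C e n)"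

definition principal_ideal ::
    "(nat \<Rightarrow> 'h::complex_hilbert) \<Rightarrow> (nat \<Rightarrow> real) \<Rightarrow> ('h \<Rightarrow> 'h) set" where
  "principal_ideal e \<xi> = Idl\<^bsub>BH\<^esub> {diag_op e \<xi>}"

definition am_ideal :: "('h::complex_hilbert \<Rightarrow> 'h) set \<Rightarrow> ('h \<Rightarrow> 'h) set" where
  "am_ideal I = (THE J. op_ideal J \<and>
     char_set J = {\<xi> \<in> c0star. \<exists>\<eta> \<in> char_set I. big_O \<xi> (amean \<eta>)})"

definition hat_ideal :: "('h::complex_hilbert \<Rightarrow> 'h) set \<Rightarrow> ('h \<Rightarrow> 'h) set" where
  "hat_ideal I = \<Inter>{J. op_ideal J \<and> am_ideal I \<subseteq> am_ideal J}"

end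

theory Submission
  imports Defs
begin

text \<open>
  For an ideal \<open>J\<close>, \<open>J\<^sub>a \<supseteq> (\<xi>)\<^sub>a\<close> holds iff \<open>\<xi>\<^sub>a = O(\<eta>\<^sub>a)\<close> for some \<open>\<eta>\<close> in the characteristic set of \<open>J\<close>.  If \<open>\<xi>\<close>
  is summable, then \<open>\<xi>\<^sub>a\<close> is of order \<open>1/n\<close>, so every nonzero ideal qualifies.  Otherwise, splitting
  the partial sum of \<open>\<eta>\<close> up to \<open>\<nu>(\<xi>)\<^sub>n\<close> at a small multiple of \<open>n\<close> shows that \<open>\<xi>\<^sub>a = O(\<eta>\<^sub>a)\<close> forces the
  hat of \<open>\<xi>\<close> into \<open>(\<eta>)\<close>; conversely, any \<open>\<zeta>\<close> outside the ideal of the hat is avoided by some step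
  sequence \<open>\<eta>\<close> with \<open>\<xi>\<^sub>a = O(\<eta>\<^sub>a)\<close>.

  The correspondence between ideals and characteristic sets rests on the singular value
  decomposition of a compact operator \<open>X\<close>, obtained by successively maximising \<open>norm (X x)\<close> over the
  unit vectors orthogonal to the previous maximisers; no adjoint is needed for this.
\<close>

section \<open>Bessel series\<close>

text \<open>The sequence \<open>\<nu>\<close> measures what a bounded sequence can do. The first k
  terms of \<open>\<eta>\<close> sum to at most \<open>k * \<eta> 0\<close>, so where the partial
  sums of \<open>\<xi>\<close> exceed this, the later terms must supply the rest; this forces
  \<open>\<eta>\<close>, at an index comparable with n, to be at least of the order of the mean of
  \<open>\<xi>\<close> up to \<open>\<nu> \<xi> n\<close>. The intersection need not be attained.
  For 1/n the hat decays like n exp(-n), so it is summable and all means from its ideal are of order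
  at most 1/n, whereas the mean of 1/n is of order log n / n. Hence the upper inclusion cannot be
  tested on the ideal of the hat itself, and each sequence outside it needs its own
  \<open>\<eta>\<close>. With indices from 0 the ampliation D_m becomes \<open>n div m\<close>,
  since the ceiling of (n+1)/m is n div m + 1. The adjoint, the s-numbers and the mean of an ideal
  are definite descriptions, so existence and uniqueness precede every use; the singular expansion
  supplies existence for the first two.\<close>

lemma norm_scaleC: "norm (c *\<^sub>C x) = cmod c * norm x"
proof -
  have "complex_of_real ((norm (c *\<^sub>C x))\<^sup>2) = cinner (c *\<^sub>C x) (c *\<^sub>C x)"
    by (simp only: cinner_self)
  also have "\<dots> = c * cinner x (c *\<^sub>C x)" by (simp only: cinner_scaleC_left)
  also have "cinner x (c *\<^sub>C x) = cnj (c * cinner x x)"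
    by (subst cinner_commute) (simp only: cinner_scaleC_left)
  also have "c * cnj (c * cinner x x) = complex_of_real ((cmod c * norm x)\<^sup>2)"
    by (simp only: cinner_self complex_cnj_mult complex_cnj_complex_of_real)
      (simp add: power_mult_distrib complex_norm_square flip: mult.assoc del: of_real_power)
  finally have "(norm (c *\<^sub>C x))\<^sup>2 = (cmod c * norm x)\<^sup>2"
    unfolding of_real_eq_iff .
  then show ?thesis by (simp add: power2_eq_iff_nonneg)
qed

lemma cinner_scaleC_right: "cinner x (c *\<^sub>C y) = cnj c * cinner x y"
  by (subst cinner_commute, subst (2) cinner_commute) (simp add: cinner_scaleC_left)

lemma cinner_add_right: "cinner x (y + z) = cinner x y + cinner x z"
  by (subst cinner_commute, subst (2) cinner_commute, subst (3) cinner_commute)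
    (simp add: cinner_add_left)

lemma norm_add_sq: "(norm (x + y :: 'h::complex_hilbert))\<^sup>2 = (norm x)\<^sup>2 + (norm y)\<^sup>2 + 2 * Re (cinner x y)"
proof -
  have "complex_of_real ((norm (x + y))\<^sup>2) = cinner x x + cinner y y + (cinner x y + cnj (cinner x y))"
    unfolding cinner_self[symmetric]
    by (simp add: cinner_add_left cinner_add_right) (metis cinner_commute)
  then have "complex_of_real ((norm (x + y))\<^sup>2)
      = complex_of_real ((norm x)\<^sup>2 + (norm y)\<^sup>2 + 2 * Re (cinner x y))"
    by (simp add: cinner_self complex_add_cnj)
  then show ?thesis unfolding of_real_eq_iff .
qed

lemma cmod_cinner_le: "cmod (cinner x y) \<le> norm x * norm (y :: 'h::complex_hilbert)"
proof (cases "y = 0")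
  case True
  have "cinner x (0 *\<^sub>C y) = 0" unfolding cinner_scaleC_right by simp
  then show ?thesis using True by simp
next
  case False
  define b where "b = (norm y)\<^sup>2"
  define c where "c = cinner x y"
  \<comment> \<open>With this coefficient \<open>x + d *\<^sub>C y\<close> is orthogonal to y, which
    makes its norm minimal.\<close>
  define d where "d = - (c / of_real b)"
  have b: "b > 0" using False by (simp add: b_def)
  have "0 \<le> (norm (x + d *\<^sub>C y))\<^sup>2" by simp
  also have "\<dots> = (norm x)\<^sup>2 + (cmod d)\<^sup>2 * b + 2 * Re (cnj d * c)"
    by (simp add: norm_add_sq norm_scaleC cinner_scaleC_right power_mult_distrib b_def c_def)
  also have "cnj d * c = of_real (- ((cmod c)\<^sup>2 / b))"
    by (simp add: d_def complex_norm_square mult.commute del: of_real_power)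
  also have "(cmod d)\<^sup>2 * b = (cmod c)\<^sup>2 / b"
    using b by (simp add: d_def norm_divide power_divide power2_eq_square)
  finally have "(cmod c)\<^sup>2 / b \<le> (norm x)\<^sup>2" by simp
  then have "(cmod c)\<^sup>2 \<le> (norm x * norm y)\<^sup>2"
    using b by (simp add: divide_le_eq power_mult_distrib b_def)
  then show ?thesis unfolding c_def by (rule power2_le_imp_le) simp
qed

interpretation cinner: bounded_bilinear "cinner :: 'h::complex_hilbert \<Rightarrow> 'h \<Rightarrow> complex"
proof
  fix r :: real and x y z :: 'h
  show "cinner (r *\<^sub>R x) y = r *\<^sub>R cinner x y"
    unfolding scaleC_of_real[symmetric] by (simp add: cinner_scaleC_left scaleR_conv_of_real)
  show "cinner x (r *\<^sub>R y) = r *\<^sub>R cinner x y"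
    unfolding scaleC_of_real[symmetric] by (simp add: cinner_scaleC_right scaleR_conv_of_real)
  show "\<exists>K. \<forall>a b. norm (cinner a b :: complex) \<le> norm (a::'h) * norm b * K"
    by (intro exI[of _ 1]) (auto intro: cmod_cinner_le)
qed (simp_all add: cinner_add_left cinner_add_right)

interpretation scaleC: bounded_bilinear "scaleC :: complex \<Rightarrow> 'h::complex_hilbert \<Rightarrow> 'h"
proof
  fix r :: real and x y z :: 'h and c :: complex
  show "(r *\<^sub>R c) *\<^sub>C x = r *\<^sub>R c *\<^sub>C x"
    by (simp add: scaleR_conv_of_real scaleC_of_real[symmetric] scaleC_scaleC)
  show "c *\<^sub>C r *\<^sub>R x = r *\<^sub>R c *\<^sub>C x"
    by (simp add: scaleC_of_real[symmetric] scaleC_scaleC mult.commute)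
  show "\<exists>K. \<forall>a b. norm (a *\<^sub>C b :: 'h) \<le> norm a * norm b * K"
    by (intro exI[of _ 1]) (simp add: norm_scaleC)
qed (simp_all add: scaleC_add_right scaleC_add_left)

lemma norm_diff_sq: "(norm (x - y :: 'h::complex_hilbert))\<^sup>2 = (norm x)\<^sup>2 + (norm y)\<^sup>2 - 2 * Re (cinner x y)"
  using norm_add_sq[of x "- y"] by (simp add: cinner.minus_right)

section \<open>Orthogonal sums and Bessel's inequality\<close>

lemma norm_sum_orthogonal_sq:
  fixes b :: "'i \<Rightarrow> 'h::complex_hilbert"
  assumes "finite A" and "\<And>i j. i \<in> A \<Longrightarrow> j \<in> A \<Longrightarrow> i \<noteq> j \<Longrightarrow> cinner (b i) (b j) = 0"
  shows "(norm (\<Sum>i\<in>A. b i))\<^sup>2 = (\<Sum>i\<in>A. (norm (b i))\<^sup>2)"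
  using assms
proof (induction A)
  case (insert a A)
  have "cinner (b a) (\<Sum>i\<in>A. b i) = 0"
    using insert by (auto simp: cinner.sum_right intro!: sum.neutral)
  then show ?case using insert by (simp add: norm_add_sq)
qed simp

text \<open>By Pythagoras the blocks of the series inherit the Cauchy condition from the squared
  norms; completeness and continuity of the norm do the rest.\<close>

lemma summable_orthogonal:
  fixes b :: "nat \<Rightarrow> 'h::complex_hilbert"
  assumes orth: "\<And>i j. i \<noteq> j \<Longrightarrow> cinner (b i) (b j) = 0"
    and summ: "summable (\<lambda>i. (norm (b i))\<^sup>2)"
  shows "summable b" and "(norm (suminf b))\<^sup>2 = (\<Sum>i. (norm (b i))\<^sup>2)"
proof -
  show s: "summable b"
    unfolding summable_Cauchy
  proof (intro allI impI)
    fix e :: real assume "e > 0"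
    then obtain N where N: "\<And>m n. m \<ge> N \<Longrightarrow> norm (\<Sum>i=m..<n. (norm (b i))\<^sup>2) < e\<^sup>2"
      using summ unfolding summable_Cauchy by (metis zero_less_power)
    have "norm (sum b {m..<n}) < e" if "m \<ge> N" for m n
    proof -
      have "(norm (sum b {m..<n}))\<^sup>2 = (\<Sum>i=m..<n. (norm (b i))\<^sup>2)"
        by (rule norm_sum_orthogonal_sq) (use orth in auto)
      also have "\<dots> < e\<^sup>2" using N[OF that, of n] by simp
      finally show ?thesis using \<open>e > 0\<close> by (simp add: power2_less_imp_less)
    qed
    then show "\<exists>N. \<forall>m\<ge>N. \<forall>n. norm (sum b {m..<n}) < e" by blast
  qed
  have "(\<lambda>n. (norm (\<Sum>i<n. b i))\<^sup>2) \<longlonglongrightarrow> (norm (suminf b))\<^sup>2"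
    by (intro tendsto_power tendsto_norm summable_LIMSEQ s)
  moreover have "(norm (\<Sum>i<n. b i))\<^sup>2 = (\<Sum>i<n. (norm (b i))\<^sup>2)" for n
    by (rule norm_sum_orthogonal_sq) (use orth in auto)
  ultimately have "(\<lambda>n. \<Sum>i<n. (norm (b i))\<^sup>2) \<longlonglongrightarrow> (norm (suminf b))\<^sup>2" by simp
  then have "(\<lambda>i. (norm (b i))\<^sup>2) sums (norm (suminf b))\<^sup>2" by (simp add: sums_def)
  then show "(norm (suminf b))\<^sup>2 = (\<Sum>i. (norm (b i))\<^sup>2)" by (simp add: sums_unique)
qed

lemma bessel_finite:
  fixes a :: "'i \<Rightarrow> 'h::complex_hilbert"
  assumes "finite A" and orth: "\<And>i j. i \<noteq> j \<Longrightarrow> cinner (a i) (a j) = 0"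
    and le: "\<And>i. norm (a i) \<le> 1"
  shows "(\<Sum>i\<in>A. (cmod (cinner x (a i)))\<^sup>2) \<le> (norm x)\<^sup>2"
proof -
  define y where "y = (\<Sum>i\<in>A. cinner x (a i) *\<^sub>C a i)"
  let ?S = "\<Sum>i\<in>A. (cmod (cinner x (a i)))\<^sup>2"
  have 1: "cinner x y = of_real ?S"
    by (simp add: y_def cinner.sum_right cinner_scaleC_right complex_norm_square mult.commute
        del: of_real_power)
  have "(norm y)\<^sup>2 = (\<Sum>i\<in>A. (norm (cinner x (a i) *\<^sub>C a i))\<^sup>2)"
    unfolding y_def
    by (rule norm_sum_orthogonal_sq) (simp_all add: assms cinner_scaleC_left cinner_scaleC_right)
  also have "\<dots> \<le> ?S"
  proof (rule sum_mono)
    fix i assume "i \<in> A"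
    have "(norm (cinner x (a i) *\<^sub>C a i))\<^sup>2 = (cmod (cinner x (a i)))\<^sup>2 * (norm (a i))\<^sup>2"
      by (simp add: norm_scaleC power_mult_distrib)
    also have "\<dots> \<le> (cmod (cinner x (a i)))\<^sup>2 * 1"
      by (intro mult_left_mono) (use le[of i] in \<open>auto simp: power_le_one\<close>)
    finally show "(norm (cinner x (a i) *\<^sub>C a i))\<^sup>2 \<le> (cmod (cinner x (a i)))\<^sup>2" by simp
  qed
  finally have 2: "(norm y)\<^sup>2 \<le> ?S" .
  have "0 \<le> (norm (x - y))\<^sup>2" by simp
  also have "\<dots> = (norm x)\<^sup>2 + (norm y)\<^sup>2 - 2 * ?S" using 1 by (simp only: norm_diff_sq Re_complex_of_real)
  finally show ?thesis using 2 by linarith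
qed

lemma bessel:
  fixes a :: "nat \<Rightarrow> 'h::complex_hilbert"
  assumes orth: "\<And>i j. i \<noteq> j \<Longrightarrow> cinner (a i) (a j) = 0" and le: "\<And>i. norm (a i) \<le> 1"
  shows "summable (\<lambda>i. (cmod (cinner x (a i)))\<^sup>2)" and "(\<Sum>i. (cmod (cinner x (a i)))\<^sup>2) \<le> (norm x)\<^sup>2"
proof -
  have *: "(\<Sum>i<n. (cmod (cinner x (a i)))\<^sup>2) \<le> (norm x)\<^sup>2" for n
    by (rule bessel_finite) (use assms in auto)
  show s: "summable (\<lambda>i. (cmod (cinner x (a i)))\<^sup>2)"
    by (rule bounded_imp_summable[where B="(norm x)\<^sup>2"])
      (use *[of "Suc _"] in \<open>auto simp: lessThan_Suc_atMost\<close>)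
  show "(\<Sum>i. (cmod (cinner x (a i)))\<^sup>2) \<le> (norm x)\<^sup>2"
    by (rule suminf_le_const[OF s]) (rule *)
qed

text \<open>The common shape of the operators built here: diagonal operators, projections, partial
  isometries, adjoints and the outer factors of a factorisation.\<close>

definition series_op :: "(nat \<Rightarrow> 'h::complex_hilbert) \<Rightarrow> (nat \<Rightarrow> 'h) \<Rightarrow> 'h \<Rightarrow> 'h" where
  "series_op a b x = (\<Sum>n. cinner x (a n) *\<^sub>C b n)"

text \<open>Bessel's inequality makes the coefficients square summable, and Pythagoras turns this
  into the norm bound, because the \<open>b n\<close> are orthogonal with a common bound on their
  norms.\<close>

lemma
  fixes a b :: "nat \<Rightarrow> 'h::complex_hilbert"
  assumes a: "\<And>i j. i \<noteq> j \<Longrightarrow> cinner (a i) (a j) = 0" "\<And>i. norm (a i) \<le> 1"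
    and b: "\<And>i j. i \<noteq> j \<Longrightarrow> cinner (b i) (b j) = 0" "\<And>i. norm (b i) \<le> C"
  shows series_op_summable: "summable (\<lambda>n. cinner x (a n) *\<^sub>C b n)"
    and norm_series_op_le: "norm (series_op a b x) \<le> C * norm x"
    and bounded_clinear_series_op: "bounded_clinear (series_op a b)"
proof -
  have C: "C \<ge> 0" using b(2)[of 0] norm_ge_zero[of "b 0"] by linarith
  have le: "(norm (cinner x (a n) *\<^sub>C b n))\<^sup>2 \<le> C\<^sup>2 * (cmod (cinner x (a n)))\<^sup>2" for n x
    unfolding norm_scaleC power_mult_distrib mult.commute[of "C\<^sup>2"]
    by (intro mult_left_mono power_mono b(2)) auto
  have s1: "summable (\<lambda>n. C\<^sup>2 * (cmod (cinner x (a n)))\<^sup>2)" for x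
    by (intro summable_mult bessel(1) a)
  have s2: "summable (\<lambda>n. (norm (cinner x (a n) *\<^sub>C b n))\<^sup>2)" for x
    by (rule summable_comparison_test'[OF s1, of 0]) (use le in auto)
  have o: "i \<noteq> j \<Longrightarrow> cinner (cinner x (a i) *\<^sub>C b i) (cinner x (a j) *\<^sub>C b j) = 0" for i j x
    by (simp add: b cinner_scaleC_left cinner_scaleC_right)
  show s: "summable (\<lambda>n. cinner x (a n) *\<^sub>C b n)" for x
    by (rule summable_orthogonal(1)[OF o s2])
  show n: "norm (series_op a b x) \<le> C * norm x" for x
  proof -
    have "(norm (series_op a b x))\<^sup>2 = (\<Sum>n. (norm (cinner x (a n) *\<^sub>C b n))\<^sup>2)"
      unfolding series_op_def by (rule summable_orthogonal(2)[OF o s2])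
    also have "\<dots> \<le> (\<Sum>n. C\<^sup>2 * (cmod (cinner x (a n)))\<^sup>2)"
      by (rule suminf_le[OF le s2 s1])
    also have "\<dots> = C\<^sup>2 * (\<Sum>n. (cmod (cinner x (a n)))\<^sup>2)"
      by (intro suminf_mult bessel(1) a)
    also have "\<dots> \<le> C\<^sup>2 * (norm x)\<^sup>2" by (intro mult_left_mono bessel(2) a) auto
    finally have "(norm (series_op a b x))\<^sup>2 \<le> (C * norm x)\<^sup>2" by (simp add: power_mult_distrib)
    then show ?thesis by (rule power2_le_imp_le) (simp add: C)
  qed
  have add: "series_op a b (x + y) = series_op a b x + series_op a b y" for x y
    unfolding series_op_def
    by (simp add: cinner_add_left scaleC_add_left suminf_add[OF s s])
  have scale: "series_op a b (c *\<^sub>C x) = c *\<^sub>C series_op a b x" for c x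
  proof -
    have "c *\<^sub>C series_op a b x = (\<Sum>n. c *\<^sub>C (cinner x (a n) *\<^sub>C b n))"
      unfolding series_op_def by (rule bounded_linear.suminf[OF scaleC.bounded_linear_right s])
    then show ?thesis by (simp add: series_op_def cinner_scaleC_left scaleC_scaleC)
  qed
  show "bounded_clinear (series_op a b)"
    unfolding bounded_clinear_def
  proof (intro conjI allI scale bounded_linear_intro)
    show "series_op a b (r *\<^sub>R x) = r *\<^sub>R series_op a b x" for r x
      using scale[of "of_real r" x] by (simp add: scaleC_of_real)
    show "norm (series_op a b x) \<le> norm x * C" for x using n[of x] by (simp add: mult.commute)
  qed (rule add)
qed

definition orthonormal :: "(nat \<Rightarrow> 'h::complex_hilbert) \<Rightarrow> bool" where
  "orthonormal u \<longleftrightarrow> (\<forall>i j. cinner (u i) (u j) = (if i = j then 1 else 0))"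

lemma orthonormal_cinner: "orthonormal u \<Longrightarrow> cinner (u i) (u j) = (if i = j then 1 else 0)"
  by (simp add: orthonormal_def)

lemma norm_eq_1_iff_cinner: "norm x = 1 \<longleftrightarrow> cinner x x = 1"
  unfolding cinner_self by (metis norm_ge_zero of_real_eq_1_iff power2_eq_1_iff norm_not_less_zero
     less_minus_one_simps(1) one_power2)

lemma orthonormal_norm: "orthonormal u \<Longrightarrow> norm (u i) = 1"
  by (simp add: norm_eq_1_iff_cinner orthonormal_def)

lemma cinner_eq_0_iff [simp]: "cinner x x = 0 \<longleftrightarrow> x = 0"
  by (simp add: cinner_self)

context
  fixes u :: "nat \<Rightarrow> 'h::complex_hilbert"
  assumes u: "orthonormal u"
begin

lemma orthonormal_summable: "summable (\<lambda>n. cinner x (u n) *\<^sub>C u n)"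
  by (rule series_op_summable[where C=1]) (use u in \<open>simp_all add: orthonormal_cinner orthonormal_norm\<close>)

lemma cinner_series_op_self: "cinner (series_op u u x) (u k) = cinner x (u k)"
proof -
  have "cinner (series_op u u x) (u k) = (\<Sum>n. cinner (cinner x (u n) *\<^sub>C u n) (u k))"
    unfolding series_op_def
    by (rule bounded_linear.suminf[OF cinner.bounded_linear_left orthonormal_summable])
  also have "\<dots> = (\<Sum>n. if n = k then cinner x (u k) else 0)"
    by (intro suminf_cong) (use u in \<open>simp add: cinner_scaleC_left orthonormal_cinner\<close>)
  also have "\<dots> = cinner x (u k)" using sums_If_finite_set[of "{k}" "\<lambda>_. cinner x (u k)"]
    by (simp add: sums_iff)
  finally show ?thesis .
qed

end

lemma bounded_clinear_lin:
  assumes "bounded_clinear X"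
  shows "X (x + y) = X x + X y" "X (c *\<^sub>C x) = c *\<^sub>C X x" "X 0 = 0" "X (x - y) = X x - X y" "X (sum f A) = (\<Sum>i\<in>A. X (f i))"
    "bounded_linear X"
proof -
  show b: "bounded_linear X" using assms by (simp add: bounded_clinear_def)
  then interpret bounded_linear X .
  show "X (x + y) = X x + X y" by (rule add)
  show "X (c *\<^sub>C x) = c *\<^sub>C X x" using assms by (simp add: bounded_clinear_def)
  show "X 0 = 0" by (rule zero)
  show "X (x - y) = X x - X y" by (rule diff)
  show "X (sum f A) = (\<Sum>i\<in>A. X (f i))" by (rule sum)
qed

lemma onb_orthonormal: "orthonormal_basis e \<Longrightarrow> orthonormal e"
  by (simp add: orthonormal_basis_def orthonormal_def)

lemma onb_total:
  assumes "orthonormal_basis e" "\<And>n. cinner x (e n) = 0"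
  shows "x = 0"
proof -
  let ?S = "{y. cinner x y = 0}"
  have "closed ?S"
    by (intro closed_Collect_eq continuous_on_const bounded_linear.continuous_on[OF cinner.bounded_linear_right])
      (auto intro: continuous_intros)
  moreover have "cspan (range e) \<subseteq> ?S"
  proof (rule complex_vector.span_minimal)
    show "complex_vector.subspace ?S"
      by (auto simp: complex_vector.subspace_def cinner_add_right cinner_scaleC_right cinner.zero_right)
  qed (use assms in auto)
  ultimately have "closure (cspan (range e)) \<subseteq> ?S" by (rule closure_minimal[rotated])
  then have "x \<in> ?S" using assms(1) by (auto simp only: orthonormal_basis_def)
  then show ?thesis by simp
qed

lemma bounded_clinear_eqI:
  assumes "orthonormal_basis e" "bounded_clinear X" "bounded_clinear Y" "\<And>n. X (e n) = Y (e n)"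
  shows "X = Y"
proof
  fix x
  let ?S = "{y. X y = Y y}"
  note X = bounded_clinear_lin[OF assms(2)] and Y = bounded_clinear_lin[OF assms(3)]
  have "closed ?S"
    by (intro closed_Collect_eq bounded_linear.continuous_on[OF X(6)] bounded_linear.continuous_on[OF Y(6)])
      (auto intro: continuous_intros)
  moreover have "cspan (range e) \<subseteq> ?S"
  proof (rule complex_vector.span_minimal)
    show "complex_vector.subspace ?S"
      by (auto simp: complex_vector.subspace_def X Y)
  qed (use assms in auto)
  ultimately have "closure (cspan (range e)) \<subseteq> ?S" by (rule closure_minimal[rotated])
  then show "X x = Y x" using assms by (auto simp: orthonormal_basis_def)
qed

section \<open>Singular systems\<close>

lemma homogeneous_system_nontrivial:
  fixes f :: "nat \<Rightarrow> nat \<Rightarrow> complex"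
  shows "\<exists>a. (\<exists>j\<le>n. a j \<noteq> 0) \<and> (\<forall>i<n. (\<Sum>j\<le>n. a j * f i j) = 0)"
proof (induction n arbitrary: f)
  case 0
  show ?case by (intro exI[of _ "\<lambda>_. 1"]) auto
next
  case (Suc n)
  show ?case
  proof (cases "\<forall>i<Suc n. f i (Suc n) = 0")
    case True
    then show ?thesis by (intro exI[of _ "\<lambda>j. if j = Suc n then 1 else 0"]) auto
  next
    case False
    then obtain p where p: "p < Suc n" "f p (Suc n) \<noteq> 0" by blast
    \<comment> \<open>Eliminates unknown \<open>Suc n\<close> by means of the pivot equation p; the
      other n equations are renumbered so as to skip p.\<close>
    define g where "g i j = (let k = (if i < p then i else Suc i) in f k j - f k (Suc n) * f p j / f p (Suc n))" for i j
    obtain a where a: "\<exists>j\<le>n. a j \<noteq> 0" "\<And>i. i < n \<Longrightarrow> (\<Sum>j\<le>n. a j * g i j) = 0"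
      using Suc[of g] by blast
    \<comment> \<open>The eliminated unknown is recovered from equation p.\<close>
    define t where "t = - (\<Sum>j\<le>n. a j * f p j) / f p (Suc n)"
    define b where "b = a (Suc n := t)"
    have b: "(\<Sum>j\<le>Suc n. b j * f k j) = (\<Sum>j\<le>n. a j * f k j) + t * f k (Suc n)" for k
      by (auto simp: b_def)
    have "(\<Sum>j\<le>Suc n. b j * f k j) = 0" if k: "k < Suc n" for k
    proof (cases "k = p")
      case True
      then show ?thesis unfolding b using p by (simp add: t_def)
    next
      case False
      define i where "i = (if k < p then k else k - 1)"
      have i: "i < n" "(if i < p then i else Suc i) = k" using False k p by (auto simp: i_def)
      have "0 = (\<Sum>j\<le>n. a j * g i j)" using a(2)[OF i(1)] by simp
      also have "\<dots> = (\<Sum>j\<le>n. a j * f k j - (a j * f p j) * (f k (Suc n) / f p (Suc n)))"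
        unfolding g_def Let_def i(2) by (intro sum.cong) (auto simp: algebra_simps)
      also have "\<dots> = (\<Sum>j\<le>n. a j * f k j) + t * f k (Suc n)"
        by (simp add: sum_subtractf t_def sum_distrib_right sum_divide_distrib)
      finally show ?thesis unfolding b by simp
    qed
    moreover have "\<exists>j\<le>Suc n. b j \<noteq> 0"
    proof -
      obtain j where "j \<le> n" "a j \<noteq> 0" using a by blast
      then show ?thesis by (intro exI[of _ j]) (auto simp: b_def)
    qed
    ultimately show ?thesis by blast
  qed
qed

lemma orthonormal_comb_norm:
  assumes "orthonormal u"
  shows "(norm (\<Sum>j\<le>n. a j *\<^sub>C u j))\<^sup>2 = (\<Sum>j\<le>n. (cmod (a j))\<^sup>2)"
proof -
  have "(norm (\<Sum>j\<le>n. a j *\<^sub>C u j))\<^sup>2 = (\<Sum>j\<le>n. (norm (a j *\<^sub>C u j))\<^sup>2)"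
    by (rule norm_sum_orthogonal_sq) (simp_all add: cinner_scaleC_left cinner_scaleC_right orthonormal_cinner[OF assms])
  then show ?thesis by (simp add: norm_scaleC orthonormal_norm[OF assms])
qed

text \<open>The values on \<open>u 0\<close>, ..., \<open>u n\<close> give n equations in n+1
  unknowns, and orthonormality turns a nontrivial solution into a nonzero vector.\<close>

lemma exists_common_kernel:
  fixes f :: "nat \<Rightarrow> 'h::complex_hilbert \<Rightarrow> complex"
  assumes u: "orthonormal u"
    and f: "\<And>i x y. i < n \<Longrightarrow> f i (x + y) = f i x + f i y" "\<And>i c x. i < n \<Longrightarrow> f i (c *\<^sub>C x) = c * f i x"
  shows "\<exists>a. (\<Sum>j\<le>n. a j *\<^sub>C u j) \<noteq> 0 \<and> (\<forall>i<n. f i (\<Sum>j\<le>n. a j *\<^sub>C u j) = 0)"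
proof -
  obtain a where a: "\<exists>j\<le>n. a j \<noteq> 0" "\<And>i. i < n \<Longrightarrow> (\<Sum>j\<le>n. a j * f i (u j)) = 0"
    using homogeneous_system_nontrivial[of n "\<lambda>i j. f i (u j)"] by blast
  let ?x = "\<Sum>j\<le>n. a j *\<^sub>C u j"
  have "f i ?x = 0" if i: "i < n" for i
  proof -
    have z: "f i 0 = 0" using f(2)[OF i, of 0 0] by simp
    have "f i (sum g A) = (\<Sum>j\<in>A. f i (g j))" for g and A :: "nat set"
      by (induction A rule: infinite_finite_induct) (simp_all add: z f(1)[OF i])
    then show ?thesis using a(2)[OF i] f(2)[OF i] by simp
  qed
  moreover have "?x \<noteq> 0"
  proof
    assume "?x = 0"
    then have "(\<Sum>j\<le>n. (cmod (a j))\<^sup>2) = 0" using orthonormal_comb_norm[OF u, of a n] by simp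
    then show False using a(1) by (subst (asm) sum_nonneg_eq_0_iff) auto
  qed
  ultimately show ?thesis by blast
qed

text \<open>The vectors \<open>u n\<close> are right singular vectors of \<open>X\<close> and the \<open>X (u n) / s n\<close> are left
  singular vectors; the \<open>u n\<close> need not be complete, but \<open>X\<close> vanishes on their complement.\<close>

definition singular_system :: "('h::complex_hilbert \<Rightarrow> 'h) \<Rightarrow> (nat \<Rightarrow> real) \<Rightarrow> (nat \<Rightarrow> 'h) \<Rightarrow> bool" where
  "singular_system X s u \<longleftrightarrow> bounded_clinear X \<and> s \<in> c0star \<and> orthonormal u \<and>
     (\<forall>m n. cinner (X (u m)) (X (u n)) = (if m = n then complex_of_real ((s n)\<^sup>2) else 0)) \<and>
     (\<forall>x. (\<forall>n. cinner x (u n) = 0) \<longrightarrow> X x = 0)"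

lemma c0star_nonneg: "s \<in> c0star \<Longrightarrow> 0 \<le> s n"
  and c0star_antimono: "s \<in> c0star \<Longrightarrow> m \<le> n \<Longrightarrow> s n \<le> s m"
  and c0star_tendsto: "s \<in> c0star \<Longrightarrow> s \<longlonglongrightarrow> 0"
  by (auto simp: c0star_def decseq_def)

lemma c0starI: "(\<And>n. 0 \<le> s n) \<Longrightarrow> (\<And>n. s (Suc n) \<le> s n) \<Longrightarrow> s \<longlonglongrightarrow> 0 \<Longrightarrow> s \<in> c0star"
  by (auto simp: c0star_def decseq_Suc_iff)

context
  fixes X :: "'h::complex_hilbert \<Rightarrow> 'h" and s u
  assumes S: "singular_system X s u"
begin

lemma
  shows ss_lin: "bounded_clinear X" and ss_c0: "s \<in> c0star" and ss_on: "orthonormal u"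
    and ss_orth: "cinner (X (u m)) (X (u n)) = (if m = n then complex_of_real ((s n)\<^sup>2) else 0)"
    and ss_ker: "(\<And>n. cinner x (u n) = 0) \<Longrightarrow> X x = 0"
  using S by (auto simp: singular_system_def)

lemma ss_norm: "norm (X (u n)) = s n"
proof -
  have "(norm (X (u n)))\<^sup>2 = (s n)\<^sup>2"
    using ss_orth[of n n] unfolding cinner_self by (simp only: of_real_eq_iff if_True simp_thms)
  then show ?thesis using c0star_nonneg[OF ss_c0] by (simp add: power2_eq_iff_nonneg)
qed

lemma ss_expand: "X x = series_op u (\<lambda>n. X (u n)) x"
proof -
  have "cinner (x - series_op u u x) (u n) = 0" for n
    by (simp add: cinner.diff_left cinner_series_op_self[OF ss_on])
  then have "X (x - series_op u u x) = 0" by (rule ss_ker)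
  then have "X x = X (series_op u u x)" by (simp add: bounded_clinear_lin(4)[OF ss_lin])
  also have "\<dots> = (\<Sum>n. X (cinner x (u n) *\<^sub>C u n))"
    unfolding series_op_def
    by (rule bounded_linear.suminf[OF bounded_clinear_lin(6)[OF ss_lin] orthonormal_summable[OF ss_on]])
  finally show ?thesis by (simp add: series_op_def bounded_clinear_lin(2)[OF ss_lin])
qed

lemma ss_summable: "summable (\<lambda>n. cinner x (u n) *\<^sub>C X (u n))"
  by (rule series_op_summable[where C="s 0"])
    (simp_all add: ss_orth orthonormal_cinner[OF ss_on] orthonormal_norm[OF ss_on] ss_norm
      c0star_antimono[OF ss_c0])

text \<open>Orthogonality of the left vectors leaves one term of the expansion. In effect
  \<open>u n\<close> is an eigenvector of the adjoint of X times X, expressed without the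
  adjoint.\<close>

lemma ss_cinner: "cinner (X x) (X (u n)) = (s n)\<^sup>2 * cinner x (u n)"
proof -
  have "cinner (X x) (X (u n)) = (\<Sum>k. cinner (cinner x (u k) *\<^sub>C X (u k)) (X (u n)))"
    unfolding ss_expand[of x] series_op_def
    by (rule bounded_linear.suminf[OF cinner.bounded_linear_left ss_summable])
  also have "\<dots> = (\<Sum>k. if k = n then (s n)\<^sup>2 * cinner x (u n) else 0)"
    by (intro suminf_cong) (simp add: cinner_scaleC_left ss_orth)
  also have "\<dots> = (s n)\<^sup>2 * cinner x (u n)"
    using sums_If_finite_set[of "{n}" "\<lambda>_. (s n)\<^sup>2 * cinner x (u n)"]
    by (simp add: sums_iff)
  finally show ?thesis .
qed

lemma ss_norm_le:
  assumes "\<And>k. k < n \<Longrightarrow> cinner x (u k) = 0"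
  shows "norm (X x) \<le> s n * norm x"
proof -
  \<comment> \<open>The first n coefficients vanish at x, so their vectors may be replaced by 0; the
    remaining ones have norm at most \<open>s n\<close>.\<close>
  let ?b = "\<lambda>k. if k < n then 0 else X (u k)"
  have "X x = series_op u ?b x"
    unfolding ss_expand[of x] series_op_def
    by (intro suminf_cong) (use assms in \<open>auto simp: scaleC.zero_left scaleC.zero_right\<close>)
  also have "norm \<dots> \<le> s n * norm x"
    by (rule norm_series_op_le)
      (auto simp: ss_orth orthonormal_cinner[OF ss_on] orthonormal_norm[OF ss_on] ss_norm cinner.zero_left cinner.zero_right
        c0star_antimono[OF ss_c0] c0star_nonneg[OF ss_c0])
  finally show ?thesis .
qed

text \<open>The easy half of the Courant-Fischer principle.\<close>

lemma ss_minimax: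
  fixes f :: "nat \<Rightarrow> 'h \<Rightarrow> complex"
  assumes f: "\<And>i x y. i < n \<Longrightarrow> f i (x + y) = f i x + f i y" "\<And>i c x. i < n \<Longrightarrow> f i (c *\<^sub>C x) = c * f i x"
    and le: "\<And>x. (\<And>i. i < n \<Longrightarrow> f i x = 0) \<Longrightarrow> norm (X x) \<le> c * norm x"
  shows "s n \<le> c"
proof -
  \<comment> \<open>On the span of the first n+1 right singular vectors X stretches by at least
    \<open>s n\<close>, and n functionals cannot separate that span from 0.\<close>
  have "\<exists>a. (\<Sum>j\<le>n. a j *\<^sub>C u j) \<noteq> 0 \<and> (\<forall>i<n. f i (\<Sum>j\<le>n. a j *\<^sub>C u j) = 0)"
    using f by (rule exists_common_kernel[OF ss_on])
  then obtain a where a: "(\<Sum>j\<le>n. a j *\<^sub>C u j) \<noteq> 0" "\<And>i. i < n \<Longrightarrow> f i (\<Sum>j\<le>n. a j *\<^sub>C u j) = 0"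
    by blast
  let ?x = "\<Sum>j\<le>n. a j *\<^sub>C u j"
  have "(s n * norm ?x)\<^sup>2 = (\<Sum>j\<le>n. (s n)\<^sup>2 * (cmod (a j))\<^sup>2)"
    by (simp add: power_mult_distrib orthonormal_comb_norm[OF ss_on] sum_distrib_left)
  also have "\<dots> \<le> (\<Sum>j\<le>n. (s j)\<^sup>2 * (cmod (a j))\<^sup>2)"
    by (intro sum_mono mult_right_mono power_mono c0star_antimono[OF ss_c0] c0star_nonneg[OF ss_c0]) auto
  also have "\<dots> = (\<Sum>j\<le>n. (norm (a j *\<^sub>C X (u j)))\<^sup>2)"
    by (simp add: norm_scaleC ss_norm power_mult_distrib mult.commute)
  also have "\<dots> = (norm (\<Sum>j\<le>n. a j *\<^sub>C X (u j)))\<^sup>2"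
    by (rule norm_sum_orthogonal_sq[symmetric]) (simp_all add: cinner_scaleC_left cinner_scaleC_right ss_orth)
  also have "(\<Sum>j\<le>n. a j *\<^sub>C X (u j)) = X ?x"
    by (simp add: bounded_clinear_lin[OF ss_lin])
  finally have "s n * norm ?x \<le> norm (X ?x)" by (rule power2_le_imp_le) simp
  also have "\<dots> \<le> c * norm ?x" by (rule le) (rule a(2))
  finally show ?thesis using a(1) by simp
qed

end

section \<open>Singular values of sums and products, and factorisation\<close>

lemma singular_system_add:
  assumes X: "singular_system X s u" and Y: "singular_system Y t v"
    and Z: "singular_system (\<lambda>x. X x + Y x) r w"
  shows "r (m + n) \<le> s m + t n"
proof -
  \<comment> \<open>The first m functionals make X small and the next n make Y small; on their
    common kernel both bounds of \<open>ss_norm_le\<close> hold.\<close>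
  define f where "f i x = (if i < m then cinner x (u i) else cinner x (v (i - m)))" for i x
  show ?thesis
  proof (rule ss_minimax[OF Z, of _ f])
    fix x assume x: "\<And>i. i < m + n \<Longrightarrow> f i x = 0"
    have "cinner x (u i) = 0" if "i < m" for i using x[of i] that by (simp add: f_def)
    then have 1: "norm (X x) \<le> s m * norm x" by (rule ss_norm_le[OF X])
    have "cinner x (v i) = 0" if "i < n" for i using x[of "m + i"] that by (simp add: f_def)
    then have 2: "norm (Y x) \<le> t n * norm x" by (rule ss_norm_le[OF Y])
    show "norm (X x + Y x) \<le> (s m + t n) * norm x"
      using 1 2 norm_triangle_ineq[of "X x" "Y x"] by (simp add: algebra_simps)
  qed (auto simp: f_def cinner_add_left cinner_scaleC_left)
qed

lemma singular_system_comp: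
  assumes X: "singular_system X s u" and Z: "singular_system (A \<circ> X \<circ> B) r w"
    and "bounded_clinear A" "bounded_clinear B"
  shows "\<exists>C. \<forall>n. r n \<le> C * s n"
proof -
  obtain KA where KA: "KA > 0" "\<And>x. norm (A x) \<le> norm x * KA"
    using bounded_linear.pos_bounded[OF bounded_clinear_lin(6)[OF assms(3)]] by blast
  obtain KB where KB: "KB > 0" "\<And>x. norm (B x) \<le> norm x * KB"
    using bounded_linear.pos_bounded[OF bounded_clinear_lin(6)[OF assms(4)]] by blast
  note B = bounded_clinear_lin[OF assms(4)]
  have "r n \<le> KA * KB * s n" for n
  \<comment> \<open>These functionals vanish exactly where \<open>B x\<close> is orthogonal to the
    first n right singular vectors of X.\<close>
  proof (rule ss_minimax[OF Z, of n "\<lambda>i x. cinner (B x) (u i)"])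
    fix x assume "\<And>i. i < n \<Longrightarrow> cinner (B x) (u i) = 0"
    then have "norm (X (B x)) \<le> s n * norm (B x)" by (rule ss_norm_le[OF X])
    also have "\<dots> \<le> s n * (norm x * KB)"
      by (intro mult_left_mono KB c0star_nonneg[OF ss_c0[OF X]])
    finally have "norm (X (B x)) * KA \<le> s n * (norm x * KB) * KA" using KA by simp
    then show "norm ((A \<circ> X \<circ> B) x) \<le> KA * KB * s n * norm x"
      using KA(2)[of "X (B x)"] by (simp add: mult_ac)
  qed (simp_all add: B cinner_add_left cinner_scaleC_left)
  then show ?thesis by blast
qed

text \<open>B carries \<open>u n\<close> to \<open>w n\<close>, Y carries this to a vector of norm
  \<open>t n\<close>, and A takes that vector to \<open>X (u n)\<close>. The estimate
  \<open>s n \<le> C * t n\<close> keeps A bounded.\<close>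

lemma singular_system_factor:
  assumes X: "singular_system X s u" and Y: "singular_system Y t w"
    and le: "\<And>n. s n \<le> C * t n"
  obtains A B where "bounded_clinear A" "bounded_clinear B" "X = A \<circ> Y \<circ> B"
proof
  \<comment> \<open>Where \<open>t n = 0\<close>, \<open>inverse\<close> yields 0 and both vectors
    vanish. Nothing is lost, since then \<open>s n = 0\<close> and
    \<open>X (u n) = 0\<close>.\<close>
  define yt where "yt n = complex_of_real (inverse (t n)) *\<^sub>C Y (w n)" for n
  define xt where "xt n = complex_of_real (inverse (t n)) *\<^sub>C X (u n)" for n
  define C' where "C' = max C 0"
  have yo: "cinner (yt i) (yt j) = 0" if "i \<noteq> j" for i j
    using that by (simp add: yt_def cinner_scaleC_left cinner_scaleC_right ss_orth[OF Y])
  have xo: "cinner (xt i) (xt j) = 0" if "i \<noteq> j" for i j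
    using that by (simp add: xt_def cinner_scaleC_left cinner_scaleC_right ss_orth[OF X])
  have yn: "norm (yt i) \<le> 1" for i
    using c0star_nonneg[OF ss_c0[OF Y], of i]
    by (cases "t i = 0") (simp_all add: yt_def norm_scaleC ss_norm[OF Y] norm_inverse)
  have xn: "norm (xt i) \<le> C'" for i
  proof (cases "t i = 0")
    case False
    then have "t i > 0" using c0star_nonneg[OF ss_c0[OF Y], of i] by simp
    then have "inverse (t i) * s i \<le> C" using le[of i] by (simp add: field_simps)
    then show ?thesis using \<open>t i > 0\<close> by (simp add: xt_def norm_scaleC ss_norm[OF X] C'_def norm_inverse)
  qed (simp add: xt_def C'_def scaleC.zero_left)
  let ?A = "series_op yt xt" and ?B = "series_op u w"
  show A: "bounded_clinear ?A" by (rule bounded_clinear_series_op) (fact yo yn xo xn)+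
  have Bs: "summable (\<lambda>n. cinner x (u n) *\<^sub>C w n)" for x
    by (rule series_op_summable[where C=1])
      (simp_all add: orthonormal_cinner[OF ss_on[OF X]] orthonormal_norm[OF ss_on[OF X]]
       orthonormal_cinner[OF ss_on[OF Y]] orthonormal_norm[OF ss_on[OF Y]])
  show B: "bounded_clinear ?B"
    by (rule bounded_clinear_series_op[where C=1])
      (simp_all add: orthonormal_cinner[OF ss_on[OF X]] orthonormal_norm[OF ss_on[OF X]]
       orthonormal_cinner[OF ss_on[OF Y]] orthonormal_norm[OF ss_on[OF Y]])
  have AY: "?A (Y (w n)) = X (u n)" for n
  proof -
    have "?A (Y (w n)) = (\<Sum>k. if k = n then X (u n) else 0)"
      unfolding series_op_def
    proof (rule suminf_cong)
      fix k
      have "s n = 0" if "t n = 0" using le[of n] c0star_nonneg[OF ss_c0[OF X], of n] that by simp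
      then have "X (u n) = 0" if "t n = 0" using ss_norm[OF X, of n] that by simp
      moreover have "complex_of_real (inverse (t n) * (t n * t n) * inverse (t n)) *\<^sub>C X (u n) = X (u n)"
        if "t n \<noteq> 0" using that by (simp only: scaleC_of_real) (simp add: field_simps)
      ultimately show "cinner (Y (w n)) (yt k) *\<^sub>C xt k = (if k = n then X (u n) else 0)"
        by (cases "t n = 0") (auto simp: yt_def xt_def cinner_scaleC_right ss_orth[OF Y] scaleC_scaleC scaleC.zero_left scaleC.zero_right
            power2_eq_square simp flip: of_real_mult of_real_inverse)
    qed
    also have "\<dots> = X (u n)" using sums_If_finite_set[of "{n}" "\<lambda>_. X (u n)"] by (simp add: sums_iff)
    finally show ?thesis .
  qed
  show "X = ?A \<circ> Y \<circ> ?B"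
  proof
    fix x
    have AYb: "bounded_linear (\<lambda>x. ?A (Y x))"
      by (intro bounded_linear_compose[OF bounded_clinear_lin(6) bounded_clinear_lin(6)] A ss_lin[OF Y])
    have "?A (Y (?B x)) = (\<Sum>n. ?A (Y (cinner x (u n) *\<^sub>C w n)))"
      unfolding series_op_def[of u w] by (rule bounded_linear.suminf[OF AYb Bs])
    also have "\<dots> = (\<Sum>n. cinner x (u n) *\<^sub>C X (u n))"
      by (simp add: bounded_clinear_lin(2)[OF A] bounded_clinear_lin(2)[OF ss_lin[OF Y]] AY)
    finally show "X x = (?A \<circ> Y \<circ> ?B) x" using ss_expand[OF X, of x] by (simp add: series_op_def)
  qed
qed

section \<open>Compact operators\<close>

text \<open>Compactness makes the images of a maximising sequence converge along a subsequence. The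
  parallelogram law lifts this to the vectors themselves, whose limit stays in M and attains the
  supremum.\<close>

lemma maximizing_vector:
  fixes X :: "'h::complex_hilbert \<Rightarrow> 'h"
  assumes X: "bounded_clinear X" and comp: "compact (closure (X ` cball 0 1))"
    and M: "closed M" "csubspace M" and x0: "x0 \<in> M" "x0 \<noteq> 0"
  obtains r where "r \<in> M" "norm r = 1" "\<And>x. x \<in> M \<Longrightarrow> norm (X x) \<le> norm (X r) * norm x"
proof -
  note X' = bounded_clinear_lin[OF X]
  have Msc: "c *\<^sub>R x \<in> M" if "x \<in> M" for c :: real and x
    using complex_vector.subspace_scale[OF M(2) that, of "of_real c"] by (simp add: scaleC_of_real)
  define A where "A = {norm (X x) |x. x \<in> M \<and> norm x = 1}"
  define \<sigma> where "\<sigma> = Sup A"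
  obtain K where K: "\<And>x. norm (X x) \<le> norm x * K"
    using bounded_linear.pos_bounded[OF X'(6)] by blast
  have bdd: "bdd_above A" unfolding A_def by (rule bdd_aboveI[of _ K]) (auto, metis K mult_1)
  have unit: "(1 / norm x) *\<^sub>R x \<in> M \<and> norm ((1 / norm x) *\<^sub>R x) = 1" if "x \<in> M" "x \<noteq> 0" for x
    using Msc that by simp
  have ne: "A \<noteq> {}" using unit[OF x0] unfolding A_def by blast
  have le: "norm (X x) \<le> \<sigma> * norm x" if "x \<in> M" for x
  proof (cases "x = 0")
    case False
    have "norm (X ((1 / norm x) *\<^sub>R x)) \<le> \<sigma>"
      unfolding \<sigma>_def by (rule cSup_upper[OF _ bdd]) (use unit[OF that False] in \<open>auto simp: A_def\<close>)
    moreover have "X ((1 / norm x) *\<^sub>R x) = (1 / norm x) *\<^sub>R X x"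
      by (rule linear_scale[OF bounded_linear.linear[OF X'(6)]])
    ultimately show ?thesis using False by (simp add: field_simps)
  qed (simp add: X')
  have \<sigma>0: "\<sigma> \<ge> 0"
  proof -
    obtain a where "a \<in> A" using ne by blast
    then have "0 \<le> a" "a \<le> \<sigma>" by (auto simp: A_def \<sigma>_def intro!: cSup_upper bdd[unfolded A_def])
    then show ?thesis by simp
  qed
  have le1: "norm (X x) \<le> \<sigma>" if "x \<in> M" "norm x = 1" for x using le[OF that(1)] that(2) by simp
  have "\<exists>x. x \<in> M \<and> norm x = 1 \<and> \<sigma> - 1 / real (Suc k) < norm (X x)" for k
  proof -
    have "\<sigma> - 1 / real (Suc k) < Sup A" by (simp add: \<sigma>_def)
    then show ?thesis unfolding less_cSup_iff[OF ne bdd] by (auto simp: A_def)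
  qed
  then obtain x where x: "\<And>k. x k \<in> M" "\<And>k. norm (x k) = 1" "\<And>k. \<sigma> - 1 / real (Suc k) < norm (X (x k))"
    by metis
  have lim: "(\<lambda>k. norm (X (x k))) \<longlonglongrightarrow> \<sigma>"
  proof (rule tendsto_sandwich[OF _ _ _ tendsto_const])
    show "(\<lambda>k. \<sigma> - 1 / real (Suc k)) \<longlonglongrightarrow> \<sigma>"
      using tendsto_diff[OF tendsto_const LIMSEQ_inverse_real_of_nat, of \<sigma>] by (simp add: inverse_eq_divide)
  qed (use x le1 in \<open>auto simp: less_imp_le intro!: always_eventually\<close>)
  have "X (x k) \<in> closure (X ` cball 0 1)" for k
    by (rule subsetD[OF closure_subset]) (use x(2) in auto)
  then obtain l \<rho> where \<rho>: "strict_mono \<rho>" "((\<lambda>k. X (x k)) \<circ> \<rho>) \<longlonglongrightarrow> l"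
    using comp unfolding compact_def by meson
  define y where "y = x \<circ> \<rho>"
  have y: "y k \<in> M" "norm (y k) = 1" for k using x by (auto simp: y_def)
  have yl: "(\<lambda>k. X (y k)) \<longlonglongrightarrow> l" using \<rho> by (simp add: y_def o_def)
  have ylim: "(\<lambda>k. norm (X (y k))) \<longlonglongrightarrow> \<sigma>"
    using LIMSEQ_subseq_LIMSEQ[OF lim \<rho>(1)] by (simp add: y_def o_def)
  show ?thesis
  proof (cases "\<sigma> = 0")
    case True
    show ?thesis
    proof (rule that[OF y(1)[of 0] y(2)[of 0]])
      show "norm (X x) \<le> norm (X (y 0)) * norm x" if "x \<in> M" for x
        using le[OF that] True by simp
    qed
  next
    case False
    then have \<sigma>: "\<sigma> > 0" using \<sigma>0 by simp
    have par: "(norm (a + b :: 'h))\<^sup>2 = 2 * (norm a)\<^sup>2 + 2 * (norm b)\<^sup>2 - (norm (a - b))\<^sup>2" for a b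
      by (simp add: norm_add_sq norm_diff_sq)
    \<comment> \<open>X stretches \<open>y j + y k\<close> by at most \<open>\<sigma>\<close>. So if
      both images have norm near \<open>\<sigma>\<close> and are close together, the sum has norm
      near 2, and the parallelogram law makes the difference small.\<close>
    have key: "\<sigma>\<^sup>2 * (norm (y j - y k))\<^sup>2 \<le> 2 * (\<sigma>\<^sup>2 - (norm (X (y j)))\<^sup>2) + 2 * (\<sigma>\<^sup>2 - (norm (X (y k)))\<^sup>2)
        + (norm (X (y j) - X (y k)))\<^sup>2" for j k
    proof -
      have "norm (X (y j) + X (y k)) \<le> \<sigma> * norm (y j + y k)"
        using le[of "y j + y k"] complex_vector.subspace_add[OF M(2) y(1) y(1)] by (simp add: X')
      then have "(norm (X (y j) + X (y k)))\<^sup>2 \<le> \<sigma>\<^sup>2 * (norm (y j + y k))\<^sup>2"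
        unfolding power_mult_distrib[symmetric] by (rule power_mono) simp
      then show ?thesis unfolding par y(2) by (simp add: algebra_simps)
    qed
    have "Cauchy y"
    proof (rule metric_CauchyI)
      fix \<epsilon> :: real assume \<epsilon>: "\<epsilon> > 0"
      \<comment> \<open>Each of the three terms in \<open>key\<close> will be below
        \<open>\<delta>\<^sup>2\<close>, so their sum is below \<open>4 * \<delta>\<^sup>2\<close>,
        which is \<open>\<sigma>\<^sup>2 * \<epsilon>\<^sup>2\<close>.\<close>
      define \<delta> where "\<delta> = \<sigma> * \<epsilon> / 2"
      have \<delta>: "\<delta> > 0" using \<sigma> \<epsilon> by (simp add: \<delta>_def)
      have "(\<lambda>k. \<sigma>\<^sup>2 - (norm (X (y k)))\<^sup>2) \<longlonglongrightarrow> \<sigma>\<^sup>2 - \<sigma>\<^sup>2" by (intro tendsto_intros ylim)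
      then have "\<forall>\<^sub>F k in sequentially. \<sigma>\<^sup>2 - (norm (X (y k)))\<^sup>2 < \<delta>\<^sup>2 / 2"
        using \<delta> by (intro order_tendstoD(2)[of _ 0]) auto
      then obtain N1 where N1: "\<And>k. k \<ge> N1 \<Longrightarrow> \<sigma>\<^sup>2 - (norm (X (y k)))\<^sup>2 < \<delta>\<^sup>2 / 2"
        unfolding eventually_sequentially by blast
      obtain N2 where N2: "\<And>j k. j \<ge> N2 \<Longrightarrow> k \<ge> N2 \<Longrightarrow> norm (X (y j) - X (y k)) < \<delta>"
        using metric_CauchyD[OF LIMSEQ_imp_Cauchy[OF yl] \<delta>] unfolding dist_norm by blast
      have arith: "\<lbrakk>a \<le> 2 * p + 2 * q + c; c < d; p < d / 2; q < d / 2; 0 < d\<rbrakk> \<Longrightarrow> a < 4 * d"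
        for a p q c d :: real by linarith
      have "dist (y j) (y k) < \<epsilon>" if "j \<ge> max N1 N2" "k \<ge> max N1 N2" for j k
      proof -
        have "(norm (X (y j) - X (y k)))\<^sup>2 < \<delta>\<^sup>2"
          by (intro power_strict_mono N2) (use that in auto)
        moreover have "\<sigma>\<^sup>2 - (norm (X (y j)))\<^sup>2 < \<delta>\<^sup>2 / 2" "\<sigma>\<^sup>2 - (norm (X (y k)))\<^sup>2 < \<delta>\<^sup>2 / 2"
          using that by (simp_all only: N1 max.bounded_iff)
        ultimately have "\<sigma>\<^sup>2 * (norm (y j - y k))\<^sup>2 < 4 * \<delta>\<^sup>2"
          using key[of j k] zero_less_power[OF \<delta>, of 2] by (intro arith)
        also have "4 * \<delta>\<^sup>2 = \<sigma>\<^sup>2 * \<epsilon>\<^sup>2" by (simp add: \<delta>_def power2_eq_square)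
        finally have "(norm (y j - y k))\<^sup>2 < \<epsilon>\<^sup>2" using \<sigma> by simp
        then show ?thesis unfolding dist_norm by (rule power2_less_imp_less) (use \<epsilon> in simp)
      qed
      then show "\<exists>N. \<forall>j\<ge>N. \<forall>k\<ge>N. dist (y j) (y k) < \<epsilon>" by blast
    qed
    then obtain r where r: "y \<longlonglongrightarrow> r" using convergent_eq_Cauchy by blast
    have "r \<in> M" using M(1) y(1) r by (rule closed_sequentially)
    moreover have "norm r = 1"
      using tendsto_norm[OF r] y(2) by (simp add: LIMSEQ_const_iff)
    moreover have "norm (X r) = \<sigma>"
      using tendsto_norm[OF bounded_linear.tendsto[OF X'(6) r]] ylim by (rule LIMSEQ_unique)
    ultimately show ?thesis using le by (intro that[of r]) simp_all
  qed
qed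

text \<open>First variation of \<open>norm (X x) / norm x\<close> at a maximum.\<close>

lemma maximizing_vector_orthogonal:
  fixes X :: "'h::complex_hilbert \<Rightarrow> 'h"
  assumes X: "bounded_clinear X" and M: "csubspace M" and r: "r \<in> M" "norm r = 1"
    and max: "\<And>x. x \<in> M \<Longrightarrow> norm (X x) \<le> norm (X r) * norm x"
    and w: "w \<in> M" "cinner r w = 0"
  shows "cinner (X r) (X w) = 0"
proof (rule ccontr)
  note X' = bounded_clinear_lin[OF X]
  define z where "z = cinner (X r) (X w)"
  define K where "K = (norm (X r))\<^sup>2 * (norm w)\<^sup>2"
  \<comment> \<open>Moving from r by c times w gains a term linear in \<open>\<epsilon>\<close> and
    costs one of order \<open>\<epsilon>\<^sup>2\<close> with factor K;
    \<open>\<epsilon> * K < 1\<close> lets the gain win. The phase of c, taken from z, makes the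
    linear term real and positive.\<close>
  define \<epsilon> where "\<epsilon> = 1 / (K + 1)"
  assume "cinner (X r) (X w) \<noteq> 0"
  then have z: "(cmod z)\<^sup>2 > 0" by (simp add: z_def)
  have K: "K \<ge> 0" by (simp add: K_def)
  then have \<epsilon>: "\<epsilon> > 0" "\<epsilon> * K < 1" by (auto simp: \<epsilon>_def)
  define c where "c = of_real \<epsilon> * z"
  have c: "(cmod c)\<^sup>2 = \<epsilon>\<^sup>2 * (cmod z)\<^sup>2" by (simp add: c_def norm_mult power_mult_distrib)
  have cz: "cnj c * z = of_real (\<epsilon> * (cmod z)\<^sup>2)"
    by (simp add: c_def complex_norm_square mult_ac del: of_real_power)
  have "(norm (X (r + c *\<^sub>C w)))\<^sup>2 \<le> (norm (X r) * norm (r + c *\<^sub>C w))\<^sup>2"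
    by (intro power_mono max complex_vector.subspace_add[OF M] complex_vector.subspace_scale[OF M] r w) simp
  also have "\<dots> = (norm (X r))\<^sup>2 * (1 + (cmod c)\<^sup>2 * (norm w)\<^sup>2)"
    by (simp add: power_mult_distrib norm_add_sq r norm_scaleC cinner_scaleC_right w)
  also have "\<dots> = (norm (X r))\<^sup>2 + \<epsilon>\<^sup>2 * (cmod z)\<^sup>2 * K" by (simp add: c K_def algebra_simps)
  finally have "(norm (X r + c *\<^sub>C X w))\<^sup>2 \<le> (norm (X r))\<^sup>2 + \<epsilon>\<^sup>2 * (cmod z)\<^sup>2 * K"
    by (simp add: X')
  then have "(norm (c *\<^sub>C X w))\<^sup>2 + 2 * (\<epsilon> * (cmod z)\<^sup>2) \<le> \<epsilon>\<^sup>2 * (cmod z)\<^sup>2 * K"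
    by (simp add: norm_add_sq cinner_scaleC_right z_def[symmetric] cz del: of_real_mult of_real_power)
  then have "2 * (\<epsilon> * (cmod z)\<^sup>2) \<le> (\<epsilon> * K) * (\<epsilon> * (cmod z)\<^sup>2)"
    using zero_le_power2[of "norm (c *\<^sub>C X w)"]
    unfolding power2_eq_square[of \<epsilon>] by (simp only: mult_ac)
  also have "\<dots> \<le> 1 * (\<epsilon> * (cmod z)\<^sup>2)"
    by (intro mult_right_mono) (use \<epsilon> z in auto)
  finally show False using \<epsilon> z by simp
qed

lemma singular_system_exists:
  fixes X :: "'h::complex_hilbert \<Rightarrow> 'h"
  assumes e: "orthonormal (e :: nat \<Rightarrow> 'h)" and Xc: "X \<in> compact_ops"
  obtains s u where "singular_system X s u"
proof -
  have X: "bounded_clinear X" and comp: "compact (closure (X ` cball 0 1))"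
    using Xc by (auto simp: compact_ops_def)
  define M where "M f n = {x :: 'h. \<forall>k<n. cinner x (f k) = 0}" for f and n :: nat
  have subM: "csubspace (M f n)" for f n
    by (auto simp: M_def complex_vector.subspace_def cinner_add_left cinner_scaleC_left cinner.zero_left)
  have clM: "closed (M f n)" for f n
  proof -
    have "M f n = (\<Inter>k<n. {x. cinner x (f k) = 0})" by (auto simp: M_def)
    moreover have "closed {x. cinner x (f k) = 0}" for k
      by (intro closed_Collect_eq bounded_linear.continuous_on[OF cinner.bounded_linear_left])
        (auto intro: continuous_intros)
    ultimately show ?thesis by auto
  qed
  \<comment> \<open>The space \<open>M f n\<close> depends on all earlier values of f, hence a
    choice principle that sees the whole prefix.\<close>
  have "\<exists>f. \<forall>n. (f n \<in> M f n \<and> norm (f n) = 1 \<and> (\<forall>x\<in>M f n. norm (X x) \<le> norm (X (f n)) * norm x))"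
  proof (rule dependent_wellorder_choice)
    fix r and f g :: "nat \<Rightarrow> 'h" and n :: nat
    assume "\<And>k. k < n \<Longrightarrow> f k = g k"
    then have "M f n = M g n" by (simp add: M_def)
    then show "(r \<in> M f n \<and> norm r = 1 \<and> (\<forall>x\<in>M f n. norm (X x) \<le> norm (X r) * norm x))
      = (r \<in> M g n \<and> norm r = 1 \<and> (\<forall>x\<in>M g n. norm (X x) \<le> norm (X r) * norm x))" by simp
  next
    fix n :: nat and f
    \<comment> \<open>The orthonormal sequence e supplies a nonzero vector of \<open>M f n\<close>,
      so the recursion never stops, even if X has finite rank.\<close>
    have "\<exists>a. (\<Sum>j\<le>n. a j *\<^sub>C e j) \<noteq> 0 \<and> (\<forall>i<n. cinner (\<Sum>j\<le>n. a j *\<^sub>C e j) (f i) = 0)"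
      by (rule exists_common_kernel[OF e, of n "\<lambda>i x. cinner x (f i)"]) (simp_all add: cinner_add_left cinner_scaleC_left)
    then obtain a where a: "(\<Sum>j\<le>n. a j *\<^sub>C e j) \<noteq> 0" "\<And>i. i < n \<Longrightarrow> cinner (\<Sum>j\<le>n. a j *\<^sub>C e j) (f i) = 0"
      by blast
    have "(\<Sum>j\<le>n. a j *\<^sub>C e j) \<in> M f n" using a(2) by (simp add: M_def)
    from maximizing_vector[OF X comp clM subM this a(1)]
    show "\<exists>r. r \<in> M f n \<and> norm r = 1 \<and> (\<forall>x\<in>M f n. norm (X x) \<le> norm (X r) * norm x)" by metis
  qed
  then obtain u where u: "\<And>n. u n \<in> M u n" "\<And>n. norm (u n) = 1"
    "\<And>n x. x \<in> M u n \<Longrightarrow> norm (X x) \<le> norm (X (u n)) * norm x" by blast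
  have uM: "u n \<in> M u m" if "m \<le> n" for m n using u(1)[of n] that by (auto simp: M_def)
  have swap: "cinner x y = 0 \<longleftrightarrow> cinner y x = 0" for x y :: 'h
    using cinner_commute[of x y] by simp
  have uo: "cinner (u m) (u n) = 0" if "m \<noteq> n" for m n
    using u(1)[of m] u(1)[of n] that unfolding M_def
    by (cases m n rule: linorder_cases) (auto simp: swap[of "u m"])
  have on: "orthonormal u"
    using u(2) by (auto simp: orthonormal_def uo norm_eq_1_iff_cinner)
  \<comment> \<open>For m below n, \<open>u n\<close> lies in \<open>M u m\<close> and is orthogonal
    to the maximiser \<open>u m\<close>, so the first variation applies.\<close>
  have Xo1: "cinner (X (u m)) (X (u n)) = 0" if "m < n" for m n
    by (rule maximizing_vector_orthogonal[OF X subM[of u m] u(1) u(2) u(3)])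
      (use that uo uM in auto)
  have Xo: "cinner (X (u m)) (X (u n)) = 0" if "m \<noteq> n" for m n
    using Xo1[of m n] Xo1[of n m] that by (cases m n rule: linorder_cases) (auto simp: swap[of "X (u m)"])
  define s where "s n = norm (X (u n))" for n
  have sdec: "s (Suc n) \<le> s n" for n
    using u(3)[OF uM, of n "Suc n"] u(2) by (simp add: s_def)
  then have "decseq s" by (simp add: decseq_Suc_iff)
  have s0: "s \<longlonglongrightarrow> 0"
  proof -
    obtain L where L: "s \<longlonglongrightarrow> L" "\<And>n. L \<le> s n"
      using decseq_convergent[OF \<open>decseq s\<close>, of 0] by (auto simp: s_def)
    have L0: "L \<ge> 0" by (rule LIMSEQ_le_const[OF L(1)]) (auto simp: s_def)
    have "X (u k) \<in> closure (X ` cball 0 1)" for k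
      by (rule subsetD[OF closure_subset]) (use u(2) in auto)
    then obtain l \<rho> where \<rho>: "strict_mono \<rho>" "((\<lambda>k. X (u k)) \<circ> \<rho>) \<longlonglongrightarrow> l"
      using comp unfolding compact_def by meson
    \<comment> \<open>Orthogonal images of norm at least L have distance at least L, which a
      convergent subsequence rules out for positive L.\<close>
    have "L = 0"
    proof (rule ccontr)
      assume "L \<noteq> 0"
      then have "L > 0" using L0 by simp
      from metric_CauchyD[OF LIMSEQ_imp_Cauchy[OF \<rho>(2)] this]
      obtain N where N: "\<And>m n. m \<ge> N \<Longrightarrow> n \<ge> N \<Longrightarrow> norm (X (u (\<rho> m)) - X (u (\<rho> n))) < L"
        unfolding dist_norm o_def by blast
      let ?a = "X (u (\<rho> N))" and ?b = "X (u (\<rho> (Suc N)))"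
      have "\<rho> N \<noteq> \<rho> (Suc N)" using strict_mono_eq[OF \<rho>(1)] by simp
      then have "(norm (?a - ?b))\<^sup>2 = (s (\<rho> N))\<^sup>2 + (s (\<rho> (Suc N)))\<^sup>2"
        by (simp add: norm_diff_sq Xo s_def)
      also have "\<dots> \<ge> L\<^sup>2 + 0"
        by (intro add_mono power_mono L) (use L0 in auto)
      finally have "L\<^sup>2 \<le> (norm (?a - ?b))\<^sup>2" by simp
      then have "L \<le> norm (?a - ?b)" by (rule power2_le_imp_le) simp
      then show False using N[of N "Suc N"] by simp
    qed
    then show ?thesis using L by simp
  qed
  have "singular_system X s u"
    unfolding singular_system_def
  proof (intro conjI allI impI X on)
    show "s \<in> c0star" by (rule c0starI[OF _ sdec s0]) (simp add: s_def)
    show "cinner (X (u m)) (X (u n)) = (if m = n then complex_of_real ((s n)\<^sup>2) else 0)" for m n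
      by (simp add: Xo s_def cinner_self)
    fix x assume "\<forall>n. cinner x (u n) = 0"
    then have "x \<in> M u n" for n by (simp add: M_def)
    then have "norm (X x) \<le> s n * norm x" for n unfolding s_def by (rule u(3))
    moreover have "(\<lambda>n. s n * norm x) \<longlonglongrightarrow> 0 * norm x" by (intro tendsto_intros s0)
    ultimately have "norm (X x) \<le> 0" by (intro LIMSEQ_le_const[of "\<lambda>n. s n * norm x"]) auto
    then show "X x = 0" by simp
  qed
  then show ?thesis by (rule that)
qed

section \<open>Adjoint, eigenspaces and uniqueness of the s-numbers\<close>

lemma cinner_ext: "(\<And>x. cinner x a = cinner x b) \<Longrightarrow> a = b"
proof -
  assume "\<And>x. cinner x a = cinner x b"
  then have "cinner (a - b) (a - b) = 0" by (simp add: cinner.diff_right)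
  then show "a = b" by simp
qed

text \<open>The definite description is resolved by an explicit adjoint, the singular expansion with
  its two families exchanged: y goes to the sum of
  \<open>cinner y (X (u n)) *\<^sub>C u n\<close>.\<close>

lemma cinner_cadjoint:
  assumes S: "singular_system X s u"
  shows "cinner (X x) y = cinner x (cadjoint X y)"
proof -
  \<comment> \<open>Division by K brings the left vectors to norm at most 1, as the series bounds
    require; the added 1 keeps K positive when \<open>s 0 = 0\<close>.\<close>
  define K where "K = s 0 + 1"
  have K: "K > 0" using c0star_nonneg[OF ss_c0[OF S], of 0] by (simp add: K_def)
  define xt where "xt n = complex_of_real (inverse K) *\<^sub>C X (u n)" for n
  have "s n \<le> K" for n using c0star_antimono[OF ss_c0[OF S], of 0 n] by (simp add: K_def)
  then have xt: "norm (xt n) \<le> 1" for n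
    using K unfolding xt_def norm_scaleC norm_of_real ss_norm[OF S] by (simp add: field_simps)
  note o = orthonormal_cinner[OF ss_on[OF S]]
  have xo: "cinner (xt i) (xt j) = 0" if "i \<noteq> j" for i j
    using that by (simp add: xt_def cinner_scaleC_left cinner_scaleC_right ss_orth[OF S])
  have sm: "summable (\<lambda>n. cinner y (xt n) *\<^sub>C u n)" for y
    by (rule series_op_summable[where C=1]) (auto simp: o orthonormal_norm[OF ss_on[OF S]] xo xt)
  define Y where "Y y = complex_of_real K *\<^sub>C series_op xt u y" for y
  have Y: "cinner (X x) y = cinner x (Y y)" for x y
  proof -
    have "cinner (X x) y = (\<Sum>n. cinner (cinner x (u n) *\<^sub>C X (u n)) y)"
      unfolding ss_expand[OF S, of x] series_op_def
      by (rule bounded_linear.suminf[OF cinner.bounded_linear_left ss_summable[OF S]])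
    also have "\<dots> = (\<Sum>n. K * cinner x (cinner y (xt n) *\<^sub>C u n))"
    proof (rule suminf_cong)
      fix n
      have "cnj (cinner y (X (u n))) = cinner (X (u n)) y" by (rule cinner_commute[symmetric])
      then show "cinner (cinner x (u n) *\<^sub>C X (u n)) y = K * cinner x (cinner y (xt n) *\<^sub>C u n)"
        using K by (simp add: cinner_scaleC_left cinner_scaleC_right xt_def)
    qed
    also have "\<dots> = K * (\<Sum>n. cinner x (cinner y (xt n) *\<^sub>C u n))"
      by (rule suminf_mult[OF bounded_linear.summable[OF cinner.bounded_linear_right sm]])
    also have "(\<Sum>n. cinner x (cinner y (xt n) *\<^sub>C u n)) = cinner x (series_op xt u y)"
      unfolding series_op_def
      by (rule bounded_linear.suminf[OF cinner.bounded_linear_right sm, symmetric])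
    finally show ?thesis by (simp add: Y_def cinner_scaleC_right)
  qed
  have "cadjoint X = Y"
    unfolding cadjoint_def
  proof (rule the_equality)
    show "\<forall>x y. cinner (X x) y = cinner x (Y y)" using Y by blast
    fix Z assume "\<forall>x y. cinner (X x) y = cinner x (Z y)"
    then show "Z = Y" using Y by (intro ext cinner_ext) metis
  qed
  then show ?thesis using Y by simp
qed

lemma c0star_finite_level:
  assumes "s \<in> c0star" "t > 0" shows "finite {n. s n \<ge> t}"
proof -
  have "\<forall>\<^sub>F n in sequentially. s n < t" using order_tendstoD(2)[OF c0star_tendsto[OF assms(1)] assms(2)] .
  then obtain N where "\<And>n. n \<ge> N \<Longrightarrow> s n < t" unfolding eventually_sequentially by blast
  then have "{n. s n \<ge> t} \<subseteq> {..<N}" by (auto simp: not_le[symmetric])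
  then show ?thesis by (rule finite_subset) simp
qed

text \<open>The \<open>u n\<close> with \<open>s n = t\<close> form a basis of the eigenspace.
  Removing the components along them from an eigenvector leaves a vector orthogonal to every
  \<open>u k\<close>: by construction if \<open>s k = t\<close>, by distinctness of the eigenvalues
  otherwise. X kills this vector, and t > 0 then makes it 0.\<close>

lemma cdim_singular_space:
  fixes X :: "'h::complex_hilbert \<Rightarrow> 'h"
  assumes S: "singular_system X s u" and t: "t > 0"
  shows "cdim {v. cadjoint X (X v) = complex_of_real (t\<^sup>2) *\<^sub>C v} = card {n. s n = t}"
proof -
  let ?V = "{v. cadjoint X (X v) = complex_of_real (t\<^sup>2) *\<^sub>C v}"
  let ?A = "{n. s n = t}"
  note o = orthonormal_cinner[OF ss_on[OF S]]
  have V: "v \<in> ?V \<longleftrightarrow> (\<forall>x. cinner (X x) (X v) = t\<^sup>2 * cinner x v)" for v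
  proof
    show "v \<in> ?V \<Longrightarrow> \<forall>x. cinner (X x) (X v) = t\<^sup>2 * cinner x v"
      by (simp add: cinner_cadjoint[OF S] cinner_scaleC_right)
    assume "\<forall>x. cinner (X x) (X v) = t\<^sup>2 * cinner x v"
    then show "v \<in> ?V"
      unfolding mem_Collect_eq by (intro cinner_ext) (simp add: cinner_cadjoint[OF S] cinner_scaleC_right)
  qed
  have fin: "finite ?A" by (rule finite_subset[OF _ c0star_finite_level[OF ss_c0[OF S] t]]) auto
  have inj: "inj u" using o by (auto intro!: injI) (metis zero_neq_one)
  have V': "?V = {v. \<forall>x. cinner (X x) (X v) = t\<^sup>2 * cinner x v}" using V by blast
  have sub: "csubspace ?V"
    unfolding V' complex_vector.subspace_def
    by (auto simp: bounded_clinear_lin[OF ss_lin[OF S]] cinner.zero_right cinner_add_right cinner_scaleC_right algebra_simps)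
  have uV: "u n \<in> ?V" if "s n = t" for n
    unfolding V using that by (simp add: ss_cinner[OF S])
  have "v \<in> cspan (u ` ?A)" if v: "v \<in> ?V" for v
  proof -
    define w where "w = (\<Sum>n\<in>?A. cinner v (u n) *\<^sub>C u n)"
    have wV: "w \<in> ?V" unfolding w_def
      by (intro complex_vector.subspace_sum[OF sub] complex_vector.subspace_scale[OF sub] uV) simp
    have dV: "v - w \<in> ?V" by (rule complex_vector.subspace_diff[OF sub v wV])
    have "cinner (v - w) (u k) = 0" for k
    proof (cases "s k = t")
      case True
      have "cinner w (u k) = (\<Sum>n\<in>?A. if k = n then cinner v (u n) else 0)"
        unfolding w_def cinner.sum_left by (intro sum.cong) (auto simp: cinner_scaleC_left o)
      also have "\<dots> = cinner v (u k)" using True fin by (subst sum.delta') auto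
      finally show ?thesis by (simp add: cinner.diff_left)
    next
      case False
      have "(s k)\<^sup>2 \<noteq> t\<^sup>2" using False t c0star_nonneg[OF ss_c0[OF S], of k] by (simp add: power2_eq_iff_nonneg)
      have "cinner (X (v - w)) (X (u k)) = cnj (cinner (X (u k)) (X (v - w)))" by (rule cinner_commute)
      also have "\<dots> = t\<^sup>2 * cinner (v - w) (u k)"
        using dV unfolding V by (subst (2) cinner_commute) simp
      finally have "((s k)\<^sup>2 - t\<^sup>2) * cinner (v - w) (u k) = 0"
        by (simp add: ss_cinner[OF S] algebra_simps)
      then show ?thesis using \<open>(s k)\<^sup>2 \<noteq> t\<^sup>2\<close>
        by (metis mult_eq_0_iff eq_iff_diff_eq_0 of_real_eq_0_iff of_real_diff of_real_power)
    qed
    then have "X (v - w) = 0" by (rule ss_ker[OF S])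
    then have "\<forall>x. complex_of_real (t\<^sup>2) * cinner x (v - w) = 0" using dV unfolding V by (simp add: cinner.zero_right)
    then have "cinner (v - w) (v - w) = 0" using t by auto
    then have "v = w" by simp
    moreover have "w \<in> cspan (u ` ?A)"
      unfolding w_def
      by (intro complex_vector.span_sum complex_vector.span_scale complex_vector.span_base) simp
    ultimately show ?thesis by simp
  qed
  then have span: "cspan (u ` ?A) = ?V"
    using complex_vector.span_minimal[OF _ sub, of "u ` ?A"] uV by auto
  have "\<not> cdependent (u ` ?A)"
  proof
    assume "cdependent (u ` ?A)"
    then obtain g where g: "\<exists>v\<in>u ` ?A. g v \<noteq> 0" "(\<Sum>v\<in>u ` ?A. g v *\<^sub>C v) = 0"
      using fin by (subst (asm) complex_vector.dependent_finite) auto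
    then obtain k where k: "s k = t" "g (u k) \<noteq> 0" by blast
    have "0 = cinner (\<Sum>n\<in>?A. g (u n) *\<^sub>C u n) (u k)"
      using g(2) inj by (subst (asm) sum.reindex) (auto simp: inj_on_def inj_def o_def cinner.zero_left)
    also have "\<dots> = (\<Sum>n\<in>?A. if k = n then g (u n) else 0)"
      unfolding cinner.sum_left by (intro sum.cong) (auto simp: cinner_scaleC_left o)
    also have "\<dots> = g (u k)" using k fin by (subst sum.delta') auto
    finally show False using k by simp
  qed
  then have "cdim ?V = card (u ` ?A)"
    by (intro complex_vector.dim_eq_card)
      (simp_all only: span complex_vector.span_eq_iff[THEN iffD2, OF sub] not_False_eq_True)
  also have "\<dots> = card ?A" by (rule card_image) (use inj in \<open>auto simp: inj_on_def inj_def\<close>)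
  finally show ?thesis .
qed

text \<open>At a first difference with \<open>a n > b n\<close>, every occurrence of the positive
  value \<open>a n\<close> in b lies before n and is shared with a, while a has a further one at n.
  The counts are finite because a tends to 0, so they differ.\<close>

lemma c0star_eqI:
  assumes "s \<in> c0star" "s' \<in> c0star" and card: "\<And>t. t > 0 \<Longrightarrow> card {n. s n = t} = card {n. s' n = t}"
  shows "s = s'"
proof -
  have aux: "a n \<le> b n" if a: "a \<in> c0star" and b: "b \<in> c0star" and eq: "\<And>k. k < n \<Longrightarrow> a k = b k"
    and card: "\<And>t. t > 0 \<Longrightarrow> card {n. a n = t} = card {n. b n = t}" for a b :: "nat \<Rightarrow> real" and n
  proof (rule ccontr)
    assume "\<not> a n \<le> b n"
    then have lt: "b n < a n" by simp
    then have pos: "a n > 0" using c0star_nonneg[OF b, of n] by simp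
    have "{k. b k = a n} \<subseteq> {k. a k = a n} - {n}"
    proof
      fix k assume "k \<in> {k. b k = a n}"
      then have "b k = a n" by simp
      then have "k < n" using c0star_antimono[OF b, of n k] lt by (cases "k < n") auto
      then show "k \<in> {k. a k = a n} - {n}" using eq \<open>b k = a n\<close> by auto
    qed
    then have "{k. b k = a n} \<subset> {k. a k = a n}" by blast
    moreover have "finite {k. a k = a n}"
      by (rule finite_subset[OF _ c0star_finite_level[OF a pos]]) auto
    ultimately have "card {k. b k = a n} < card {k. a k = a n}" by (rule psubset_card_mono[rotated])
    then show False using card[OF pos] by simp
  qed
  have "s n = s' n" for n
  proof (induction n rule: less_induct)
    case (less n)
    then show ?case using aux[of s s' n] aux[of s' s n] assms by (simp add: order_antisym)
  qed
  then show ?thesis by blast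
qed

lemma s_numbers_eq:
  assumes S: "singular_system X s u"
  shows "s_numbers X = s"
  unfolding s_numbers_def
proof (rule the_equality)
  show "s \<in> c0star \<and> (\<forall>t>0. card {n. s n = t} = cdim {v. cadjoint X (X v) = complex_of_real (t\<^sup>2) *\<^sub>C v})"
    using cdim_singular_space[OF S] ss_c0[OF S] by auto
  fix s' assume "s' \<in> c0star \<and> (\<forall>t>0. card {n. s' n = t} = cdim {v. cadjoint X (X v) = complex_of_real (t\<^sup>2) *\<^sub>C v})"
  then show "s' = s" using cdim_singular_space[OF S] ss_c0[OF S] by (intro c0star_eqI) auto
qed

section \<open>Ideals and their characteristic sets\<close>

lemma c0star_add: "s \<in> c0star \<Longrightarrow> t \<in> c0star \<Longrightarrow> (\<lambda>n. s n + t n) \<in> c0star"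
  unfolding c0star_def decseq_def by (auto intro: add_mono tendsto_add_zero)

lemma c0star_ampliation:
  assumes s: "s \<in> c0star" and m: "m \<ge> 1" shows "(\<lambda>n. s (n div m)) \<in> c0star"
proof -
  have "filterlim (\<lambda>n. n div m) at_top sequentially"
    unfolding filterlim_at_top eventually_sequentially
    using m by (auto intro!: exI[of _ "_ * m"] simp: less_eq_div_iff_mult_less_eq)
  then have "(\<lambda>n. s (n div m)) \<longlonglongrightarrow> 0" by (rule filterlim_compose[OF c0star_tendsto[OF s]])
  then show ?thesis using s by (auto simp: c0star_def decseq_def div_le_mono)
qed

section \<open>Closure properties of the compact operators\<close>

lemma compact_opsI:
  assumes "bounded_clinear X" "compact K" "X ` cball 0 1 \<subseteq> K"
  shows "X \<in> compact_ops"
proof -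
  have "closure (X ` cball 0 1) \<subseteq> K"
    by (rule closure_minimal[OF assms(3) compact_imp_closed[OF assms(2)]])
  then have "closure (X ` cball 0 1) = K \<inter> closure (X ` cball 0 1)" by blast
  moreover have "compact (K \<inter> closure (X ` cball 0 1))"
    using assms(2) closed_closure by (rule compact_Int_closed)
  ultimately show ?thesis using assms(1) by (simp add: compact_ops_def)
qed

lemma bounded_clinear_add:
  assumes "bounded_clinear X" "bounded_clinear Y" shows "bounded_clinear (\<lambda>x. X x + Y x)"
  using assms unfolding bounded_clinear_def by (auto intro: bounded_linear_add simp: scaleC_add_right)

lemma bounded_clinear_comp:
  assumes "bounded_clinear X" "bounded_clinear Y" shows "bounded_clinear (X \<circ> Y)"
  using assms unfolding bounded_clinear_def comp_def by (auto intro: bounded_linear_compose)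

lemma bounded_clinear_id: "bounded_clinear id"
  and bounded_clinear_zero: "bounded_clinear (\<lambda>_. 0)"
  by (auto simp: bounded_clinear_def id_def scaleC.zero_right)

lemma bounded_clinear_uminus: "bounded_clinear uminus"
  by (simp add: bounded_clinear_def bounded_linear_minus[OF bounded_linear_ident] scaleC.minus_right)

lemma bounded_clinear_rank_one: "bounded_clinear (\<lambda>x. cinner x a *\<^sub>C v)"
  unfolding bounded_clinear_def
  by (auto simp: cinner_scaleC_left scaleC_scaleC
      intro: bounded_linear_compose[OF scaleC.bounded_linear_left cinner.bounded_linear_left])

lemma compact_ops_bounded: "X \<in> compact_ops \<Longrightarrow> bounded_clinear X"
  by (simp add: compact_ops_def)

lemma compact_ops_add:
  assumes "X \<in> compact_ops" "Y \<in> compact_ops"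
  shows "(\<lambda>x. X x + Y x) \<in> compact_ops"
proof (rule compact_opsI)
  let ?A = "closure (X ` cball 0 1)" and ?B = "closure (Y ` cball 0 1)"
  show "bounded_clinear (\<lambda>x. X x + Y x)" using assms by (intro bounded_clinear_add compact_ops_bounded)
  show "compact {x + y |x y. x \<in> ?A \<and> y \<in> ?B}"
    by (rule compact_sums) (use assms in \<open>auto simp: compact_ops_def\<close>)
  show "(\<lambda>x. X x + Y x) ` cball 0 1 \<subseteq> {x + y |x y. x \<in> ?A \<and> y \<in> ?B}"
    by (auto intro!: subsetD[OF closure_subset] exI)
qed

lemma compact_ops_comp:
  assumes X: "X \<in> compact_ops" and A: "bounded_clinear A" and B: "bounded_clinear B"
  shows "A \<circ> X \<circ> B \<in> compact_ops"
proof -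
  note A' = bounded_clinear_lin[OF A] and X' = bounded_clinear_lin[OF compact_ops_bounded[OF X]]
  obtain b where b: "b > 0" "\<And>x. norm (B x) \<le> norm x * b"
    using bounded_linear.pos_bounded[OF bounded_clinear_lin(6)[OF B]] by blast
  \<comment> \<open>B maps the unit ball into the ball of radius b, whence the dilation by
    b.\<close>
  let ?K = "A ` ((\<lambda>x. b *\<^sub>R x) ` closure (X ` cball 0 1))"
  have 1: "compact ?K"
    using X by (intro compact_continuous_image bounded_linear.continuous_on[OF A'(6)] continuous_intros)
      (auto simp: compact_ops_def)
  have 2: "(A \<circ> X \<circ> B) ` cball 0 1 \<subseteq> ?K"
  proof
    fix z assume "z \<in> (A \<circ> X \<circ> B) ` cball 0 1"
    then obtain x where x: "norm x \<le> 1" "z = A (X (B x))" by auto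
    let ?y = "(1 / b) *\<^sub>R B x"
    have "norm (B x) \<le> 1 * b" using b(2)[of x] mult_right_mono[OF x(1), of b] b(1) by linarith
    then have "?y \<in> cball 0 1" using b(1) by (simp add: field_simps)
    then have "X ?y \<in> closure (X ` cball 0 1)" by (intro subsetD[OF closure_subset] imageI)
    then have "b *\<^sub>R X ?y \<in> (\<lambda>x. b *\<^sub>R x) ` closure (X ` cball 0 1)" by (rule imageI)
    moreover have "b *\<^sub>R X ?y = X (b *\<^sub>R ?y)"
      by (rule linear_scale[OF bounded_linear.linear[OF X'(6)], symmetric])
    then have "X (B x) = b *\<^sub>R X ?y" using b(1) by simp
    ultimately have "X (B x) \<in> (\<lambda>x. b *\<^sub>R x) ` closure (X ` cball 0 1)" by (simp only:)
    then show "z \<in> ?K" unfolding x(2) by (rule imageI)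
  qed
  show ?thesis
    by (rule compact_opsI[OF _ 1 2]) (intro bounded_clinear_comp A B compact_ops_bounded[OF X])
qed

lemma compact_ops_rank_one: "(\<lambda>x. cinner x a *\<^sub>C v) \<in> compact_ops"
proof (rule compact_opsI[OF bounded_clinear_rank_one])
  show "compact ((\<lambda>z. z *\<^sub>C v) ` cball 0 (norm a))"
    by (intro compact_continuous_image bounded_linear.continuous_on[OF scaleC.bounded_linear_left]
        continuous_intros compact_cball)
  show "(\<lambda>x. cinner x a *\<^sub>C v) ` cball 0 1 \<subseteq> (\<lambda>z. z *\<^sub>C v) ` cball 0 (norm a)"
  proof
    fix y assume "y \<in> (\<lambda>x. cinner x a *\<^sub>C v) ` cball 0 1"
    then obtain x where x: "norm x \<le> 1" "y = cinner x a *\<^sub>C v" by auto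
    have "cmod (cinner x a) \<le> 1 * norm a"
      using cmod_cinner_le[of x a] mult_right_mono[OF x(1), of "norm a"] by simp
    then show "y \<in> (\<lambda>z. z *\<^sub>C v) ` cball 0 (norm a)" using x by auto
  qed
qed

lemma compact_ops_zero: "(\<lambda>_. 0) \<in> compact_ops"
  using compact_ops_rank_one[of 0 0] by (simp add: scaleC.zero_right)

lemma compact_ops_sum:
  assumes "\<And>i. i \<in> A \<Longrightarrow> X i \<in> compact_ops"
  shows "(\<lambda>x. \<Sum>i\<in>A. X i x) \<in> compact_ops"
  using assms
  by (induction A rule: infinite_finite_induct) (auto intro: compact_ops_zero compact_ops_add)

lemma compact_ops_limit:
  assumes X: "bounded_clinear X"
    and lim: "\<And>\<epsilon>. \<epsilon> > 0 \<Longrightarrow> \<exists>K\<in>compact_ops. \<forall>x. norm (X x - K x) \<le> \<epsilon> * norm x"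
  shows "X \<in> compact_ops"
proof -
  let ?S = "closure (X ` cball 0 1)"
  have "\<exists>k. finite k \<and> ?S \<subseteq> (\<Union>x\<in>k. ball x \<epsilon>)" if \<epsilon>: "\<epsilon> > 0" for \<epsilon>
  proof -
    obtain K where K: "K \<in> compact_ops" "\<And>x. norm (X x - K x) \<le> \<epsilon> / 4 * norm x"
      using lim[of "\<epsilon> / 4"] \<epsilon> by auto
    have "compact (closure (K ` cball 0 1))" using K(1) by (simp add: compact_ops_def)
    moreover have "\<epsilon> / 4 > 0" using \<epsilon> by simp
    ultimately obtain k where k: "finite k" "closure (K ` cball 0 1) \<subseteq> (\<Union>x\<in>k. ball x (\<epsilon> / 4))"
      unfolding compact_eq_totally_bounded by blast
    \<comment> \<open>A finite union of closed balls is closed, so this cover passes to the closure;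
      doubling the radius then makes the balls open.\<close>
    have "X ` cball 0 1 \<subseteq> (\<Union>x\<in>k. cball x (\<epsilon> / 2))"
    proof
      fix z assume "z \<in> X ` cball 0 1"
      then obtain x where x: "norm x \<le> 1" "z = X x" by auto
      have "K x \<in> closure (K ` cball 0 1)" by (rule subsetD[OF closure_subset]) (use x in auto)
      then obtain c where c: "c \<in> k" "dist c (K x) < \<epsilon> / 4" using k by auto
      have "\<epsilon> / 4 * norm x \<le> \<epsilon> / 4 * 1" by (rule mult_left_mono) (use x \<epsilon> in auto)
      then have "dist (K x) (X x) \<le> \<epsilon> / 4" using K(2)[of x] by (simp add: dist_norm norm_minus_commute)
      then have "dist c z \<le> \<epsilon> / 2" unfolding x(2) using c dist_triangle[of c "X x" "K x"] by linarith
      then show "z \<in> (\<Union>x\<in>k. cball x (\<epsilon> / 2))" using c by auto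
    qed
    moreover have "closed (\<Union>x\<in>k. cball x (\<epsilon> / 2))" using k(1) by auto
    ultimately have "?S \<subseteq> (\<Union>x\<in>k. cball x (\<epsilon> / 2))" by (rule closure_minimal)
    also have "\<dots> \<subseteq> (\<Union>x\<in>k. ball x \<epsilon>)" using \<epsilon> by (intro UN_mono) auto
    finally show ?thesis using k(1) by blast
  qed
  moreover have "complete ?S" by (simp add: complete_eq_closed)
  ultimately have "compact ?S" unfolding compact_eq_totally_bounded by blast
  then show ?thesis using X by (simp add: compact_ops_def)
qed

lemma series_op_basis: "orthonormal u \<Longrightarrow> series_op u b (u k) = b k"
proof -
  assume u: "orthonormal u"
  have "series_op u b (u k) = (\<Sum>n. if n = k then b k else 0)"
    unfolding series_op_def
    by (intro suminf_cong) (auto simp: orthonormal_cinner[OF u] scaleC.zero_left)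
  also have "\<dots> = b k" using sums_If_finite_set[of "{k}" "\<lambda>_. b k"] by (simp add: sums_iff)
  finally show ?thesis .
qed

section \<open>Diagonal operators\<close>

context
  fixes e :: "nat \<Rightarrow> 'h::complex_hilbert"
  assumes e: "orthonormal_basis e"
begin

lemma diag_op_series: "diag_op e s = series_op e (\<lambda>n. complex_of_real (s n) *\<^sub>C e n)"
  by (rule ext) (simp add: diag_op_def series_op_def scaleC_scaleC mult.commute)

lemma diag_op_basis: "diag_op e s (e n) = complex_of_real (s n) *\<^sub>C e n"
  unfolding diag_op_series by (rule series_op_basis[OF onb_orthonormal[OF e]])

lemma diag_op_truncation:
  assumes s: "s \<in> c0star"
  shows "norm (series_op e (\<lambda>n. if n < N then 0 else complex_of_real (s n) *\<^sub>C e n) x) \<le> s N * norm x"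
    "summable (\<lambda>n. cinner x (e n) *\<^sub>C (if n < N then 0 else complex_of_real (s n) *\<^sub>C e n))"
    "bounded_clinear (series_op e (\<lambda>n. if n < N then 0 else complex_of_real (s n) *\<^sub>C e n))"
proof -
  let ?b = "\<lambda>n. if n < N then 0 else complex_of_real (s n) *\<^sub>C e n"
  note o = orthonormal_cinner[OF onb_orthonormal[OF e]] orthonormal_norm[OF onb_orthonormal[OF e]]
  have b: "cinner (?b i) (?b j) = 0" if "i \<noteq> j" for i j
    using that by (simp add: cinner_scaleC_left cinner_scaleC_right o cinner.zero_left cinner.zero_right)
  have n: "norm (?b i) \<le> s N" for i
    using c0star_nonneg[OF s] c0star_antimono[OF s, of N i] by (auto simp: norm_scaleC o)
  show "norm (series_op e ?b x) \<le> s N * norm x"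
    by (rule norm_series_op_le) (use b n in \<open>simp_all add: o\<close>)
  show "summable (\<lambda>n. cinner x (e n) *\<^sub>C ?b n)"
    by (rule series_op_summable[where C="s N"]) (use b n in \<open>simp_all add: o\<close>)
  show "bounded_clinear (series_op e ?b)"
    by (rule bounded_clinear_series_op[where C="s N"]) (use b n in \<open>simp_all add: o\<close>)
qed

lemma bounded_clinear_diag: "s \<in> c0star \<Longrightarrow> bounded_clinear (diag_op e s)"
  using diag_op_truncation(3)[of s 0] by (simp add: diag_op_series)

text \<open>The tail of the diagonal from N on has norm at most \<open>s N\<close>, so the finite
  rank truncations converge in operator norm.\<close>

lemma diag_op_compact:
  assumes s: "s \<in> c0star"
  shows "diag_op e s \<in> compact_ops"
proof (rule compact_ops_limit[OF bounded_clinear_diag[OF s]])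
  fix \<epsilon> :: real assume "\<epsilon> > 0"
  then obtain N where N: "s N < \<epsilon>"
    using order_tendstoD(2)[OF c0star_tendsto[OF s]] by (auto simp: eventually_sequentially)
  let ?K = "\<lambda>x. \<Sum>n<N. cinner x (e n) *\<^sub>C (complex_of_real (s n) *\<^sub>C e n)"
  let ?b = "\<lambda>n. if n < N then 0 else complex_of_real (s n) *\<^sub>C e n"
  have "diag_op e s x - ?K x = series_op e ?b x" for x
  proof -
    have sm: "summable (\<lambda>n. cinner x (e n) *\<^sub>C (complex_of_real (s n) *\<^sub>C e n))"
      using diag_op_truncation(2)[OF s, of x 0] by simp
    have "diag_op e s x - ?K x = (\<Sum>n. cinner x (e (n + N)) *\<^sub>C (complex_of_real (s (n + N)) *\<^sub>C e (n + N)))"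
      using suminf_split_initial_segment[OF sm, of N] by (simp add: diag_op_series series_op_def)
    also have "\<dots> = series_op e ?b x"
      unfolding series_op_def
      using suminf_split_initial_segment[OF diag_op_truncation(2)[OF s, of x N], of N]
      by (simp add: scaleC.zero_right)
    finally show ?thesis .
  qed
  then have "norm (diag_op e s x - ?K x) \<le> \<epsilon> * norm x" for x
    using order_trans[OF diag_op_truncation(1)[OF s, of N x] mult_right_mono[OF less_imp_le[OF N]]] by simp
  moreover have "?K \<in> compact_ops" by (intro compact_ops_sum compact_ops_rank_one)
  ultimately show "\<exists>K\<in>compact_ops. \<forall>x. norm (diag_op e s x - K x) \<le> \<epsilon> * norm x"
    by (intro bexI[of _ ?K]) simp_all
qed

lemma singular_system_diag:
  assumes s: "s \<in> c0star"
  shows "singular_system (diag_op e s) s e"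
proof -
  have "x = 0" if "\<forall>n. cinner x (e n) = 0" for x using that onb_total[OF e] by blast
  then show ?thesis
    using s onb_orthonormal[OF e] bounded_clinear_lin(3)[OF bounded_clinear_diag[OF s]]
    by (auto simp: singular_system_def bounded_clinear_diag diag_op_basis cinner_scaleC_left cinner_scaleC_right
       orthonormal_def power2_eq_square)
qed

lemma s_numbers_diag: "s \<in> c0star \<Longrightarrow> s_numbers (diag_op e s) = s"
  by (rule s_numbers_eq[OF singular_system_diag])

lemma s_numbers_system:
  fixes X :: "'h \<Rightarrow> 'h"
  assumes "X \<in> compact_ops"
  shows "\<exists>u. singular_system X (s_numbers X) u"
proof -
  obtain s u where "singular_system X s u"
    using singular_system_exists[OF onb_orthonormal[OF e] assms] .
  then show ?thesis using s_numbers_eq by metis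
qed

lemma s_numbers_c0star: "(X :: 'h \<Rightarrow> 'h) \<in> compact_ops \<Longrightarrow> s_numbers X \<in> c0star"
  using s_numbers_system ss_c0 by metis

end

section \<open>The correspondence between ideals and characteristic sets\<close>

lemma op_ideal_compact: "op_ideal J \<Longrightarrow> X \<in> J \<Longrightarrow> X \<in> compact_ops"
  by (auto simp: op_ideal_def)

lemma op_ideal_zero: "op_ideal J \<Longrightarrow> (\<lambda>_. 0) \<in> J"
  using additive_subgroup.zero_closed[OF ideal.axioms(1), of J BH] by (auto simp: op_ideal_def BH_def)

lemma op_ideal_add: "op_ideal J \<Longrightarrow> X \<in> J \<Longrightarrow> Y \<in> J \<Longrightarrow> (\<lambda>x. X x + Y x) \<in> J"
  using additive_subgroup.a_closed[OF ideal.axioms(1), of J BH X Y] by (auto simp: op_ideal_def BH_def)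

lemma op_ideal_comp:
  assumes "op_ideal J" "X \<in> J" "bounded_clinear A" "bounded_clinear B"
  shows "A \<circ> X \<circ> B \<in> J"
proof -
  have J: "ideal J BH" using assms by (simp add: op_ideal_def)
  have "A \<circ> X \<in> J" using ideal.I_l_closed[OF J, of X A] assms by (simp add: BH_def)
  then show ?thesis using ideal.I_r_closed[OF J, of "A \<circ> X" B] assms by (simp add: BH_def)
qed

lemma op_ideal_sum:
  assumes "op_ideal J" "\<And>i. i \<in> A \<Longrightarrow> X i \<in> J"
  shows "(\<lambda>x. \<Sum>i\<in>A. X i x) \<in> J"
  using assms(2)
  by (induction A rule: infinite_finite_induct) (auto intro: op_ideal_zero op_ideal_add assms(1))

lemma op_idealI:
  assumes sub: "J \<subseteq> compact_ops" and zero: "(\<lambda>_. 0) \<in> J"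
    and add: "\<And>X Y. X \<in> J \<Longrightarrow> Y \<in> J \<Longrightarrow> (\<lambda>x. X x + Y x) \<in> J"
    and comp: "\<And>X A B. X \<in> J \<Longrightarrow> bounded_clinear A \<Longrightarrow> bounded_clinear B \<Longrightarrow> A \<circ> X \<circ> B \<in> J"
  shows "op_ideal J"
proof -
  interpret ring "BH :: ('a \<Rightarrow> 'a) ring" by (rule ring_BH)
  have bdd: "X \<in> J \<Longrightarrow> X \<in> carrier BH" for X
    using sub by (auto simp: BH_def dest: compact_ops_bounded)
  have "ideal J BH"
  proof (rule idealI[OF ring_BH])
    show "subgroup J (add_monoid BH)"
    proof (rule subgroup.intro)
      show "J \<subseteq> carrier (add_monoid BH)" using bdd by auto
      show "x \<otimes>\<^bsub>add_monoid BH\<^esub> y \<in> J" if "x \<in> J" "y \<in> J" for x y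
        using add[OF that] by (simp add: BH_def)
      show "\<one>\<^bsub>add_monoid BH\<^esub> \<in> J" using zero by (simp add: BH_def)
      show "inv\<^bsub>add_monoid BH\<^esub> X \<in> J" if X: "X \<in> J" for X
      proof -
        have neg: "(\<lambda>x. - X x) \<in> J"
          using comp[OF X bounded_clinear_uminus bounded_clinear_id] by (simp add: o_def)
        have "\<ominus>\<^bsub>BH\<^esub> X = (\<lambda>x. - X x)"
          by (rule minus_equality) (use bdd[OF X] bdd[OF neg] in \<open>simp_all add: BH_def\<close>)
        then show ?thesis using neg by (simp add: a_inv_def)
      qed
    qed
    show "x \<otimes>\<^bsub>BH\<^esub> a \<in> J" if "a \<in> J" "x \<in> carrier BH" for a x
      using comp[OF that(1), of x id] that bounded_clinear_id by (simp add: BH_def)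
    show "a \<otimes>\<^bsub>BH\<^esub> x \<in> J" if "a \<in> J" "x \<in> carrier BH" for a x
      using comp[OF that(1), of id x] that bounded_clinear_id by (simp add: BH_def)
  qed
  then show ?thesis using sub by (simp add: op_ideal_def)
qed

context
  fixes e :: "nat \<Rightarrow> 'h::complex_hilbert"
  assumes e: "orthonormal_basis e"
begin

text \<open>X factors through Y with bounded outer factors; hence membership of a compact operator
  in an ideal depends on its s-numbers alone.\<close>

lemma op_ideal_mem_of_le:
  assumes J: "op_ideal J" and Y: "Y \<in> J" and X: "(X :: 'h \<Rightarrow> 'h) \<in> compact_ops"
    and le: "\<And>n. s_numbers X n \<le> C * s_numbers Y n"
  shows "X \<in> J"
proof -
  obtain u where u: "singular_system X (s_numbers X) u" using s_numbers_system[OF e X] by blast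
  obtain w where w: "singular_system Y (s_numbers Y) w"
    using s_numbers_system[OF e op_ideal_compact[OF J Y]] by blast
  obtain A B where "bounded_clinear A" "bounded_clinear B" "X = A \<circ> Y \<circ> B"
    using singular_system_factor[OF u w le] .
  then show ?thesis using op_ideal_comp[OF J Y] by simp
qed

context
  fixes J :: "('h \<Rightarrow> 'h) set"
  assumes J: "op_ideal J"
begin

lemma op_ideal_mem_iff: "X \<in> J \<longleftrightarrow> X \<in> compact_ops \<and> s_numbers X \<in> char_set J"
proof
  show "X \<in> J \<Longrightarrow> X \<in> compact_ops \<and> s_numbers X \<in> char_set J"
    using op_ideal_compact[OF J] by (auto simp: char_set_def)
  assume X: "X \<in> compact_ops \<and> s_numbers X \<in> char_set J"
  then obtain Y where "Y \<in> J" "s_numbers X = s_numbers Y" by (auto simp: char_set_def)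
  then show "X \<in> J" using op_ideal_mem_of_le[OF J, of Y X 1] X by simp
qed

lemma char_set_c0star: "s \<in> char_set J \<Longrightarrow> s \<in> c0star"
  using op_ideal_compact[OF J] s_numbers_c0star[OF e] by (auto simp: char_set_def)

lemma diag_op_mem_iff: "s \<in> c0star \<Longrightarrow> diag_op e s \<in> J \<longleftrightarrow> s \<in> char_set J"
  by (simp add: op_ideal_mem_iff diag_op_compact[OF e] s_numbers_diag[OF e])

lemma char_set_le:
  assumes t: "t \<in> char_set J" and s: "s \<in> c0star" and le: "\<And>n. s n \<le> C * t n"
  shows "s \<in> char_set J"
proof -
  have t0: "t \<in> c0star" by (rule char_set_c0star[OF t])
  have "diag_op e s \<in> J"
    by (rule op_ideal_mem_of_le[OF J, of "diag_op e t"])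
      (use t t0 s le in \<open>simp_all add: diag_op_mem_iff diag_op_compact[OF e] s_numbers_diag[OF e]\<close>)
  then show ?thesis using s by (simp add: diag_op_mem_iff)
qed

lemma char_set_zero: "(\<lambda>_. 0) \<in> char_set J"
proof -
  have z: "(\<lambda>_. 0) \<in> c0star" by (simp add: c0star_def decseq_def)
  have "diag_op e (\<lambda>_. 0) = (\<lambda>_. 0)" by (rule ext) (simp add: diag_op_def scaleC.zero_left)
  then show ?thesis using op_ideal_zero[OF J] diag_op_mem_iff[OF z] by simp
qed

lemma char_set_add:
  assumes s: "s \<in> char_set J" and t: "t \<in> char_set J"
  shows "(\<lambda>n. s n + t n) \<in> char_set J"
proof -
  note s0 = char_set_c0star[OF s] and t0 = char_set_c0star[OF t]
  have "diag_op e (\<lambda>n. s n + t n) = (\<lambda>x. diag_op e s x + diag_op e t x)"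
    using c0star_add[OF s0 t0] s0 t0
    by (intro bounded_clinear_eqI[OF e] bounded_clinear_add bounded_clinear_diag[OF e])
      (simp_all add: diag_op_basis[OF e] scaleC_add_left)
  also have "\<dots> \<in> J" using s t s0 t0 by (intro op_ideal_add J) (simp_all add: diag_op_mem_iff)
  finally show ?thesis using c0star_add[OF s0 t0] by (simp add: diag_op_mem_iff)
qed

text \<open>\<open>V r\<close> is the isometry sending \<open>e n\<close> to
  \<open>e (m * n + r)\<close> and \<open>W r\<close> reverses it, so for r below m
  \<open>T r\<close> puts a copy of s on the residue class r. Adding these copies repeats each entry
  m times.\<close>

lemma char_set_ampliation:
  assumes s: "s \<in> char_set J" and m: "m \<ge> 1"
  shows "(\<lambda>n. s (n div m)) \<in> char_set J"
proof -
  note s0 = char_set_c0star[OF s]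
  note on = orthonormal_cinner[OF onb_orthonormal[OF e]] orthonormal_norm[OF onb_orthonormal[OF e]]
  define V where "V r = series_op e (\<lambda>n. e (m * n + r))" for r
  define W where "W r = series_op (\<lambda>n. e (m * n + r)) e" for r
  define T where "T r = V r \<circ> diag_op e s \<circ> W r" for r
  have V: "bounded_clinear (V r)" for r
    unfolding V_def by (rule bounded_clinear_series_op[where C=1]) (use m in \<open>simp_all add: on\<close>)
  have W: "bounded_clinear (W r)" for r
    unfolding W_def by (rule bounded_clinear_series_op[where C=1]) (use m in \<open>simp_all add: on\<close>)
  have Wb: "W r (e k) = (if k mod m = r then e (k div m) else 0)" if r: "r < m" for r k
  proof -
    have eq: "k = m * n + r \<longleftrightarrow> k mod m = r \<and> n = k div m" for n using r by auto
    have "W r (e k) = (\<Sum>n. if n \<in> {k div m} then (if k mod m = r then e (k div m) else 0) else 0)"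
      unfolding W_def series_op_def
      by (intro suminf_cong) (auto simp: on eq scaleC.zero_left)
    also have "\<dots> = (if k mod m = r then e (k div m) else 0)"
      using sums_If_finite_set[of "{k div m}" "\<lambda>_. (if k mod m = r then e (k div m) else 0)"]
      by (simp add: sums_iff)
    finally show ?thesis .
  qed
  have Tb: "T r (e k) = (if k mod m = r then complex_of_real (s (k div m)) *\<^sub>C e k else 0)" if r: "r < m" for r k
    using bounded_clinear_lin(3)[OF bounded_clinear_diag[OF e s0]] bounded_clinear_lin(2,3)[OF V]
      series_op_basis[OF onb_orthonormal[OF e]]
    by (auto simp: T_def Wb[OF r] diag_op_basis[OF e] V_def)
  have T: "bounded_clinear (T r)" for r
    unfolding T_def by (intro bounded_clinear_comp V W bounded_clinear_diag[OF e s0])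
  have TJ: "T r \<in> J" for r
    unfolding T_def using s s0 by (intro op_ideal_comp[OF J] V W) (simp add: diag_op_mem_iff)
  have TS: "(\<lambda>x. \<Sum>r<m. T r x) \<in> J" by (intro op_ideal_sum J TJ)
  have "diag_op e (\<lambda>n. s (n div m)) = (\<lambda>x. \<Sum>r<m. T r x)"
  proof (rule bounded_clinear_eqI[OF e bounded_clinear_diag[OF e c0star_ampliation[OF s0 m]]])
    show "bounded_clinear (\<lambda>x. \<Sum>r<m. T r x)" by (rule compact_ops_bounded[OF op_ideal_compact[OF J TS]])
    show "diag_op e (\<lambda>n. s (n div m)) (e k) = (\<Sum>r<m. T r (e k))" for k
      using m by (simp add: diag_op_basis[OF e] Tb)
  qed
  then have "diag_op e (\<lambda>n. s (n div m)) \<in> J" using TS by simp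
  then show ?thesis using diag_op_mem_iff[OF c0star_ampliation[OF s0 m]] by blast
qed

end

lemma op_ideal_subset_iff:
  assumes "op_ideal (J :: ('h \<Rightarrow> 'h) set)" "op_ideal J'"
  shows "J \<subseteq> J' \<longleftrightarrow> char_set J \<subseteq> char_set J'"
proof
  show "J \<subseteq> J' \<Longrightarrow> char_set J \<subseteq> char_set J'" unfolding char_set_def by (rule image_mono)
  show "char_set J \<subseteq> char_set J' \<Longrightarrow> J \<subseteq> J'"
    by (metis op_ideal_mem_iff[OF assms(1)] op_ideal_mem_iff[OF assms(2)] subset_iff)
qed

lemma op_ideal_eqI:
  assumes "op_ideal (J :: ('h \<Rightarrow> 'h) set)" "op_ideal J'" "char_set J = char_set J'"
  shows "J = J'"
  unfolding set_eq_iff op_ideal_mem_iff[OF assms(1)] op_ideal_mem_iff[OF assms(2)] assms(3) by blast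

text \<open>Ampliation by 2 is what sums require: \<open>n div 2 + n div 2 \<le> n\<close>, so the
  s-number of a sum at n is at most the sum of those of the summands at
  \<open>n div 2\<close>.\<close>

lemma calkin_ideal:
  fixes \<Sigma> :: "(nat \<Rightarrow> real) set"
  assumes c0: "\<Sigma> \<subseteq> c0star" and zero: "(\<lambda>_. 0) \<in> \<Sigma>"
    and le: "\<And>s t C. t \<in> \<Sigma> \<Longrightarrow> s \<in> c0star \<Longrightarrow> C \<ge> 0 \<Longrightarrow> (\<And>n. s n \<le> C * t n) \<Longrightarrow> s \<in> \<Sigma>"
    and add: "\<And>s t. s \<in> \<Sigma> \<Longrightarrow> t \<in> \<Sigma> \<Longrightarrow> (\<lambda>n. s n + t n) \<in> \<Sigma>"
    and ampl: "\<And>s. s \<in> \<Sigma> \<Longrightarrow> (\<lambda>n. s (n div 2)) \<in> \<Sigma>"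
  shows "op_ideal {X :: 'h \<Rightarrow> 'h. X \<in> compact_ops \<and> s_numbers X \<in> \<Sigma>}" (is "op_ideal ?J")
    and "char_set {X :: 'h \<Rightarrow> 'h. X \<in> compact_ops \<and> s_numbers X \<in> \<Sigma>} = \<Sigma>"
proof -
  show "char_set ?J = \<Sigma>"
  proof
    show "\<Sigma> \<subseteq> char_set ?J"
    proof
      fix s assume "s \<in> \<Sigma>"
      then have s0: "s \<in> c0star" using c0 by blast
      then have "diag_op e s \<in> ?J"
        using \<open>s \<in> \<Sigma>\<close> by (simp add: s_numbers_diag[OF e] diag_op_compact[OF e])
      then have "s_numbers (diag_op e s) \<in> char_set ?J" unfolding char_set_def by (rule imageI)
      then show "s \<in> char_set ?J" by (simp only: s_numbers_diag[OF e s0])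
    qed
    show "char_set ?J \<subseteq> \<Sigma>" by (simp add: char_set_def image_subset_iff)
  qed
  have z: "s_numbers (\<lambda>_ :: 'h. 0 :: 'h) = (\<lambda>_. 0)"
  proof -
    have "singular_system (\<lambda>_ :: 'h. 0 :: 'h) (\<lambda>_. 0) e"
      using onb_orthonormal[OF e]
      by (simp add: singular_system_def c0star_def decseq_def bounded_clinear_zero cinner.zero_left)
    then show ?thesis by (rule s_numbers_eq)
  qed
  show "op_ideal ?J"
  proof (rule op_idealI)
    show "(\<lambda>_. 0) \<in> ?J" using zero z compact_ops_zero by auto
  next
    fix X Y :: "'h \<Rightarrow> 'h" assume X: "X \<in> ?J" and Y: "Y \<in> ?J"
    then have Zc: "(\<lambda>x. X x + Y x) \<in> compact_ops" by (auto intro: compact_ops_add)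
    obtain u where u: "singular_system X (s_numbers X) u" using s_numbers_system[OF e, of X] X by auto
    obtain v where v: "singular_system Y (s_numbers Y) v" using s_numbers_system[OF e, of Y] Y by auto
    obtain w where w: "singular_system (\<lambda>x. X x + Y x) (s_numbers (\<lambda>x. X x + Y x)) w"
      using s_numbers_system[OF e Zc] by blast
    have "s_numbers (\<lambda>x. X x + Y x) n \<le> 1 * (s_numbers X (n div 2) + s_numbers Y (n div 2))" for n
    proof -
      have "s_numbers (\<lambda>x. X x + Y x) n \<le> s_numbers (\<lambda>x. X x + Y x) (n div 2 + n div 2)"
        by (rule c0star_antimono[OF s_numbers_c0star[OF e Zc]]) simp
      then show ?thesis using singular_system_add[OF u v w, of "n div 2" "n div 2"] by simp
    qed
    moreover have "s_numbers X \<in> \<Sigma>" "s_numbers Y \<in> \<Sigma>" using X Y by simp_all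
    then have "(\<lambda>n. s_numbers X (n div 2) + s_numbers Y (n div 2)) \<in> \<Sigma>" by (intro add ampl)
    ultimately have "s_numbers (\<lambda>x. X x + Y x) \<in> \<Sigma>"
      using le[of _ _ 1] s_numbers_c0star[OF e Zc] by simp
    then show "(\<lambda>x. X x + Y x) \<in> ?J" using Zc by simp
  next
    fix X A B :: "'h \<Rightarrow> 'h" assume X: "X \<in> ?J" and A: "bounded_clinear A" and B: "bounded_clinear B"
    then have Zc: "A \<circ> X \<circ> B \<in> compact_ops" by (auto intro: compact_ops_comp)
    obtain u where u: "singular_system X (s_numbers X) u" using s_numbers_system[OF e, of X] X by auto
    obtain w where w: "singular_system (A \<circ> X \<circ> B) (s_numbers (A \<circ> X \<circ> B)) w"
      using s_numbers_system[OF e Zc] by blast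
    obtain C where C: "\<And>n. s_numbers (A \<circ> X \<circ> B) n \<le> C * s_numbers X n"
      using singular_system_comp[OF u w A B] by blast
    have C': "s_numbers (A \<circ> X \<circ> B) n \<le> max C 0 * s_numbers X n" for n
      by (rule order_trans[OF C])
        (intro mult_right_mono c0star_nonneg[OF ss_c0[OF u]] max.cobounded1)
    have "s_numbers X \<in> \<Sigma>" using X by simp
    then have "s_numbers (A \<circ> X \<circ> B) \<in> \<Sigma>"
      by (rule le[OF _ s_numbers_c0star[OF e Zc] max.cobounded2 C'])
    then show "A \<circ> X \<circ> B \<in> ?J" using Zc by simp
  qed auto
qed

end

section \<open>Arithmetic means\<close>

lemma amean_eq: "amean \<xi> n = (\<Sum>i<Suc n. \<xi> i) / real (Suc n)"
  by (simp add: amean_def lessThan_Suc_atMost)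

lemma amean_nonneg: "(\<And>n. 0 \<le> \<xi> n) \<Longrightarrow> 0 \<le> amean \<xi> n"
  by (simp add: amean_def sum_nonneg)

lemma amean_add: "amean (\<lambda>n. \<xi> n + \<eta> n) n = amean \<xi> n + amean \<eta> n"
  by (simp add: amean_def sum.distrib add_divide_distrib)

lemma amean_mono_scaled:
  assumes "\<And>n. \<xi> n \<le> C * \<eta> n" shows "amean \<xi> n \<le> C * amean \<eta> n"
proof -
  have "(\<Sum>i\<le>n. \<xi> i) \<le> C * (\<Sum>i\<le>n. \<eta> i)"
    unfolding sum_distrib_left by (intro sum_mono assms)
  then show ?thesis unfolding amean_def by (simp add: divide_right_mono)
qed

lemma amean_c0star:
  assumes \<xi>: "\<xi> \<in> c0star" shows "amean \<xi> \<in> c0star"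
proof (rule c0starI)
  note nn = c0star_nonneg[OF \<xi>]
  show "0 \<le> amean \<xi> n" for n by (rule amean_nonneg[OF nn])
  show "amean \<xi> (Suc n) \<le> amean \<xi> n" for n
  proof -
    define S where "S = (\<Sum>i<Suc n. \<xi> i)"
    have "(\<Sum>i<Suc n. \<xi> (Suc n)) \<le> S"
      unfolding S_def by (intro sum_mono c0star_antimono[OF \<xi>]) simp
    then have "real (Suc n) * \<xi> (Suc n) \<le> S" by simp
    then have "(S + \<xi> (Suc n)) * real (Suc n) \<le> S * real (Suc (Suc n))" by (simp add: algebra_simps)
    then have "(S + \<xi> (Suc n)) / real (Suc (Suc n)) \<le> S / real (Suc n)"
      by (simp add: divide_le_eq pos_le_divide_eq del: of_nat_Suc)
    then show ?thesis unfolding amean_eq S_def by simp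
  qed
  show "amean \<xi> \<longlonglongrightarrow> 0"
  proof (rule LIMSEQ_I)
    fix \<epsilon> :: real assume \<epsilon>: "\<epsilon> > 0"
    have "\<forall>\<^sub>F n in sequentially. \<xi> n < \<epsilon> / 2"
      using order_tendstoD(2)[OF c0star_tendsto[OF \<xi>], of "\<epsilon> / 2"] \<epsilon> by simp
    then obtain N where N: "\<And>n. n \<ge> N \<Longrightarrow> \<xi> n < \<epsilon> / 2" by (auto simp: eventually_sequentially)
    \<comment> \<open>From M on, the fixed head below N contributes less than
      \<open>\<epsilon> / 2\<close> to the mean.\<close>
    obtain M :: nat where M: "2 * (\<Sum>i<N. \<xi> i) / \<epsilon> < real M" using reals_Archimedean2 by blast
    have "amean \<xi> n < \<epsilon>" if n: "n \<ge> max N M" for n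
    proof -
      have "(\<Sum>i<Suc n. \<xi> i) = (\<Sum>i<N. \<xi> i) + (\<Sum>i=N..<Suc n. \<xi> i)"
        using sum.atLeastLessThan_concat[of 0 N "Suc n" \<xi>] n
        by (simp only: atLeast0LessThan)
      also have "(\<Sum>i=N..<Suc n. \<xi> i) \<le> (\<Sum>i=N..<Suc n. \<epsilon> / 2)"
        by (rule sum_mono) (metis N atLeastLessThan_iff less_imp_le)
      also have "\<dots> = real (Suc n - N) * (\<epsilon> / 2)" by simp
      also have "\<dots> \<le> real (Suc n) * (\<epsilon> / 2)" using \<epsilon> by (intro mult_right_mono of_nat_mono) auto
      also have "(\<Sum>i<N. \<xi> i) < real (Suc n) * (\<epsilon> / 2)"
      proof -
        have "2 * (\<Sum>i<N. \<xi> i) / \<epsilon> < real (Suc n)" using M n by linarith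
        then show ?thesis using \<epsilon> by (simp add: field_simps)
      qed
      finally have "(\<Sum>i<Suc n. \<xi> i) < \<epsilon> * real (Suc n)" by (simp add: algebra_simps)
      then show ?thesis unfolding amean_eq by (simp add: divide_less_eq del: sum.lessThan_Suc of_nat_Suc)
    qed
    then show "\<exists>no. \<forall>n\<ge>no. norm (amean \<xi> n - 0) < \<epsilon>"
      using amean_nonneg[OF nn] by (intro exI[of _ "max N M"]) auto
  qed
qed

text \<open>The numerator does not grow and the denominator loses at most a factor 2. This makes the
  set of sequences dominated by a mean closed under ampliation.\<close>

lemma amean_half_le:
  assumes \<xi>: "\<xi> \<in> c0star" shows "amean \<xi> (n div 2) \<le> 2 * amean \<xi> n"
proof -
  let ?S = "\<lambda>n. (\<Sum>i<Suc n. \<xi> i)"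
  have 1: "?S (n div 2) \<le> ?S n" by (rule sum_mono2) (auto simp: c0star_nonneg[OF \<xi>])
  have 0: "0 \<le> ?S n" by (intro sum_nonneg c0star_nonneg[OF \<xi>])
  have "Suc n \<le> 2 * Suc (n div 2)" by presburger
  then have "real (Suc n) \<le> real (2 * Suc (n div 2))" by (rule of_nat_mono)
  then have 2: "real (Suc n) \<le> 2 * real (Suc (n div 2))" by (simp only: of_nat_mult of_nat_numeral)
  have "?S (n div 2) * real (Suc n) \<le> ?S n * (2 * real (Suc (n div 2)))"
    by (intro mult_mono 1 2 0) simp
  then show ?thesis unfolding amean_eq
    by (simp add: divide_le_eq pos_le_divide_eq mult_ac del: sum.lessThan_Suc of_nat_Suc)
qed

text \<open>Each \<open>\<xi> i\<close> is repeated at most m times. Up to a constant, a sequence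
  thus controls the means of its ampliations.\<close>

lemma amean_ampliation_le:
  assumes \<xi>: "\<xi> \<in> c0star" and m: "m \<ge> 1"
  shows "amean (\<lambda>n. \<xi> (n div m)) n \<le> real m * amean \<xi> n"
proof -
  have "(\<Sum>j\<le>n. \<xi> (j div m)) = (\<Sum>i\<le>n. \<Sum>j\<in>{j \<in> {..n}. j div m = i}. \<xi> (j div m))"
    by (rule sum.group[symmetric]) (auto intro: div_le_dividend order_trans)
  also have "\<dots> \<le> (\<Sum>i\<le>n. real m * \<xi> i)"
  proof (rule sum_mono)
    fix i
    have "{j \<in> {..n}. j div m = i} \<subseteq> {i * m..<i * m + m}"
      using m dividend_less_times_div[of m] by (auto simp: add.commute mult.commute)
    then have "card {j \<in> {..n}. j div m = i} \<le> card {i * m..<i * m + m}" by (intro card_mono) auto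
    then have c: "card {j \<in> {..n}. j div m = i} \<le> m" by simp
    have "(\<Sum>j\<in>{j \<in> {..n}. j div m = i}. \<xi> (j div m)) = real (card {j \<in> {..n}. j div m = i}) * \<xi> i"
      by simp
    also have "\<dots> \<le> real m * \<xi> i" using c by (intro mult_right_mono c0star_nonneg[OF \<xi>]) simp
    finally show "(\<Sum>j\<in>{j \<in> {..n}. j div m = i}. \<xi> (j div m)) \<le> real m * \<xi> i" .
  qed
  finally have "(\<Sum>j\<le>n. \<xi> (j div m)) \<le> real m * (\<Sum>j\<le>n. \<xi> j)" by (simp add: sum_distrib_left)
  then show ?thesis unfolding amean_def by (simp add: divide_right_mono)
qed

text \<open>The sequence on the right belongs to a rank one projection and has mean
  \<open>1 / (n + 1)\<close>, so the finite rank ideal already dominates the mean of a summable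
  sequence.\<close>

lemma amean_le_of_summable:
  assumes \<xi>: "\<xi> \<in> c0star" and s: "summable \<xi>"
  shows "amean \<xi> n \<le> suminf \<xi> * amean (\<lambda>n. if n = 0 then 1 else 0) n"
proof -
  have "(\<Sum>i\<le>n. \<xi> i) \<le> suminf \<xi>" by (rule sum_le_suminf[OF s]) (auto simp: c0star_nonneg[OF \<xi>])
  moreover have "(\<Sum>i\<le>n. if i = 0 then 1 else 0 :: real) = 1" by simp
  ultimately show ?thesis unfolding amean_def by (simp add: divide_right_mono)
qed

section \<open>The index sequence and the hat of a nonsummable sequence\<close>

context
  fixes \<xi> :: "nat \<Rightarrow> real"
  assumes \<xi>: "\<xi> \<in> c0star" and ns: "\<not> summable \<xi>"
begin

text \<open>Guarantees that the minimum defining \<open>\<nu>\<close> is taken over a nonempty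
  set.\<close>

lemma partial_sums_unbounded: "\<exists>k\<ge>1. B \<le> (\<Sum>i<k. \<xi> i)"
proof (rule ccontr)
  assume *: "\<not> ?thesis"
  have "summable \<xi>"
  proof (rule bounded_imp_summable)
    show "(\<Sum>i\<le>n. \<xi> i) \<le> B" for n
    proof -
      have "1 \<le> Suc n" by simp
      then have "\<not> B \<le> (\<Sum>i<Suc n. \<xi> i)" using * by blast
      then show ?thesis by (simp only: lessThan_Suc_atMost not_le less_imp_le)
    qed
  qed (rule c0star_nonneg[OF \<xi>])
  then show False using ns by simp
qed

lemma nonsummable_first_pos: "\<xi> 0 > 0"
proof (rule ccontr)
  assume "\<not> ?thesis"
  then have "\<xi> n = 0" for n using c0star_nonneg[OF \<xi>, of n] c0star_antimono[OF \<xi>, of 0 n] by simp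
  then have "\<xi> = (\<lambda>_. 0)" by (rule ext)
  then show False using ns summable_zero by simp
qed

lemma \<nu>_spec: "1 \<le> \<nu> \<xi> n" "real n * \<xi> 0 \<le> (\<Sum>i<\<nu> \<xi> n. \<xi> i)"
  using LeastI_ex[OF partial_sums_unbounded[of "real n * \<xi> 0", unfolded Bex_def]] unfolding \<nu>_def by auto

lemma \<nu>_le: "1 \<le> k \<Longrightarrow> real n * \<xi> 0 \<le> (\<Sum>i<k. \<xi> i) \<Longrightarrow> \<nu> \<xi> n \<le> k"
  unfolding \<nu>_def by (rule Least_le) simp

text \<open>By minimality the sum without its last term stays within \<open>n * \<xi> 0\<close>, and
  one term adds at most \<open>\<xi> 0\<close>. The case \<open>\<nu> \<xi> n = 1\<close> is
  separate because minimality only concerns k from 1 on.\<close>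

lemma \<nu>_upper:
  assumes "n \<ge> 1" shows "(\<Sum>i<\<nu> \<xi> n. \<xi> i) \<le> (real n + 1) * \<xi> 0"
proof (cases "\<nu> \<xi> n = 1")
  case True
  then show ?thesis using nonsummable_first_pos by (simp add: algebra_simps)
next
  case False
  then obtain k where k: "\<nu> \<xi> n = Suc k" "k \<ge> 1" using \<nu>_spec(1)[of n] by (cases "\<nu> \<xi> n") auto
  then have "(\<Sum>i<k. \<xi> i) \<le> real n * \<xi> 0" using \<nu>_le[OF k(2), of n] by fastforce
  then show ?thesis using c0star_antimono[OF \<xi>, of 0 k] by (simp add: k algebra_simps)
qed

lemma \<nu>_mono: "m \<le> n \<Longrightarrow> \<nu> \<xi> m \<le> \<nu> \<xi> n"
proof -
  assume "m \<le> n"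
  then have "real m * \<xi> 0 \<le> real n * \<xi> 0" using nonsummable_first_pos by simp
  then show ?thesis using \<nu>_spec[of n] by (intro \<nu>_le) auto
qed

text \<open>No term exceeds \<open>\<xi> 0\<close>, so at least n terms are needed. Consequently
  \<open>\<nu>\<close> tends to infinity and the hat to 0.\<close>

lemma \<nu>_ge: "n \<le> \<nu> \<xi> n"
proof -
  have "(\<Sum>i<\<nu> \<xi> n. \<xi> i) \<le> (\<Sum>i<\<nu> \<xi> n. \<xi> 0)" by (intro sum_mono c0star_antimono[OF \<xi>]) simp
  then have "real n * \<xi> 0 \<le> real (\<nu> \<xi> n) * \<xi> 0" using \<nu>_spec(2)[of n] by simp
  then show ?thesis using nonsummable_first_pos by simp
qed

lemma hat_seq_eq: "hat_seq \<xi> n = (\<Sum>i<\<nu> \<xi> (n + 1). \<xi> i) / real (\<nu> \<xi> (n + 1))"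
  unfolding hat_seq_def amean_eq using \<nu>_spec(1)[of "n + 1"] by (simp del: sum.lessThan_Suc)

lemma hat_seq_pos: "hat_seq \<xi> n > 0"
proof -
  have "0 < real (n + 1) * \<xi> 0" using nonsummable_first_pos by simp
  then show ?thesis unfolding hat_seq_eq using \<nu>_spec[of "n + 1"] by (intro divide_pos_pos) auto
qed

lemma hat_seq_c0star: "hat_seq \<xi> \<in> c0star"
proof (rule c0starI)
  show "0 \<le> hat_seq \<xi> n" for n using hat_seq_pos[of n] by simp
  show "hat_seq \<xi> (Suc n) \<le> hat_seq \<xi> n" for n
    unfolding hat_seq_def by (intro c0star_antimono[OF amean_c0star[OF \<xi>]] diff_le_mono \<nu>_mono) simp
  have "filterlim (\<lambda>n. \<nu> \<xi> (n + 1) - 1) at_top sequentially"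
    unfolding filterlim_at_top
  proof
    fix Z :: nat
    have "Z \<le> \<nu> \<xi> (n + 1) - 1" if "n \<ge> Z" for n using \<nu>_ge[of "n + 1"] that by simp
    then show "\<forall>\<^sub>F n in sequentially. Z \<le> \<nu> \<xi> (n + 1) - 1"
      unfolding eventually_sequentially by blast
  qed
  then show "hat_seq \<xi> \<longlonglongrightarrow> 0"
    unfolding hat_seq_def by (rule filterlim_compose[OF c0star_tendsto[OF amean_c0star[OF \<xi>]]])
qed

lemma hat_seq_le_first: "hat_seq \<xi> n \<le> \<xi> 0"
proof -
  have "hat_seq \<xi> n \<le> amean \<xi> 0" unfolding hat_seq_def by (rule c0star_antimono[OF amean_c0star[OF \<xi>]]) simp
  then show ?thesis by (simp add: amean_def)
qed

lemma hat_seq_big_O_of_amean: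
  assumes \<eta>: "\<eta> \<in> c0star" and le: "\<And>n. amean \<xi> n \<le> C * amean \<eta> n" and C: "C \<ge> 0"
  shows "\<exists>m\<ge>1. \<exists>C. \<forall>n. hat_seq \<xi> n \<le> C * \<eta> (n div m)"
proof -
  \<comment> \<open>The ampliation factor: the first \<open>n div m\<close> terms of
    \<open>\<eta>\<close>, estimated by \<open>\<eta> 0\<close> and multiplied by C, account for at
    most half of \<open>n * \<xi> 0\<close>.\<close>
  obtain m :: nat where "2 * C * \<eta> 0 / \<xi> 0 < real m" using reals_Archimedean2 by blast
  moreover have "0 \<le> 2 * C * \<eta> 0 / \<xi> 0"
    using nonsummable_first_pos C c0star_nonneg[OF \<eta>, of 0] by simp
  ultimately have "0 < real m" and lt: "2 * C * \<eta> 0 / \<xi> 0 < real m" by linarith+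
  then have m: "2 * C * \<eta> 0 \<le> real m * \<xi> 0" "m \<noteq> 0"
    using nonsummable_first_pos by (simp_all add: divide_less_eq)
  have "hat_seq \<xi> n \<le> 4 * C * \<eta> (n div m)" for n
  proof -
    define N where "N = \<nu> \<xi> (n + 1)"
    define k where "k = n div m"
    have N: "N \<ge> 1" "real (n + 1) * \<xi> 0 \<le> (\<Sum>i<N. \<xi> i)" "(\<Sum>i<N. \<xi> i) \<le> (real (n + 1) + 1) * \<xi> 0"
      using \<nu>_spec[of "n + 1"] \<nu>_upper[of "n + 1"] by (simp_all add: N_def)
    obtain N' where N': "N = Suc N'" using N(1) by (cases N) auto
    have "(\<Sum>i<N. \<xi> i) / real N \<le> C * ((\<Sum>i<N. \<eta> i) / real N)"
      using le[of N'] unfolding amean_eq N' .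
    then have "(\<Sum>i<N. \<xi> i) \<le> C * (\<Sum>i<N. \<eta> i)" using N(1) by (simp add: field_simps)
    moreover have "(\<Sum>i<N. \<eta> i) \<le> real k * \<eta> 0 + real N * \<eta> k"
    proof -
      \<comment> \<open>Terms before k are estimated by \<open>\<eta> 0\<close>, the later ones by
        \<open>\<eta> k\<close>.\<close>
      have "(\<Sum>i<N. \<eta> i) \<le> (\<Sum>i<N. (if i < k then \<eta> 0 else 0) + \<eta> k)"
        by (intro sum_mono) (use c0star_antimono[OF \<eta>] c0star_nonneg[OF \<eta>] in \<open>auto intro: add_increasing2\<close>)
      also have "\<dots> = (\<Sum>i<N. if i < k then \<eta> 0 else 0) + real N * \<eta> k" by (simp add: sum.distrib)
      also have "(\<Sum>i<N. if i < k then \<eta> 0 else 0) = (\<Sum>i\<in>{..<N} \<inter> {..<k}. \<eta> 0)"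
        by (simp add: sum.If_cases lessThan_def)
      also have "\<dots> \<le> (\<Sum>i<k. \<eta> 0)" by (intro sum_mono2) (auto simp: c0star_nonneg[OF \<eta>])
      finally show ?thesis by simp
    qed
    ultimately have "(\<Sum>i<N. \<xi> i) \<le> C * (real k * \<eta> 0 + real N * \<eta> k)"
      using mult_left_mono[OF _ C] by (meson order_trans)
    moreover have "C * (real k * \<eta> 0) \<le> real n * \<xi> 0 / 2"
    proof -
      have "real k * (2 * C * \<eta> 0) \<le> real k * (real m * \<xi> 0)" by (intro mult_left_mono m) simp
      also have "\<dots> = real (k * m) * \<xi> 0" by simp
      also have "\<dots> \<le> real n * \<xi> 0"
        unfolding k_def using nonsummable_first_pos by (intro mult_right_mono of_nat_mono div_times_less_eq_dividend) simp
      finally show ?thesis by (simp add: algebra_simps)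
    qed
    \<comment> \<open>Of at least \<open>(n + 1) * \<xi> 0\<close> the head takes at most
      \<open>n * \<xi> 0 / 2\<close>. What remains is half of the upper bound for the partial sum of
      \<open>\<xi>\<close> in N(3).\<close>
    ultimately have "(real n + 2) * \<xi> 0 / 2 \<le> C * (real N * \<eta> k)"
      using N(2) by (simp add: algebra_simps)
    then have "(\<Sum>i<N. \<xi> i) \<le> 4 * C * \<eta> k * real N"
      using N(3) mult_nonneg_nonneg[OF C mult_nonneg_nonneg[OF of_nat_0_le_iff[of N] c0star_nonneg[OF \<eta>, of k]]]
      by (simp add: algebra_simps)
    then show ?thesis unfolding hat_seq_eq N_def[symmetric] k_def[symmetric] using N(1)
      by (simp add: divide_le_eq)
  qed
  then show ?thesis using m(2) by (intro exI[of _ m]) auto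
qed

text \<open>While \<open>n div m\<close> is below q, the hat stays above its positive value at q and
  \<open>\<zeta>\<close> below \<open>\<zeta> 0\<close>. A larger constant absorbs these indices, so
  failures occur beyond every q.\<close>

lemma not_big_O_hat_seq_large:
  assumes \<zeta>: "\<zeta> \<in> c0star" and not: "\<And>m C. m \<ge> 1 \<Longrightarrow> \<exists>n. C * hat_seq \<xi> (n div m) < \<zeta> n" and m: "m \<ge> 1"
  shows "\<exists>n. q \<le> n div m \<and> C * hat_seq \<xi> (n div m) < \<zeta> n"
proof (rule ccontr)
  assume no: "\<not> ?thesis"
  define C' where "C' = max C (\<zeta> 0 / hat_seq \<xi> q)"
  have "\<zeta> n \<le> C' * hat_seq \<xi> (n div m)" for n
  proof (cases "q \<le> n div m")
    case True
    then have "\<zeta> n \<le> C * hat_seq \<xi> (n div m)" using no by (auto simp: not_less)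
    also have "\<dots> \<le> C' * hat_seq \<xi> (n div m)"
      by (intro mult_right_mono) (use hat_seq_pos[of "n div m"] in \<open>auto simp: C'_def\<close>)
    finally show ?thesis .
  next
    case False
    then have le: "hat_seq \<xi> q \<le> hat_seq \<xi> (n div m)" by (intro c0star_antimono[OF hat_seq_c0star]) simp
    have "\<zeta> n \<le> \<zeta> 0" by (rule c0star_antimono[OF \<zeta>]) simp
    also have "\<dots> = \<zeta> 0 / hat_seq \<xi> q * hat_seq \<xi> q" using hat_seq_pos[of q] by simp
    also have "\<dots> \<le> C' * hat_seq \<xi> (n div m)"
      using le hat_seq_pos[of q] c0star_nonneg[OF \<zeta>, of 0] by (intro mult_mono) (auto simp: C'_def le_max_iff_disj)
    finally show ?thesis .
  qed
  then show False using not[OF m, of C'] by (meson not_less)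
qed

text \<open>A step function \<open>\<eta>\<close> drops at \<open>n div j\<close> to the value of \<open>hat_seq \<xi>\<close> at \<open>n div j\<^sup>2\<close>, where \<open>n\<close>
  is a place at which \<open>\<zeta>\<close> is large and \<open>j\<close> exceeds the reciprocal of the preceding value.  Then the
  partial sum of \<open>\<eta>\<close> before the drop already dominates those of \<open>\<xi>\<close> up to the place \<open>\<nu>\<close> from which
  on the new value takes over.\<close>

lemma exists_amean_dominating:
  assumes \<zeta>: "\<zeta> \<in> c0star" and not: "\<And>m C. m \<ge> 1 \<Longrightarrow> \<exists>n. C * hat_seq \<xi> (n div m) < \<zeta> n"
  shows "\<exists>\<eta>\<in>c0star. (\<exists>C. \<forall>n. amean \<xi> n \<le> C * amean \<eta> n) \<and>
    (\<forall>m\<ge>1. \<forall>C. \<exists>n. C * \<eta> (n div m) < \<zeta> n)"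
proof -
  \<comment> \<open>One j serves as constant, as bound for the ampliations to be beaten and as
    reciprocal of the preceding height a. The square gives
    \<open>n div j\<^sup>2 = (n div j) div j\<close>, which leaves a factor j between the place of
    the drop and the argument of the hat.\<close>
  have ex: "\<exists>j n. j \<ge> 1 \<and> j \<ge> k \<and> 1 \<le> real j * a \<and> q \<le> n div j\<^sup>2 \<and> real j * hat_seq \<xi> (n div j\<^sup>2) < \<zeta> n"
    if a: "a > 0" for a :: real and k q :: nat
  proof -
    obtain i :: nat where i: "1 / a < real i" using reals_Archimedean2 by blast
    define j where "j = max (max i k) 1"
    have "1 / a < real j" using i by (simp add: j_def)
    then have "1 \<le> real j * a" using a by (simp add: field_simps)
    moreover have "j\<^sup>2 \<ge> 1" by (simp add: j_def)
    moreover have "1 \<le> j" "k \<le> j" by (simp_all add: j_def)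
    ultimately show ?thesis using not_big_O_hat_seq_large[OF \<zeta> not, of "j\<^sup>2" q "real j"] by blast
  qed
  define p where "p x = snd x div (fst x)\<^sup>2" for x :: "nat \<times> nat"
  define t where "t x = snd x div fst x" for x :: "nat \<times> nat"
  define P where "P k x \<longleftrightarrow> fst x \<ge> 1 \<and> fst x \<ge> k \<and> 1 \<le> p x \<and>
      real (fst x) * hat_seq \<xi> (p x) < \<zeta> (snd x) \<and> (k = 0 \<longrightarrow> 1 \<le> real (fst x) * \<xi> 0)"
    for k and x :: "nat \<times> nat"
  \<comment> \<open>The last clause makes a height of at least \<open>hat_seq \<xi> (p x)\<close>,
    kept up to \<open>t y\<close>, sum to at least \<open>p y\<close>, because \<open>t y\<close> is
    at least \<open>fst y * p y\<close>.\<close>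
  define Q where "Q x y \<longleftrightarrow> p x < p y \<and> t x < t y \<and> 1 \<le> real (fst y) * hat_seq \<xi> (p x)" for x y
  have "\<exists>f. \<forall>k. P k (f k) \<and> Q (f k) (f (Suc k))"
  proof (rule dependent_nat_choice)
    show "\<exists>x. P 0 x" using ex[OF nonsummable_first_pos, of 0 1] unfolding P_def p_def by auto
    fix x k assume "P k x"
    \<comment> \<open>The bound \<open>p x + t x + 1\<close> pushes both p and t beyond their old
      values, since \<open>n div j\<^sup>2 \<le> n div j\<close>.\<close>
    obtain j n where jn: "j \<ge> 1" "j \<ge> Suc k" "1 \<le> real j * hat_seq \<xi> (p x)" "p x + t x + 1 \<le> n div j\<^sup>2"
      "real j * hat_seq \<xi> (n div j\<^sup>2) < \<zeta> n"
      using ex[OF hat_seq_pos, of "Suc k" "p x" "p x + t x + 1"] by blast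
    have "n div j\<^sup>2 \<le> n div j" using jn(1) by (intro div_le_mono2) (auto simp: power2_eq_square)
    then show "\<exists>y. P (Suc k) y \<and> Q x y"
      using jn by (intro exI[of _ "(j, n)"]) (auto simp: P_def Q_def p_def[of "(j, n)"] t_def[of "(j, n)"])
  qed
  then obtain f where f: "\<And>k. P k (f k)" "\<And>k. Q (f k) (f (Suc k))" by blast
  define j where "j k = fst (f k)" for k
  define n where "n k = snd (f k)" for k
  define p' where "p' k = n k div (j k)\<^sup>2" for k
  define t' where "t' k = n k div j k" for k
  have pf: "p (f k) = p' k" and tf: "t (f k) = t' k" for k
    by (simp_all add: p_def t_def p'_def t'_def j_def n_def)
  have j: "j k \<ge> 1" "j k \<ge> k" "1 \<le> p' k" "real (j k) * hat_seq \<xi> (p' k) < \<zeta> (n k)" "1 \<le> real (j 0) * \<xi> 0" for k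
    using f(1)[of k] f(1)[of 0] by (auto simp: P_def pf j_def n_def)
  have "p' k < p' (Suc k)" "t' k < t' (Suc k)" and jh: "1 \<le> real (j (Suc k)) * hat_seq \<xi> (p' k)" for k
    using f(2)[of k] by (simp_all add: Q_def pf tf j_def)
  then have pm: "strict_mono p'" and tm: "strict_mono t'" by (simp_all add: strict_mono_Suc_iff)
  define A where "A k = (case k of 0 \<Rightarrow> \<xi> 0 | Suc i \<Rightarrow> hat_seq \<xi> (p' i))" for k
  have A0: "A 0 = \<xi> 0" and AS: "A (Suc k) = hat_seq \<xi> (p' k)" for k by (simp_all add: A_def)
  have jA: "1 \<le> real (j k) * A k" for k using j(5) jh by (cases k) (simp_all add: A0 AS)
  have Ac: "A \<in> c0star"
  proof (rule c0starI)
    show "0 \<le> A k" for k using nonsummable_first_pos hat_seq_pos by (cases k) (auto simp: A0 AS intro: less_imp_le)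
    show "A (Suc k) \<le> A k" for k
      using pm by (cases k) (auto simp: A0 AS hat_seq_le_first strict_mono_less_eq intro!: c0star_antimono[OF hat_seq_c0star])
    have "(\<lambda>k. hat_seq \<xi> (p' k)) \<longlonglongrightarrow> 0"
      by (rule filterlim_compose[OF c0star_tendsto[OF hat_seq_c0star] filterlim_subseq[OF pm]])
    then have "(\<lambda>k. A (Suc k)) \<longlonglongrightarrow> 0" by (simp add: AS)
    then show "A \<longlonglongrightarrow> 0" by (simp add: filterlim_sequentially_Suc)
  qed
  \<comment> \<open>\<open>c i\<close> counts the drops at or before i, and A lists the heights
    between drops, starting with \<open>\<xi> 0\<close>.\<close>
  define c where "c i = card {k. t' k \<le> i}" for i
  have ct: "c i \<le> k \<longleftrightarrow> i < t' k" for i k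
  proof
    assume "i < t' k"
    then have "{k. t' k \<le> i} \<subseteq> {..<k}"
      using strict_mono_less[OF tm] by (metis (no_types, lifting) lessThan_iff mem_Collect_eq order_le_less_trans subsetI)
    then have "c i \<le> card {..<k}" unfolding c_def by (intro card_mono) auto
    then show "c i \<le> k" by simp
  next
    assume ck: "c i \<le> k"
    show "i < t' k"
    proof (rule ccontr)
      assume "\<not> i < t' k"
      then have "t' l \<le> i" if "l \<le> k" for l using strict_mono_less_eq[OF tm, of l k] that by simp
      then have sub: "{..k} \<subseteq> {k. t' k \<le> i}" by auto
      have "l \<le> i" if "t' l \<le> i" for l using strict_mono_imp_increasing[OF tm, of l] that by simp
      then have "{k. t' k \<le> i} \<subseteq> {..i}" by blast
      then have "finite {k. t' k \<le> i}" by (rule finite_subset) simp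
      then have "card {..k} \<le> c i" unfolding c_def using sub by (rule card_mono)
      then show False using ck by simp
    qed
  qed
  have cm: "c i \<le> c i'" if "i \<le> i'" for i i'
  proof -
    have "i' < t' (c i')" unfolding ct[symmetric] by (rule order_refl)
    then have "i < t' (c i')" using that by (rule le_less_trans[rotated])
    then show ?thesis unfolding ct .
  qed
  define \<eta> where "\<eta> i = A (c i)" for i
  have \<eta>c: "\<eta> \<in> c0star"
  proof (rule c0starI)
    show "0 \<le> \<eta> i" for i by (simp add: \<eta>_def c0star_nonneg[OF Ac])
    show "\<eta> (Suc i) \<le> \<eta> i" for i unfolding \<eta>_def by (intro c0star_antimono[OF Ac] cm) simp
    have "filterlim c at_top sequentially"
      unfolding filterlim_at_top
    proof
      fix Z :: nat
      have "Z \<le> c i" if "i \<ge> t' Z" for i using ct[of i Z] that by simp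
      then show "\<forall>\<^sub>F i in sequentially. Z \<le> c i" unfolding eventually_sequentially by blast
    qed
    then show "\<eta> \<longlonglongrightarrow> 0" unfolding \<eta>_def by (rule filterlim_compose[OF c0star_tendsto[OF Ac]])
  qed
  \<comment> \<open>The 1 serves the indices where the current height alone dominates the mean of
    \<open>\<xi>\<close>. The other constant comes from \<open>\<nu>_upper\<close>: the sum up to
    \<open>\<nu> \<xi> (p + 1)\<close> is at most \<open>(p + 2) * \<xi> 0\<close>, and p is at
    least 1.\<close>
  define K where "K = max 1 (3 * \<xi> 0)"
  have S: "(\<Sum>i<N. \<xi> i) \<le> K * (\<Sum>i<N. \<eta> i)" if N: "N = Suc N'" for N N'
  proof -
    have nn: "0 \<le> (\<Sum>i<N. \<eta> i)" by (intro sum_nonneg c0star_nonneg[OF \<eta>c])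
    have "(\<Sum>i<N. A (c N')) \<le> (\<Sum>i<N. \<eta> i)"
      unfolding \<eta>_def by (intro sum_mono c0star_antimono[OF Ac] cm) (use N in simp)
    then have low: "real N * A (c N') \<le> (\<Sum>i<N. \<eta> i)" by simp
    have big: "(\<Sum>i<N. \<xi> i) \<le> K * (\<Sum>i<N. \<eta> i)" if "(\<Sum>i<N. \<xi> i) \<le> (\<Sum>i<N. \<eta> i)"
    proof -
      have "1 * (\<Sum>i<N. \<eta> i) \<le> K * (\<Sum>i<N. \<eta> i)" by (rule mult_right_mono[OF _ nn]) (simp add: K_def)
      then show ?thesis using that by simp
    qed
    show ?thesis
    proof (cases "c N'")
      case 0
      have "(\<Sum>i<N. \<xi> i) \<le> (\<Sum>i<N. \<xi> 0)" by (intro sum_mono c0star_antimono[OF \<xi>]) simp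
      then show ?thesis using low 0 by (intro big) (simp add: A0)
    next
      case (Suc k)
      then have tN: "t' k \<le> N'" using ct[of N' k] by simp
      \<comment> \<open>The current height is the mean of \<open>\<xi>\<close> over its first M
        terms. From M on the means of \<open>\<xi>\<close> do not exceed it; before M, the terms of
        \<open>\<eta>\<close> ahead of the drop at \<open>t' k\<close> already sum to at least
        \<open>p' k\<close>.\<close>
      define M where "M = \<nu> \<xi> (p' k + 1)"
      show ?thesis
      proof (cases "M \<le> N")
        case True
        have "amean \<xi> N' \<le> hat_seq \<xi> (p' k)"
          unfolding hat_seq_def using True N by (intro c0star_antimono[OF amean_c0star[OF \<xi>]]) (simp add: M_def)
        then have "real N * amean \<xi> N' \<le> real N * A (c N')" unfolding Suc AS by (rule mult_left_mono) simp
        moreover have "real N * amean \<xi> N' = (\<Sum>i<N. \<xi> i)" unfolding amean_eq N by (simp del: sum.lessThan_Suc)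
        ultimately show ?thesis using low by (intro big) simp
      next
        case False
        have "(\<Sum>i<N. \<xi> i) \<le> (\<Sum>i<M. \<xi> i)" using False by (intro sum_mono2) (auto simp: c0star_nonneg[OF \<xi>])
        also have "\<dots> \<le> (real (p' k + 1) + 1) * \<xi> 0" unfolding M_def by (rule \<nu>_upper) simp
        also have "\<dots> \<le> 3 * real (p' k) * \<xi> 0" using j(3)[of k] nonsummable_first_pos by (intro mult_right_mono) auto
        also have "\<dots> = 3 * \<xi> 0 * real (p' k)" by simp
        also have "\<dots> \<le> K * (\<Sum>i<N. \<eta> i)"
        proof (rule mult_mono)
          have "p' k = t' k div j k" by (simp add: p'_def t'_def power2_eq_square div_mult2_eq)
          then have "p' k * j k \<le> t' k" by simp
          then have pt: "real (p' k) * real (j k) \<le> real (t' k)" by (simp flip: of_nat_mult)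
          have "real (p' k) * 1 \<le> real (p' k) * (real (j k) * A k)" by (intro mult_left_mono jA) simp
          also have "\<dots> \<le> real (t' k) * A k"
            using mult_right_mono[OF pt c0star_nonneg[OF Ac, of k]] by (simp add: mult.assoc)
          also have "\<dots> = (\<Sum>i<t' k. A k)" by simp
          also have "\<dots> \<le> (\<Sum>i<t' k. \<eta> i)" unfolding \<eta>_def
            by (intro sum_mono c0star_antimono[OF Ac]) (simp add: ct)
          also have "\<dots> \<le> (\<Sum>i<N. \<eta> i)" using tN N by (intro sum_mono2) (auto simp: c0star_nonneg[OF \<eta>c])
          finally show "real (p' k) \<le> (\<Sum>i<N. \<eta> i)" by simp
        qed (auto simp: K_def)
        finally show ?thesis .
      qed
    qed
  qed
  have "amean \<xi> n \<le> K * amean \<eta> n" for n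
    using divide_right_mono[OF S[OF refl, of n], of "real (Suc n)"] unfolding amean_eq by simp
  moreover have "\<exists>i. C * \<eta> (i div m) < \<zeta> i" if m: "m \<ge> 1" for m C
  proof -
    obtain k0 :: nat where "C < real k0" using reals_Archimedean2 by blast
    \<comment> \<open>As j is at least m, the index \<open>n k div m\<close> is not before the drop
      at \<open>t' k\<close>; as j is at least C, the inequality at \<open>n k\<close> absorbs the
      constant.\<close>
    define k where "k = max k0 m"
    have k: "C \<le> real (j k)" "m \<le> j k" using \<open>C < real k0\<close> j(2)[of k] by (auto simp: k_def)
    have "t' k \<le> n k div m" unfolding t'_def using k(2) m by (intro div_le_mono2) auto
    then have "Suc k \<le> c (n k div m)" using ct[of "n k div m" k] by simp
    then have "\<eta> (n k div m) \<le> A (Suc k)" unfolding \<eta>_def by (rule c0star_antimono[OF Ac])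
    then have "real (j k) * \<eta> (n k div m) \<le> real (j k) * hat_seq \<xi> (p' k)" unfolding AS by (rule mult_left_mono) simp
    moreover have "C * \<eta> (n k div m) \<le> real (j k) * \<eta> (n k div m)"
      by (rule mult_right_mono[OF k(1) c0star_nonneg[OF \<eta>c]])
    ultimately have "C * \<eta> (n k div m) < \<zeta> (n k)" using j(4)[of k] by linarith
    then show ?thesis by blast
  qed
  ultimately show ?thesis using \<eta>c by blast
qed

end

section \<open>Principal ideals and their hats\<close>

text \<open>The constant in \<open>big_O\<close> may be negative; chaining and adding estimates
  needs its sign.\<close>

lemma big_O_nonneg:
  assumes "big_O \<zeta> \<eta>" "\<And>n. 0 \<le> \<eta> n"
  shows "\<exists>C\<ge>0. \<forall>n. \<zeta> n \<le> C * \<eta> n"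
proof -
  obtain C where C: "\<And>n. \<zeta> n \<le> C * \<eta> n" using assms(1) by (auto simp: big_O_def)
  have "\<zeta> n \<le> max C 0 * \<eta> n" for n
    by (rule order_trans[OF C]) (intro mult_right_mono assms(2) max.cobounded1)
  then show ?thesis by (intro exI[of _ "max C 0"]) simp
qed

lemma le_mult_trans:
  fixes x :: real
  assumes "x \<le> C * y" "y \<le> D * z" "C \<ge> 0"
  shows "x \<le> (C * D) * z"
  using assms(1) mult_left_mono[OF assms(2,3)] by (simp add: mult.assoc)

lemma exists_orthonormal_spanning:
  fixes B :: "'h::complex_hilbert set"
  assumes "finite B"
  shows "\<exists>C. finite C \<and> B \<subseteq> cspan C \<and> (\<forall>b\<in>C. \<forall>c\<in>C. cinner b c = (if b = c then 1 else 0))"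
  using assms
proof (induction B)
  case empty
  show ?case by (rule exI[of _ "{}"]) simp
next
  case (insert x B)
  then obtain C where C: "finite C" "B \<subseteq> cspan C" "\<And>b c. b \<in> C \<Longrightarrow> c \<in> C \<Longrightarrow> cinner b c = (if b = c then 1 else 0)"
    by blast
  \<comment> \<open>Gram-Schmidt: y is the part of x orthogonal to C, and a new vector is added only
    if it is nonzero.\<close>
  define y where "y = x - (\<Sum>c\<in>C. cinner x c *\<^sub>C c)"
  have sumC: "(\<Sum>c\<in>C. cinner x c *\<^sub>C c) \<in> cspan D" if "C \<subseteq> D" for D
    using that by (intro complex_vector.span_sum complex_vector.span_scale complex_vector.span_base) blast
  have yC: "cinner y b = 0" if "b \<in> C" for b
  proof -
    have "cinner (\<Sum>c\<in>C. cinner x c *\<^sub>C c) b = (\<Sum>c\<in>C. if b = c then cinner x c else 0)"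
      unfolding cinner.sum_left by (intro sum.cong) (auto simp: cinner_scaleC_left C(3) that)
    also have "\<dots> = cinner x b" using C(1) that by (subst sum.delta') auto
    finally show ?thesis by (simp add: y_def cinner.diff_left)
  qed
  show ?case
  proof (cases "y = 0")
    case True
    then have "x = (\<Sum>c\<in>C. cinner x c *\<^sub>C c)" by (simp add: y_def)
    then have "x \<in> cspan C" using sumC[of C] by simp
    then show ?thesis using C by (intro exI[of _ C]) simp
  next
    case False
    define z where "z = complex_of_real (1 / norm y) *\<^sub>C y"
    have zz: "cinner z z = 1"
      unfolding norm_eq_1_iff_cinner[symmetric] z_def norm_scaleC norm_of_real using False by simp
    have zC: "cinner z b = 0" "cinner b z = 0" if "b \<in> C" for b
    proof -
      show "cinner z b = 0" by (simp add: z_def cinner_scaleC_left yC[OF that])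
      then show "cinner b z = 0" by (subst cinner_commute) simp
    qed
    have "z \<notin> C" using zz zC(1)[of z] by auto
    let ?D = "insert z C"
    have "complex_of_real (norm y) *\<^sub>C z = complex_of_real (norm y * (1 / norm y)) *\<^sub>C y"
      unfolding z_def scaleC_scaleC of_real_mult ..
    also have "\<dots> = y" using False by (simp add: scaleC_of_real[of 1, simplified])
    finally have "x = complex_of_real (norm y) *\<^sub>C z + (\<Sum>c\<in>C. cinner x c *\<^sub>C c)"
      by (simp add: y_def)
    moreover have "complex_of_real (norm y) *\<^sub>C z + (\<Sum>c\<in>C. cinner x c *\<^sub>C c) \<in> cspan ?D"
      by (intro complex_vector.span_add complex_vector.span_scale complex_vector.span_base sumC) auto
    ultimately have "x \<in> cspan ?D" by simp
    moreover have "B \<subseteq> cspan ?D" using C(2) complex_vector.span_mono[of C ?D] by blast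
    ultimately show ?thesis using C(1,3) zz zC \<open>z \<notin> C\<close> by (intro exI[of _ ?D]) auto
  qed
qed

lemma cspan_orthonormal_expand:
  assumes "finite C" "\<And>b c. b \<in> C \<Longrightarrow> c \<in> C \<Longrightarrow> cinner b c = (if b = c then 1 else 0)" "x \<in> cspan C"
  shows "x = (\<Sum>c\<in>C. cinner x c *\<^sub>C c)"
  using assms(3)
proof (induction rule: complex_vector.span_induct_alt)
  case base
  show ?case by (simp add: cinner.zero_left scaleC.zero_left)
next
  case (step a b y)
  have "(\<Sum>c\<in>C. cinner (a *\<^sub>C b + y) c *\<^sub>C c) = (\<Sum>c\<in>C. (if b = c then a *\<^sub>C c else 0) + cinner y c *\<^sub>C c)"
    using step(1)
    by (intro sum.cong) (auto simp: cinner_add_left cinner_scaleC_left assms(2) scaleC_add_left)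
  also have "\<dots> = a *\<^sub>C b + (\<Sum>c\<in>C. cinner y c *\<^sub>C c)"
    using step(1) assms(1) by (simp add: sum.distrib)
  finally show ?case using step(2) by simp
qed

section \<open>Means, principal ideals and finite rank operators\<close>

context
  fixes e :: "nat \<Rightarrow> 'h::complex_hilbert"
  assumes e: "orthonormal_basis e"
begin

text \<open>The set on the right meets the closure conditions of \<open>calkin_ideal\<close>, and
  ideals with equal characteristic sets coincide; so the definite description in
  \<open>am_ideal\<close> has exactly one solution.\<close>

lemma
  assumes J: "op_ideal (J :: ('h \<Rightarrow> 'h) set)"
  shows op_ideal_am: "op_ideal (am_ideal J)"
    and char_set_am: "char_set (am_ideal J) = {\<xi> \<in> c0star. \<exists>\<eta>\<in>char_set J. big_O \<xi> (amean \<eta>)}"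
proof -
  let ?\<Sigma> = "{\<xi> \<in> c0star. \<exists>\<eta>\<in>char_set J. big_O \<xi> (amean \<eta>)}"
  let ?I = "{X :: 'h \<Rightarrow> 'h. X \<in> compact_ops \<and> s_numbers X \<in> ?\<Sigma>}"
  note c0 = char_set_c0star[OF e J]
  have nn: "0 \<le> amean \<eta> n" if "\<eta> \<in> char_set J" for \<eta> n
    by (rule amean_nonneg[OF c0star_nonneg[OF c0[OF that]]])
  have zero: "(\<lambda>_. 0) \<in> ?\<Sigma>"
    using char_set_zero[OF e J] c0[OF char_set_zero[OF e J]]
    by (auto simp: big_O_def amean_def intro!: bexI[of _ "\<lambda>_. 0"])
  have le: "s \<in> ?\<Sigma>" if t: "t \<in> ?\<Sigma>" and s: "s \<in> c0star" and C: "C \<ge> 0" "\<And>n. s n \<le> C * t n" for s t C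
  proof -
    obtain \<eta> D where "\<eta> \<in> char_set J" and D: "\<And>n. t n \<le> D * amean \<eta> n"
      using t by (auto simp: big_O_def)
    moreover have "s n \<le> (C * D) * amean \<eta> n" for n by (rule le_mult_trans[OF C(2) D C(1)])
    ultimately show ?thesis using s unfolding big_O_def by blast
  qed
  have add: "(\<lambda>n. s n + t n) \<in> ?\<Sigma>" if s: "s \<in> ?\<Sigma>" and t: "t \<in> ?\<Sigma>" for s t
  proof -
    obtain \<eta> where \<eta>: "\<eta> \<in> char_set J" "big_O s (amean \<eta>)" using s by blast
    obtain \<eta>' where \<eta>': "\<eta>' \<in> char_set J" "big_O t (amean \<eta>')" using t by blast
    obtain C where C: "C \<ge> 0" "\<And>n. s n \<le> C * amean \<eta> n" using big_O_nonneg[OF \<eta>(2) nn[OF \<eta>(1)]] by blast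
    obtain D where D: "D \<ge> 0" "\<And>n. t n \<le> D * amean \<eta>' n" using big_O_nonneg[OF \<eta>'(2) nn[OF \<eta>'(1)]] by blast
    \<comment> \<open>The cross terms created by the product on the right are nonnegative.\<close>
    have "s n + t n \<le> (C + D) * amean (\<lambda>n. \<eta> n + \<eta>' n) n" for n
      using C(2)[of n] D(2)[of n] mult_nonneg_nonneg[OF C(1) nn[OF \<eta>'(1), of n]]
        mult_nonneg_nonneg[OF D(1) nn[OF \<eta>(1), of n]]
      by (simp add: amean_add algebra_simps)
    then have "big_O (\<lambda>n. s n + t n) (amean (\<lambda>n. \<eta> n + \<eta>' n))" unfolding big_O_def by blast
    then show ?thesis using s t c0star_add[of s t] char_set_add[OF e J \<eta>(1) \<eta>'(1)] by blast
  qed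
  have ampl: "(\<lambda>n. s (n div 2)) \<in> ?\<Sigma>" if s: "s \<in> ?\<Sigma>" for s
  proof -
    obtain \<eta> where \<eta>: "\<eta> \<in> char_set J" "big_O s (amean \<eta>)" using s by blast
    obtain C where C: "C \<ge> 0" "\<And>n. s n \<le> C * amean \<eta> n" using big_O_nonneg[OF \<eta>(2) nn[OF \<eta>(1)]] by blast
    have "s (n div 2) \<le> (C * 2) * amean \<eta> n" for n
      by (rule le_mult_trans[OF C(2) amean_half_le[OF c0[OF \<eta>(1)]] C(1)])
    then have "big_O (\<lambda>n. s (n div 2)) (amean \<eta>)" unfolding big_O_def by blast
    then show ?thesis using s c0star_ampliation[of s 2] \<eta>(1) by auto
  qed
  have sub: "?\<Sigma> \<subseteq> c0star" by blast
  have I: "op_ideal ?I \<and> char_set ?I = ?\<Sigma>"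
    by (intro conjI calkin_ideal[OF e sub zero]) (fact le add ampl)+
  have "am_ideal J = ?I"
    unfolding am_ideal_def
  proof (rule the_equality)
    show "op_ideal ?I \<and> char_set ?I = ?\<Sigma>" by (rule I)
    fix K :: "('h \<Rightarrow> 'h) set" assume K: "op_ideal K \<and> char_set K = ?\<Sigma>"
    show "K = ?I" by (rule op_ideal_eqI[OF e]) (use K I in simp_all)
  qed
  then show "op_ideal (am_ideal J)" "char_set (am_ideal J) = ?\<Sigma>" using I by simp_all
qed

text \<open>The set on the right belongs to an ideal containing the diagonal operator, hence
  containing the principal ideal. Conversely, an ideal containing that operator admits all
  ampliations of \<open>\<xi>\<close> and everything they dominate.\<close>

lemma
  assumes \<xi>: "\<xi> \<in> c0star"
  shows op_ideal_principal: "op_ideal (principal_ideal e \<xi>)"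
    and char_set_principal: "char_set (principal_ideal e \<xi>) = {\<eta> \<in> c0star. \<exists>m\<ge>1. \<exists>C. \<forall>n. \<eta> n \<le> C * \<xi> (n div m)}"
proof -
  let ?\<Sigma> = "{\<eta> \<in> c0star. \<exists>m\<ge>1. \<exists>C. \<forall>n. \<eta> n \<le> C * \<xi> (n div m)}"
  let ?I = "{X :: 'h \<Rightarrow> 'h. X \<in> compact_ops \<and> s_numbers X \<in> ?\<Sigma>}"
  have memI: "\<eta> \<in> ?\<Sigma>" if "\<eta> \<in> c0star" "m \<ge> 1" "\<And>n. \<eta> n \<le> C * \<xi> (n div m)" for \<eta> m C
    using that by blast
  have memE: "\<exists>m\<ge>1. \<exists>C\<ge>0. \<forall>n. \<eta> n \<le> C * \<xi> (n div m)" if \<eta>: "\<eta> \<in> ?\<Sigma>" for \<eta>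
  proof -
    obtain m C where m: "m \<ge> 1" and C: "\<And>n. \<eta> n \<le> C * \<xi> (n div m)" using \<eta> by blast
    have "\<eta> n \<le> max C 0 * \<xi> (n div m)" for n
      by (rule order_trans[OF C]) (intro mult_right_mono c0star_nonneg[OF \<xi>] max.cobounded1)
    then show ?thesis using m max.cobounded2 by blast
  qed
  have sub: "?\<Sigma> \<subseteq> c0star" by blast
  have zero: "(\<lambda>_. 0) \<in> ?\<Sigma>"
    by (rule memI[of _ 1 0]) (simp_all add: c0star_def decseq_def)
  have le: "s \<in> ?\<Sigma>" if t: "t \<in> ?\<Sigma>" and s: "s \<in> c0star" and C: "C \<ge> 0" "\<And>n. s n \<le> C * t n" for s t C
  proof -
    obtain m D where m: "m \<ge> 1" and D: "\<And>n. t n \<le> D * \<xi> (n div m)" using t by blast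
    show ?thesis by (rule memI[OF s m le_mult_trans[OF C(2) D C(1)]])
  qed
  have add: "(\<lambda>n. s n + t n) \<in> ?\<Sigma>" if s: "s \<in> ?\<Sigma>" and t: "t \<in> ?\<Sigma>" for s t
  proof -
    obtain m C where C: "m \<ge> 1" "C \<ge> 0" "\<And>n. s n \<le> C * \<xi> (n div m)" using memE[OF s] by blast
    obtain k D where D: "k \<ge> 1" "D \<ge> 0" "\<And>n. t n \<le> D * \<xi> (n div k)" using memE[OF t] by blast
    show ?thesis
    proof (rule memI)
      show "(\<lambda>n. s n + t n) \<in> c0star" using s t by (intro c0star_add) blast+
      show "m * k \<ge> 1" using C(1) D(1) by simp
      fix n
      \<comment> \<open>\<open>m * k\<close> is a common ampliation: it lowers the index at least as
        much as m or k alone.\<close>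
      have "\<xi> (n div m) \<le> \<xi> (n div (m * k))" "\<xi> (n div k) \<le> \<xi> (n div (m * k))"
        using C(1) D(1) by (auto intro!: c0star_antimono[OF \<xi>] div_le_mono2)
      then have "C * \<xi> (n div m) \<le> C * \<xi> (n div (m * k))" "D * \<xi> (n div k) \<le> D * \<xi> (n div (m * k))"
        using C(2) D(2) by (auto intro: mult_left_mono)
      then show "s n + t n \<le> (C + D) * \<xi> (n div (m * k))"
        using C(3)[of n] D(3)[of n] unfolding distrib_right by linarith
    qed
  qed
  have ampl: "(\<lambda>n. s (n div 2)) \<in> ?\<Sigma>" if s: "s \<in> ?\<Sigma>" for s
  proof -
    obtain m C where C: "m \<ge> 1" "C \<ge> 0" "\<And>n. s n \<le> C * \<xi> (n div m)" using memE[OF s] by blast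
    show ?thesis
    proof (rule memI)
      show "(\<lambda>n. s (n div 2)) \<in> c0star" using s by (intro c0star_ampliation) auto
      show "2 * m \<ge> 1" using C(1) by simp
      show "s (n div 2) \<le> C * \<xi> (n div (2 * m))" for n using C(3)[of "n div 2"] by (simp add: div_mult2_eq)
    qed
  qed
  have I: "op_ideal ?I" and cI: "char_set ?I = ?\<Sigma>"
    by (rule calkin_ideal[OF e sub zero]; fact le add ampl)+
  have \<xi>\<Sigma>: "\<xi> \<in> ?\<Sigma>" by (rule memI[OF \<xi>, of 1 1]) simp_all
  have dI: "diag_op e \<xi> \<in> ?I" using diag_op_mem_iff[OF e I \<xi>] \<xi>\<Sigma> cI by blast
  have dc: "{diag_op e \<xi>} \<subseteq> carrier BH" by (simp add: BH_def bounded_clinear_diag[OF e \<xi>])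
  have iP: "ideal (principal_ideal e \<xi>) BH" unfolding principal_ideal_def
    by (rule ring.genideal_ideal[OF ring_BH dc])
  have dP: "diag_op e \<xi> \<in> principal_ideal e \<xi>" unfolding principal_ideal_def
    by (rule ring.genideal_self'[OF ring_BH]) (use dc in simp)
  have PI: "principal_ideal e \<xi> \<subseteq> ?I" unfolding principal_ideal_def
    by (rule ring.genideal_minimal[OF ring_BH]) (use I dI in \<open>simp_all add: op_ideal_def\<close>)
  have "?I \<subseteq> compact_ops" by blast
  then show P: "op_ideal (principal_ideal e \<xi>)" unfolding op_ideal_def using iP PI by (meson order_trans)
  have \<xi>P: "\<xi> \<in> char_set (principal_ideal e \<xi>)" using diag_op_mem_iff[OF e P \<xi>] dP by blast
  show "char_set (principal_ideal e \<xi>) = ?\<Sigma>"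
  proof
    show "char_set (principal_ideal e \<xi>) \<subseteq> ?\<Sigma>"
      using op_ideal_subset_iff[OF e P I] PI unfolding cI by blast
    show "?\<Sigma> \<subseteq> char_set (principal_ideal e \<xi>)"
    proof
      fix \<eta> assume "\<eta> \<in> ?\<Sigma>"
      then obtain m C where m: "\<eta> \<in> c0star" "m \<ge> 1" and C: "\<And>n. \<eta> n \<le> C * \<xi> (n div m)" by blast
      show "\<eta> \<in> char_set (principal_ideal e \<xi>)"
        by (rule char_set_le[OF e P char_set_ampliation[OF e P \<xi>P m(2)] m(1) C])
    qed
  qed
qed

text \<open>Projecting onto a finite orthonormal set C around the range writes X as a finite sum of
  compact operators. X vanishes on the common kernel of the \<open>card C\<close> coordinate
  functionals, so the minimax bound gives s-number 0 at index \<open>card C\<close>.\<close>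

lemma finite_rank_op_system:
  assumes "X \<in> finite_rank_ops"
  shows "(X :: 'h \<Rightarrow> 'h) \<in> compact_ops" "\<exists>N. \<forall>n\<ge>N. s_numbers X n = 0"
proof -
  have X: "bounded_clinear X" using assms by (simp add: finite_rank_ops_def)
  obtain B where "finite B" and B: "range X \<subseteq> cspan B" using assms by (auto simp: finite_rank_ops_def)
  obtain C where C: "finite C" "B \<subseteq> cspan C" "\<And>b c. b \<in> C \<Longrightarrow> c \<in> C \<Longrightarrow> cinner b c = (if b = c then 1 else 0)"
    using exists_orthonormal_spanning[OF \<open>finite B\<close>] by blast
  have "cspan B \<subseteq> cspan C" by (rule complex_vector.span_minimal[OF C(2) complex_vector.subspace_span])
  then have XC: "X x \<in> cspan C" for x using B by blast
  have X_eq: "X x = (\<Sum>c\<in>C. cinner (X x) c *\<^sub>C c)" for x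
    by (rule cspan_orthonormal_expand[OF C(1,3) XC])
  have "(\<lambda>x. \<Sum>c\<in>C. (id \<circ> (\<lambda>y. cinner y c *\<^sub>C c) \<circ> X) x) \<in> compact_ops"
    by (intro compact_ops_sum compact_ops_comp compact_ops_rank_one bounded_clinear_id X)
  then show Xc: "X \<in> compact_ops" by (simp add: X_eq[symmetric])
  obtain u where u: "singular_system X (s_numbers X) u" using s_numbers_system[OF e Xc] by blast
  obtain h :: "nat \<Rightarrow> 'h" where h: "bij_betw h {0..<card C} C" using ex_bij_betw_nat_finite[OF C(1)] by blast
  have "s_numbers X (card C) \<le> 0"
  proof (rule ss_minimax[OF u, of _ "\<lambda>i x. cinner (X x) (h i)"])
    fix x assume *: "\<And>i. i < card C \<Longrightarrow> cinner (X x) (h i) = 0"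
    have "cinner (X x) c = 0" if "c \<in> C" for c
    proof -
      have "c \<in> h ` {0..<card C}" using h that by (simp add: bij_betw_def)
      then show ?thesis using * by auto
    qed
    then have "X x = 0" using X_eq[of x] by (simp add: scaleC.zero_left)
    then show "norm (X x) \<le> 0 * norm x" by simp
  qed (simp_all add: bounded_clinear_lin[OF X] cinner_add_left cinner_scaleC_left)
  then have "s_numbers X n = 0" if "n \<ge> card C" for n
    using c0star_antimono[OF ss_c0[OF u] that] c0star_nonneg[OF ss_c0[OF u], of n] by linarith
  then show "\<exists>N. \<forall>n\<ge>N. s_numbers X n = 0" by blast
qed

lemma
  shows op_ideal_finite_rank: "op_ideal (finite_rank_ops :: ('h \<Rightarrow> 'h) set)"
    and char_set_finite_rank: "char_set (finite_rank_ops :: ('h \<Rightarrow> 'h) set) = {s \<in> c0star. \<exists>N. \<forall>n\<ge>N. s n = 0}"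
proof -
  let ?\<Sigma> = "{s \<in> c0star. \<exists>N. \<forall>n\<ge>N. s n = 0}"
  let ?I = "{X :: 'h \<Rightarrow> 'h. X \<in> compact_ops \<and> s_numbers X \<in> ?\<Sigma>}"
  have sub: "?\<Sigma> \<subseteq> c0star" by blast
  have zero: "(\<lambda>_. 0) \<in> ?\<Sigma>" by (auto simp: c0star_def decseq_def)
  have le: "s \<in> ?\<Sigma>" if t: "t \<in> ?\<Sigma>" and s: "s \<in> c0star" and C: "C \<ge> 0" "\<And>n. s n \<le> C * t n" for s t C
  proof -
    obtain N where N: "\<And>n. n \<ge> N \<Longrightarrow> t n = 0" using t by blast
    have "s n = 0" if "n \<ge> N" for n
      using C(2)[of n] N[OF that] c0star_nonneg[OF s, of n] by simp
    then show ?thesis using s by blast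
  qed
  have add: "(\<lambda>n. s n + t n) \<in> ?\<Sigma>" if s: "s \<in> ?\<Sigma>" and t: "t \<in> ?\<Sigma>" for s t
  proof -
    obtain N M where "\<And>n. n \<ge> N \<Longrightarrow> s n = 0" "\<And>n. n \<ge> M \<Longrightarrow> t n = 0" using s t by blast
    then have "\<forall>n\<ge>max N M. s n + t n = 0" by simp
    then show ?thesis using s t c0star_add[of s t] by blast
  qed
  have ampl: "(\<lambda>n. s (n div 2)) \<in> ?\<Sigma>" if s: "s \<in> ?\<Sigma>" for s
  proof -
    obtain N where "\<And>n. n \<ge> N \<Longrightarrow> s n = 0" using s by blast
    then have "\<forall>n\<ge>2 * N. s (n div 2) = 0" by simp
    then show ?thesis using s c0star_ampliation[of s 2] by auto
  qed
  have I: "op_ideal ?I" "char_set ?I = ?\<Sigma>"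
    by (rule calkin_ideal[OF e sub zero]; fact le add ampl)+
  have "finite_rank_ops = ?I"
  proof
    show "finite_rank_ops \<subseteq> ?I"
      using finite_rank_op_system s_numbers_c0star[OF e] by blast
    show "?I \<subseteq> finite_rank_ops"
    proof
      fix X :: "'h \<Rightarrow> 'h" assume X: "X \<in> ?I"
      then have Xc: "X \<in> compact_ops" by blast
      obtain N where N: "\<And>n. n \<ge> N \<Longrightarrow> s_numbers X n = 0" using X by blast
      obtain u where u: "singular_system X (s_numbers X) u" using s_numbers_system[OF e Xc] by blast
      have "X x \<in> cspan ((\<lambda>n. X (u n)) ` {..<N})" for x
      proof -
        have "X (u n) = 0" if "n \<ge> N" for n using ss_norm[OF u, of n] N[OF that] by simp
        then have "X x = (\<Sum>n<N. cinner x (u n) *\<^sub>C X (u n))"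
          unfolding ss_expand[OF u, of x] series_op_def
          by (intro suminf_finite) (auto simp: scaleC.zero_right not_less)
        also have "\<dots> \<in> cspan ((\<lambda>n. X (u n)) ` {..<N})"
          by (intro complex_vector.span_sum complex_vector.span_scale complex_vector.span_base) simp
        finally show ?thesis .
      qed
      then have "range X \<subseteq> cspan ((\<lambda>n. X (u n)) ` {..<N})" by blast
      then show "X \<in> finite_rank_ops"
        unfolding finite_rank_ops_def using compact_ops_bounded[OF Xc] by blast
    qed
  qed
  then show "op_ideal (finite_rank_ops :: ('h \<Rightarrow> 'h) set)" "char_set (finite_rank_ops :: ('h \<Rightarrow> 'h) set) = ?\<Sigma>"
    using I by simp_all
qed

text \<open>One direction tests the inclusion at \<open>amean \<xi>\<close> itself. In the other, a
  sequence of the principal ideal is dominated by an ampliation of \<open>\<xi>\<close>, whose mean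
  is at most m times \<open>amean \<xi>\<close>.\<close>

lemma am_principal_subset_iff:
  assumes \<xi>: "\<xi> \<in> c0star" and J: "op_ideal J"
  shows "am_ideal (principal_ideal e \<xi>) \<subseteq> am_ideal J \<longleftrightarrow>
    (\<exists>\<eta>\<in>char_set J. \<exists>C\<ge>0. \<forall>n. amean \<xi> n \<le> C * amean \<eta> n)"
proof -
  note P = op_ideal_principal[OF \<xi>]
  have nn: "0 \<le> amean \<eta> n" if "\<eta> \<in> char_set J" for \<eta> n
    by (rule amean_nonneg[OF c0star_nonneg[OF char_set_c0star[OF e J that]]])
  have iff: "am_ideal (principal_ideal e \<xi>) \<subseteq> am_ideal J \<longleftrightarrow>
    char_set (am_ideal (principal_ideal e \<xi>)) \<subseteq> char_set (am_ideal J)"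
    by (rule op_ideal_subset_iff[OF e op_ideal_am[OF P] op_ideal_am[OF J]])
  show ?thesis
    unfolding iff
  proof
    assume sub: "char_set (am_ideal (principal_ideal e \<xi>)) \<subseteq> char_set (am_ideal J)"
    have "\<xi> \<in> char_set (principal_ideal e \<xi>)"
      unfolding char_set_principal[OF \<xi>] using \<xi> by (auto intro!: exI[of _ 1])
    moreover have "big_O (amean \<xi>) (amean \<xi>)" unfolding big_O_def by (rule exI[of _ 1]) simp
    ultimately have "amean \<xi> \<in> char_set (am_ideal (principal_ideal e \<xi>))"
      unfolding char_set_am[OF P] using amean_c0star[OF \<xi>] by blast
    then have "amean \<xi> \<in> char_set (am_ideal J)" using sub by blast
    then obtain \<eta> where \<eta>: "\<eta> \<in> char_set J" "big_O (amean \<xi>) (amean \<eta>)" unfolding char_set_am[OF J] by blast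
    then show "\<exists>\<eta>\<in>char_set J. \<exists>C\<ge>0. \<forall>n. amean \<xi> n \<le> C * amean \<eta> n"
      using big_O_nonneg[OF \<eta>(2) nn[OF \<eta>(1)]] by blast
  next
    assume "\<exists>\<eta>\<in>char_set J. \<exists>C\<ge>0. \<forall>n. amean \<xi> n \<le> C * amean \<eta> n"
    then obtain \<eta> C where \<eta>: "\<eta> \<in> char_set J" and C: "C \<ge> 0" "\<And>n. amean \<xi> n \<le> C * amean \<eta> n" by blast
    show "char_set (am_ideal (principal_ideal e \<xi>)) \<subseteq> char_set (am_ideal J)"
    proof
      fix \<zeta> assume "\<zeta> \<in> char_set (am_ideal (principal_ideal e \<xi>))"
      then obtain \<theta> where \<zeta>: "\<zeta> \<in> c0star" and \<theta>: "\<theta> \<in> char_set (principal_ideal e \<xi>)" "big_O \<zeta> (amean \<theta>)"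
        unfolding char_set_am[OF P] by blast
      then obtain m D where \<theta>0: "\<theta> \<in> c0star" and m: "m \<ge> 1" and D: "\<And>n. \<theta> n \<le> D * \<xi> (n div m)"
        unfolding char_set_principal[OF \<xi>] by blast
      obtain E where E: "E \<ge> 0" "\<And>n. \<zeta> n \<le> E * amean \<theta> n"
        using big_O_nonneg[OF \<theta>(2) amean_nonneg[OF c0star_nonneg[OF \<theta>0]]] by blast
      have D': "\<theta> n \<le> max D 0 * \<xi> (n div m)" for n
        by (rule order_trans[OF D]) (intro mult_right_mono c0star_nonneg[OF \<xi>] max.cobounded1)
      have 1: "amean \<theta> n \<le> (max D 0 * real m) * amean \<xi> n" for n
        by (rule le_mult_trans[OF amean_mono_scaled[OF D'] amean_ampliation_le[OF \<xi> m] max.cobounded2])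
      have 2: "amean \<theta> n \<le> (max D 0 * real m * C) * amean \<eta> n" for n
        by (rule le_mult_trans[OF 1 C(2)]) simp
      have "\<zeta> n \<le> (E * (max D 0 * real m * C)) * amean \<eta> n" for n
        by (rule le_mult_trans[OF E(2) 2 E(1)])
      then have "big_O \<zeta> (amean \<eta>)" unfolding big_O_def by blast
      then show "\<zeta> \<in> char_set (am_ideal J)" unfolding char_set_am[OF J] using \<zeta> \<eta> by blast
    qed
  qed
qed

section \<open>The two cases of the theorem\<close>

lemma hat_principal_summable:
  assumes \<xi>: "\<xi> \<in> c0star" "\<xi> \<noteq> (\<lambda>_. 0)" and s: "summable \<xi>"
  shows "hat_ideal (principal_ideal e \<xi>) = finite_rank_ops"
proof
  let ?\<delta> = "\<lambda>n :: nat. if n = 0 then 1 else 0 :: real"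
  have "?\<delta> \<in> c0star"
  proof (rule c0starI)
    have "(\<lambda>n. ?\<delta> (Suc n)) \<longlonglongrightarrow> 0" by simp
    then show "?\<delta> \<longlonglongrightarrow> 0" by (rule LIMSEQ_imp_Suc[of ?\<delta>])
  qed simp_all
  moreover have "\<forall>n\<ge>1. ?\<delta> n = 0" by simp
  ultimately have "?\<delta> \<in> char_set (finite_rank_ops :: ('h \<Rightarrow> 'h) set)"
    unfolding char_set_finite_rank by blast
  moreover have "suminf \<xi> \<ge> 0" by (rule suminf_nonneg[OF s c0star_nonneg[OF \<xi>(1)]])
  ultimately have "am_ideal (principal_ideal e \<xi>) \<subseteq> am_ideal finite_rank_ops"
    unfolding am_principal_subset_iff[OF \<xi>(1) op_ideal_finite_rank]
    using amean_le_of_summable[OF \<xi>(1) s] by blast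
  then show "hat_ideal (principal_ideal e \<xi>) \<subseteq> finite_rank_ops"
    unfolding hat_ideal_def using op_ideal_finite_rank by blast
  show "finite_rank_ops \<subseteq> hat_ideal (principal_ideal e \<xi>)"
    unfolding hat_ideal_def
  proof (rule Inter_greatest)
    fix J :: "('h \<Rightarrow> 'h) set"
    assume "J \<in> {J. op_ideal J \<and> am_ideal (principal_ideal e \<xi>) \<subseteq> am_ideal J}"
    then have J: "op_ideal J" and "am_ideal (principal_ideal e \<xi>) \<subseteq> am_ideal J" by blast+
    then obtain \<eta> C where \<eta>: "\<eta> \<in> char_set J" and C: "C \<ge> 0" "\<And>n. amean \<xi> n \<le> C * amean \<eta> n"
      unfolding am_principal_subset_iff[OF \<xi>(1) J] by blast
    note \<eta>0 = char_set_c0star[OF e J \<eta>]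
    \<comment> \<open>At index 0 the means are the first terms, so \<open>\<eta> 0 = 0\<close> would
      force \<open>\<xi>\<close> to vanish.\<close>
    have "\<eta> 0 \<noteq> 0"
    proof
      assume "\<eta> 0 = 0"
      then have "\<xi> 0 \<le> 0" using C(2)[of 0] by (simp add: amean_def)
      then have "\<xi> n = 0" for n
        using c0star_antimono[OF \<xi>(1), of 0 n] c0star_nonneg[OF \<xi>(1), of n] by simp
      then show False using \<xi>(2) by blast
    qed
    then have \<eta>pos: "\<eta> 0 > 0" using c0star_nonneg[OF \<eta>0, of 0] by simp
    show "finite_rank_ops \<subseteq> J"
      unfolding op_ideal_subset_iff[OF e op_ideal_finite_rank J]
    proof
      fix \<zeta> assume "\<zeta> \<in> char_set (finite_rank_ops :: ('h \<Rightarrow> 'h) set)"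
      then obtain N where \<zeta>: "\<zeta> \<in> c0star" and N: "\<And>n. n \<ge> N \<Longrightarrow> \<zeta> n = 0"
        unfolding char_set_finite_rank by blast
      \<comment> \<open>Ampliation by \<open>Suc N\<close> spreads \<open>\<eta> 0\<close> over all
        indices up to N, beyond the support of \<open>\<zeta>\<close>.\<close>
      have le: "\<zeta> n \<le> (\<zeta> 0 / \<eta> 0) * \<eta> (n div Suc N)" for n
      proof (cases "n \<ge> N")
        case True
        then show ?thesis using N[OF True] c0star_nonneg[OF \<zeta>, of 0] \<eta>pos c0star_nonneg[OF \<eta>0] by simp
      next
        case False
        then have "n div Suc N = 0" by simp
        then show ?thesis using c0star_antimono[OF \<zeta>, of 0 n] \<eta>pos by simp
      qed
      show "\<zeta> \<in> char_set J"
        by (rule char_set_le[OF e J char_set_ampliation[OF e J \<eta>, of "Suc N"] \<zeta> le]) simp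
    qed
  qed
qed

lemma hat_principal_nonsummable:
  assumes \<xi>: "\<xi> \<in> c0star" and ns: "\<not> summable \<xi>"
  shows "hat_ideal (principal_ideal e \<xi>) = principal_ideal e (hat_seq \<xi>)"
proof
  note h = hat_seq_c0star[OF \<xi> ns]
  show "principal_ideal e (hat_seq \<xi>) \<subseteq> hat_ideal (principal_ideal e \<xi>)"
    unfolding hat_ideal_def
  proof (rule Inter_greatest)
    fix J :: "('h \<Rightarrow> 'h) set"
    assume "J \<in> {J. op_ideal J \<and> am_ideal (principal_ideal e \<xi>) \<subseteq> am_ideal J}"
    then have J: "op_ideal J" and "am_ideal (principal_ideal e \<xi>) \<subseteq> am_ideal J" by blast+
    then obtain \<eta> C where \<eta>: "\<eta> \<in> char_set J" and C: "C \<ge> 0" "\<And>n. amean \<xi> n \<le> C * amean \<eta> n"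
      unfolding am_principal_subset_iff[OF \<xi> J] by blast
    obtain m D where m: "m \<ge> 1" and D: "\<And>n. hat_seq \<xi> n \<le> D * \<eta> (n div m)"
      using hat_seq_big_O_of_amean[OF \<xi> ns char_set_c0star[OF e J \<eta>] C(2,1)] by blast
    have "hat_seq \<xi> \<in> char_set J"
      by (rule char_set_le[OF e J char_set_ampliation[OF e J \<eta> m] h D])
    then have "diag_op e (hat_seq \<xi>) \<in> J" using diag_op_mem_iff[OF e J h] by blast
    then show "principal_ideal e (hat_seq \<xi>) \<subseteq> J"
      unfolding principal_ideal_def using J
      by (intro ring.genideal_minimal[OF ring_BH]) (simp_all add: op_ideal_def)
  qed
  show "hat_ideal (principal_ideal e \<xi>) \<subseteq> principal_ideal e (hat_seq \<xi>)"
  proof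
    fix X assume X: "X \<in> hat_ideal (principal_ideal e \<xi>)"
    have mem: "X \<in> J" if "op_ideal J" "am_ideal (principal_ideal e \<xi>) \<subseteq> am_ideal J" for J
      using X that unfolding hat_ideal_def by blast
    \<comment> \<open>The ideal of \<open>\<xi>\<close> is itself among those intersected.\<close>
    have Xc: "X \<in> compact_ops"
      using op_ideal_compact[OF op_ideal_principal[OF \<xi>] mem[OF op_ideal_principal[OF \<xi>]]] by blast
    define \<zeta> where "\<zeta> = s_numbers X"
    have \<zeta>: "\<zeta> \<in> c0star" unfolding \<zeta>_def by (rule s_numbers_c0star[OF e Xc])
    have "\<zeta> \<in> char_set (principal_ideal e (hat_seq \<xi>))"
    proof (rule ccontr)
      assume "\<zeta> \<notin> char_set (principal_ideal e (hat_seq \<xi>))"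
      then have "\<not> (\<exists>m\<ge>1. \<exists>C. \<forall>n. \<zeta> n \<le> C * hat_seq \<xi> (n div m))"
        unfolding char_set_principal[OF h] using \<zeta> by blast
      then have not: "\<exists>n. C * hat_seq \<xi> (n div m) < \<zeta> n" if "m \<ge> 1" for m C
        using that by (meson not_le)
      obtain \<eta> C where \<eta>: "\<eta> \<in> c0star" and C: "\<And>n. amean \<xi> n \<le> C * amean \<eta> n"
        and far: "\<And>m C. m \<ge> 1 \<Longrightarrow> \<exists>n. C * \<eta> (n div m) < \<zeta> n"
        using exists_amean_dominating[OF \<xi> ns \<zeta> not] by blast
      note P = op_ideal_principal[OF \<eta>]
      have "\<eta> \<in> char_set (principal_ideal e \<eta>)"
        using \<eta> unfolding char_set_principal[OF \<eta>] by (auto intro!: exI[of _ 1])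
      moreover have "\<exists>C\<ge>0. \<forall>n. amean \<xi> n \<le> C * amean \<eta> n"
        by (rule big_O_nonneg) (use C in \<open>auto simp: big_O_def intro: amean_nonneg[OF c0star_nonneg[OF \<eta>]]\<close>)
      \<comment> \<open>The ideal of \<open>\<eta>\<close> takes part in the intersection and so
        contains X, although \<open>far\<close> keeps the s-numbers of X out of its characteristic
        set.\<close>
      ultimately have "X \<in> principal_ideal e \<eta>"
        by (intro mem[OF P]) (unfold am_principal_subset_iff[OF \<xi> P], blast)
      then have "\<zeta> \<in> char_set (principal_ideal e \<eta>)" unfolding \<zeta>_def char_set_def by (rule imageI)
      then show False unfolding char_set_principal[OF \<eta>] using far by (auto simp: not_less[symmetric])
    qed
    then show "X \<in> principal_ideal e (hat_seq \<xi>)"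
      using Xc unfolding op_ideal_mem_iff[OF e op_ideal_principal[OF h]] \<zeta>_def by blast
  qed
qed

end

theorem corollary6p15:
  fixes e :: "nat \<Rightarrow> 'h::complex_hilbert" and \<xi> :: "nat \<Rightarrow> real"
  assumes "separable_space (euclidean :: 'h topology)"
    and "infinite_dimensional TYPE('h)"
    and "orthonormal_basis e"
    and "\<xi> \<in> c0star" and "\<xi> \<noteq> (\<lambda>_. 0)"
  shows "hat_ideal (principal_ideal e \<xi>) =
           (if summable \<xi> then finite_rank_ops else principal_ideal e (hat_seq \<xi>))"
  using hat_principal_summable[OF assms(3-5)] hat_principal_nonsummable[OF assms(3,4)] by simp

end
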